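(* Let $n\ge1$ and $q\ge 1$. A basis over $K(n)^*$ (in the topological sense) for the quotient ring $$K(n)^*[[c_1,\ldots,c_q]]/(c_1-c_1^*,\,c_2-c_2^*,\,\ldots,\,c_q-c_q^* )$$ is given, in terms of symmetric functions in $x_1,\ldots,x_q$, by the (images of the) distinct symmetric functions of the form $$s_{IJ}=\sum x_1^{i_1}\cdots x_m^{i_m}\,x_{m+1}^{j_1}\cdots x_{m+p}^{j_p},$$ where $m,p\ge 0$, $m+p\le q$, $p$ is even, $I=(i_1,\ldots,i_m)$ satisfies $0<i_1<\cdots<i_m<2^n$, and $J=(j_1,\ldots,j_p)$ satisfies $0\le j_1\le\cdots\le j_p$ with $j_{2i-1}=j_{2i}$ for all $1\le i\le p/2$. Here the sum runs over all distinct monomials in $x_1,\ldots,x_q$ obtained from the displayed monomial by permuting the variables $x_1,\ldots,x_q$.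
   Context: $K(n)$ is Morava $K$-theory at the prime $2$, with $K(n)_*=\mathbb{Z}/2[v_n^{\pm1}]$, $v_n$ of homological degree $2(2^n-1)$ (so of cohomological degree $-2(2^n-1)$), and $K(n)^*$ its coefficient ring graded cohomologically. It is complex oriented, with $K(n)^*(\mathbb{CP}^\infty)\cong K(n)^*[[x]]$, $x$ of degree $2$, the complex orientation and formal group law $F$ being those induced from $BP$ at the prime $2$ (so $F$ has $2$-series $[2]_F(x)=v_nx^{2^n}$). One has $K(n)^*(\prod^q\mathbb{CP}^\infty)\cong K(n)^*[[x_1,\ldots,x_q]]$ with all $x_i$ of degree $2$, and $K(n)^*(BU(q))\cong K(n)^*[[c_1,\ldots,c_q]]$ is identified with the subring of symmetric power series, where $c_k$ (the $k$-th Conner-Floyd Chern class, of degree $2k$) is the $k$-th elementary symmetric function in $x_1,\ldots,x_q$. The complex conjugate $c_k^*$ of $c_k$ is the $k$-th elementary symmetric function of $[-1]_F(x_1),\ldots,[-1]_F(x_q)$, where $[-1]_F$ is the formal inverse for $F$; it is a symmetric power series in the $x_i$, hence an element of $K(n)^*[[c_1,\ldots,c_q]]$. Power series rings are taken in the graded sense: homogeneous elements may be infinite sums. The quotient ring carries the quotient of the power series topology, and "basis" is meant in the topological sense: each homogeneous element of the quotient is uniquely a possibly infinite, convergent $K(n)^*$-linear combination of the listed elements (homogeneous of its degree). *)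

theory Defs
  imports
    "HOL-Library.Z2"
    "HOL-Library.Poly_Mapping"
    "HOL-Combinatorics.Permutations"
    "HOL-Computational_Algebra.Formal_Power_Series"
    "HOL-Algebra.QuotRing"
    "HOL-Analysis.Abstract_Limits"
    "HOL-Analysis.Function_Topology"
begin

section \<open>Power series in several variables\<close>

text \<open>A power series in the variables \<open>x\<^sub>k\<close> (\<open>k :: nat\<close>) is the function sending a monomial, i.e. a
  finitely supported exponent function, to its coefficient. \<open>q\<close>-variable power series only involve
  monomials in \<open>x\<^sub>1, \<dots>, x\<^sub>q\<close>.\<close>

type_synonym monom = "nat \<Rightarrow>\<^sub>0 nat"
type_synonym 'a mps = "monom \<Rightarrow> 'a"

definition mps_ring :: "('a::comm_ring_1) mps ring" where
  "mps_ring = \<lparr> carrier = UNIV,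
     monoid.mult = (\<lambda>f g M. \<Sum>(A, B) | A + B = M. f A * g B),
     one = (\<lambda>M. if M = 0 then 1 else 0),
     zero = (\<lambda>M. 0),
     add = (\<lambda>f g M. f M + g M) \<rparr>"

definition mps_const :: "'a::comm_ring_1 \<Rightarrow> 'a mps" where
  "mps_const a = (\<lambda>M. if M = 0 then a else 0)"

definition mps_var :: "nat \<Rightarrow> ('a::comm_ring_1) mps" where
  "mps_var k = (\<lambda>M. if M = Poly_Mapping.single k 1 then 1 else 0)"

definition total_degree :: "monom \<Rightarrow> nat" where
  "total_degree M = (\<Sum>k\<in>Poly_Mapping.keys M. Poly_Mapping.lookup M k)"

text \<open>The substitution \<open>g(f)\<close>, meaningful when \<open>f\<close> has zero constant term: then the powers \<open>f\<^sup>j\<close> with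
  \<open>j > total_degree M\<close> do not contribute to the coefficient of \<open>M\<close>.\<close>

definition fps_subst :: "'a::comm_ring_1 fps \<Rightarrow> 'a mps \<Rightarrow> 'a mps" where
  "fps_subst g f =
     (\<lambda>M. \<Sum>j\<le>total_degree M. fps_nth g j * (f [^]\<^bsub>mps_ring\<^esub> (j::nat)) M)"

definition elem_sym :: "nat \<Rightarrow> nat \<Rightarrow> (nat \<Rightarrow> ('a::comm_ring_1) mps) \<Rightarrow> 'a mps" where
  "elem_sym q k y =
     (\<Oplus>\<^bsub>mps_ring\<^esub>S\<in>{S. S \<subseteq> {1..q} \<and> card S = k}. \<Otimes>\<^bsub>mps_ring\<^esub>j\<in>S. y j)"


section \<open>The formal group law of Morava K-theory at the prime 2\<close>

text \<open>\<open>int \<Rightarrow>\<^sub>0 'a\<close> is the ring of Laurent polynomials over \<open>'a\<close> in one variable, here \<open>v\<^sub>n\<close>; so the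
  coefficient ring \<open>\<int>/2[v\<^sub>n, v\<^sub>n\<^sup>-\<^sup>1]\<close> of \<open>K(n)\<close> is the following.\<close>

type_synonym K_coeff = "int \<Rightarrow>\<^sub>0 bit"

text \<open>The logarithm \<open>\<Sum>\<^sub>k m\<^sub>k x\<^bsup>2^k\<^esup>\<close> of the formal group law of \<open>BP\<close> at \<open>2\<close>, in terms of the Hazewinkel
  generators \<open>v 1, v 2, \<dots>\<close>, is given by Hazewinkel's formula
  \<open>2 m\<^sub>k = \<Sum>\<^bsub>0\<le>i<k\<^esub> m\<^sub>i v\<^bsub>k-i\<^esub>\<^bsup>2^i\<^esup>\<close>. (The Araki generators agree with these modulo \<open>2\<close>, so they
  induce the same formal group law on \<open>K(n)\<close>.)\<close>

fun BP_log_coeff :: "(nat \<Rightarrow> (int \<Rightarrow>\<^sub>0 rat)) \<Rightarrow> nat \<Rightarrow> (int \<Rightarrow>\<^sub>0 rat)" where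
  "BP_log_coeff v 0 = 1"
| "BP_log_coeff v (Suc k) =
     Poly_Mapping.single 0 (1/2) * (\<Sum>i\<le>k. BP_log_coeff v i * v (Suc k - i) ^ (2 ^ i))"

definition BP_log :: "(nat \<Rightarrow> (int \<Rightarrow>\<^sub>0 rat)) \<Rightarrow> (int \<Rightarrow>\<^sub>0 rat) fps" where
  "BP_log v = Abs_fps (\<lambda>j. \<Sum>k | 2 ^ k = j. BP_log_coeff v k)"

text \<open>The formal group law with logarithm \<open>l\<close>, as a power series in \<open>x = x\<^sub>1\<close> and \<open>y = x\<^sub>2\<close>: the unique
  series \<open>F\<close> with \<open>F(0,0) = 0\<close> and \<open>l(F(x,y)) = l(x) + l(y)\<close>.\<close>

definition FGL_of_log :: "'a::comm_ring_1 fps \<Rightarrow> 'a mps" where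
  "FGL_of_log l = (THE F. F 0 = 0 \<and>
     fps_subst l F = fps_subst l (mps_var 1) \<oplus>\<^bsub>mps_ring\<^esub> fps_subst l (mps_var 2))"

text \<open>Reduction modulo \<open>2\<close> of a rational number with odd denominator: the denominator in lowest terms
  becomes \<open>1\<close>.\<close>

definition rat_mod2 :: "rat \<Rightarrow> bit" where
  "rat_mod2 r = of_int (fst (quotient_of r))"

text \<open>The formal group law of \<open>K(n)\<close> is induced from that of \<open>BP\<close> by \<open>v\<^sub>i \<mapsto> 0\<close> for \<open>i \<noteq> n\<close> and reduction
  modulo \<open>2\<close>. The intermediate formal group law over \<open>\<rat>[v\<^sub>n]\<close> has coefficients in \<open>\<int>\<^sub>(\<^sub>2\<^sub>)[v\<^sub>n]\<close>, so the
  coefficientwise reduction is the pushforward along \<open>\<int>\<^sub>(\<^sub>2\<^sub>)[v\<^sub>n] \<rightarrow> \<int>/2[v\<^sub>n, v\<^sub>n\<^sup>-\<^sup>1]\<close>.\<close>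

definition K_FGL :: "nat \<Rightarrow> K_coeff mps" where
  "K_FGL n = (\<lambda>M. Poly_Mapping.map rat_mod2
     (FGL_of_log (BP_log (\<lambda>i. if i = n then Poly_Mapping.single 1 1 else 0)) M))"

text \<open>The formal inverse \<open>\<iota> = [-1]\<^sub>F\<close>, the unique \<open>\<iota>\<close> with \<open>\<iota>(0) = 0\<close> and \<open>F(x, \<iota>(x)) = 0\<close>.\<close>

definition formal_inverse :: "'a::comm_ring_1 mps \<Rightarrow> 'a fps" where
  "formal_inverse F = (THE \<iota>. fps_nth \<iota> 0 = 0 \<and>
     (\<forall>N. (\<Sum>a\<le>N. \<Sum>b\<le>N. F (Poly_Mapping.single 1 a + Poly_Mapping.single 2 b) *
              fps_nth (fps_X ^ a * \<iota> ^ b) N) = 0))"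


section \<open>The ring \<open>K(n)\<^sup>*(BU(q))\<close> and its quotient\<close>

text \<open>The set of cohomological degrees in which \<open>f\<close> has a nonzero component, where \<open>x\<^sub>i\<close> has degree \<open>2\<close>
  and \<open>v\<^sub>n\<close> has degree \<open>-2(2\<^sup>n - 1)\<close>. Hence \<open>f\<close> is homogeneous of degree \<open>d\<close> iff \<open>degrees n f \<subseteq> {d}\<close>,
  and \<open>f\<close> is a finite sum of homogeneous power series (i.e. belongs to the power series ring in the
  graded sense) iff \<open>degrees n f\<close> is finite.\<close>

definition degrees :: "nat \<Rightarrow> K_coeff mps \<Rightarrow> int set" where
  "degrees n f =
     {2 * int (total_degree M) - 2 * (2 ^ n - 1) * k | M k. k \<in> Poly_Mapping.keys (f M)}"

text \<open>\<open>K(n)\<^sup>*[[c\<^sub>1,\<dots>,c\<^sub>q]]\<close>, identified with the ring of symmetric power series in \<open>x\<^sub>1,\<dots>,x\<^sub>q\<close>.\<close>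

definition K_BU :: "nat \<Rightarrow> nat \<Rightarrow> K_coeff mps ring" where
  "K_BU n q = mps_ring \<lparr> carrier := {f.
     (\<forall>M. f M \<noteq> 0 \<longrightarrow> Poly_Mapping.keys M \<subseteq> {1..q}) \<and>
     (\<forall>\<sigma> M. \<sigma> permutes {1..q} \<longrightarrow> f (Poly_Mapping.map_key \<sigma> M) = f M) \<and>
     finite (degrees n f)} \<rparr>"

definition chern :: "nat \<Rightarrow> nat \<Rightarrow> K_coeff mps" where
  "chern q k = elem_sym q k mps_var"

definition chern_conj :: "nat \<Rightarrow> nat \<Rightarrow> nat \<Rightarrow> K_coeff mps" where
  "chern_conj n q k =
     elem_sym q k (\<lambda>j. fps_subst (formal_inverse (K_FGL n)) (mps_var j))"

definition conj_ideal :: "nat \<Rightarrow> nat \<Rightarrow> K_coeff mps set" where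
  "conj_ideal n q =
     Idl\<^bsub>K_BU n q\<^esub> ((\<lambda>k. chern q k \<ominus>\<^bsub>K_BU n q\<^esub> chern_conj n q k) ` {1..q})"

definition K_quot :: "nat \<Rightarrow> nat \<Rightarrow> K_coeff mps set ring" where
  "K_quot n q = K_BU n q Quot conj_ideal n q"

definition quot_proj :: "nat \<Rightarrow> nat \<Rightarrow> K_coeff mps \<Rightarrow> K_coeff mps set" where
  "quot_proj n q f = conj_ideal n q +>\<^bsub>K_BU n q\<^esub> f"

text \<open>The power series topology is that of coefficientwise convergence, the coefficient ring being
  discrete. As there are only finitely many monomials of each total degree in \<open>x\<^sub>1,\<dots>,x\<^sub>q\<close>, the power
  series vanishing below total degree \<open>N\<close>, for \<open>N = 0, 1, 2, \<dots>\<close>, form a basis of neighbourhoods of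
  zero; and \<open>x\<close>-degree and \<open>c\<close>-degree define the same topology on the symmetric power series.\<close>

definition K_BU_topology :: "nat \<Rightarrow> nat \<Rightarrow> K_coeff mps topology" where
  "K_BU_topology n q =
     subtopology (product_topology (\<lambda>_. discrete_topology UNIV) UNIV) (carrier (K_BU n q))"

definition K_quot_topology :: "nat \<Rightarrow> nat \<Rightarrow> K_coeff mps set topology" where
  "K_quot_topology n q = topology (\<lambda>U. U \<subseteq> carrier (K_quot n q) \<and>
     openin (K_BU_topology n q) {f \<in> carrier (K_BU n q). quot_proj n q f \<in> U})"

text \<open>The images of the elements of \<open>B\<close> form a topological basis over \<open>K(n)\<^sup>*\<close> of the quotient: every
  homogeneous element \<open>r\<close> of degree \<open>d\<close> is in exactly one way the limit of a sum \<open>\<Sum>\<^bsub>s \<in> B\<^esub> a\<^sub>s s\<close> whose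
  terms are homogeneous of degree \<open>d\<close>. The limit is along the finite subsets of \<open>B\<close>. The indexing is
  by \<open>B\<close> itself, so uniqueness also says that distinct elements of \<open>B\<close> have distinct images.\<close>

definition is_topological_basis :: "nat \<Rightarrow> nat \<Rightarrow> K_coeff mps set \<Rightarrow> bool" where
  "is_topological_basis n q B \<longleftrightarrow> B \<subseteq> carrier (K_BU n q) \<and>
     (\<forall>d. \<forall>r \<in> quot_proj n q ` {f \<in> carrier (K_BU n q). degrees n f \<subseteq> {d}}.
        \<exists>!a :: K_coeff mps \<Rightarrow> K_coeff.
          (\<forall>s. s \<notin> B \<longrightarrow> a s = 0) \<and>
          (\<forall>s\<in>B. degrees n (mps_const (a s) \<otimes>\<^bsub>K_BU n q\<^esub> s) \<subseteq> {d}) \<and>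
          limitin (K_quot_topology n q)
            (\<lambda>A. \<Oplus>\<^bsub>K_quot n q\<^esub>s\<in>A.
               quot_proj n q (mps_const (a s)) \<otimes>\<^bsub>K_quot n q\<^esub> quot_proj n q s)
            r (finite_subsets_at_top B))"


section \<open>The symmetric functions \<open>s\<^sub>I\<^sub>J\<close>\<close>

text \<open>The monomial \<open>x\<^sub>1\<^bsup>e\<^sub>1\<^esup> \<cdots> x\<^sub>r\<^bsup>e\<^sub>r\<^esup>\<close> for a list \<open>[e\<^sub>1, \<dots>, e\<^sub>r]\<close>.\<close>

definition monom_of_list :: "nat list \<Rightarrow> monom" where
  "monom_of_list es = (\<Sum>k<length es. Poly_Mapping.single (Suc k) (es ! k))"

definition monomial_symmetric :: "nat \<Rightarrow> monom \<Rightarrow> K_coeff mps" where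
  "monomial_symmetric q M\<^sub>0 =
     (\<lambda>M. if \<exists>\<sigma>. \<sigma> permutes {1..q} \<and> M = Poly_Mapping.map_key \<sigma> M\<^sub>0 then 1 else 0)"

definition s_IJ :: "nat \<Rightarrow> nat list \<Rightarrow> nat list \<Rightarrow> K_coeff mps" where
  "s_IJ q I J = monomial_symmetric q (monom_of_list (I @ J))"

end

theory Submission
  imports Defs
begin

text \<open>
  Put \<open>Q = 2\<^sup>n\<close>. All generators are homogeneous, so \<open>v\<^sub>n\<close> may be set to \<open>1\<close> and one works with symmetric
  power series over \<open>\<int>/2\<close>. The logarithm satisfies \<open>l(x) = x + l(x\<^bsup>Q\<^esup>)/2\<close>, and the functional equation
  lemma makes both the formal group law and the inverse \<open>l\<^sup>-\<^sup>1(-l(x))\<close> integral at \<open>2\<close>; the latter reduces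
  to an involution \<open>[-1](x) = x + x\<^bsup>Q\<^esup> + \<dots>\<close> over \<open>\<int>/2\<close>.

  Call a multiset of \<open>q\<close> exponents bad if some exponent \<open>\<ge> Q\<close> occurs in it an odd number of times; the
  \<open>s\<^sub>I\<^sub>J\<close> are the monomial symmetric functions of the other multisets. The leading form of
  \<open>c\<^sub>k - c\<^sub>k\<^sup>*\<close> is the monomial symmetric function of \<open>(Q, 1, \<dots>, 1, 0, \<dots>, 0)\<close>. The ideal generated by these
  leading forms contains the power sums \<open>p\<^sub>i\<close>, \<open>i \<ge> Q\<close>, and then all bad monomial symmetric functions, so
  the others span the quotient.

  For independence, a monomial whose exponents are not bad admits an involution of the variables that preserves
  the exponents and only fixes variables with exponent \<open>< Q\<close>. Identifying the variables in a pair up to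
  conjugation sends the ideal into the one generated by the \<open>x\<^sub>i\<^bsup>Q\<^esup>\<close> with \<open>i\<close> fixed, but it detects the
  coefficient of the given monomial in a symmetric series of that order.
\<close>

text \<open>Parity enters through the characteristic. Multiplying by a power sum weights each
  monomial symmetric function by the multiplicity of the new exponent, so only odd multiplicities
  survive over Z/2. Even multiplicities leave room for a pairing of variables, under which the
  unwanted terms of a coefficient cancel in twos. Reduction modulo 2 is a homomorphism only on
  Z_(2), while the logarithm has unbounded powers of 2 in its denominators; hence integrality comes
  before any reduction. The formal group law and the inverse are given by definite descriptions, and
  reduction to a normal form is an infinite process. All of these are fixed points of maps that
  raise the order of agreement by one, taken inside a closed set that records homogeneity,
  integrality or symmetry. Setting \<open>v\<^sub>n\<close> to 1 loses nothing in a fixed degree,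
  since the degree determines the power of \<open>v\<^sub>n\<close> at each monomial. The ideal is
  not known in advance to be closed, so uniqueness of limits in the quotient is not automatic:
  independence is proved for congruences up to an error of high order.\<close>

abbreviation lookup :: "('b \<Rightarrow>\<^sub>0 'c::zero) \<Rightarrow> 'b \<Rightarrow> 'c" where "lookup \<equiv> Poly_Mapping.lookup"
abbreviation keys :: "('b \<Rightarrow>\<^sub>0 'c::zero) \<Rightarrow> 'b set" where "keys \<equiv> Poly_Mapping.keys"
abbreviation single :: "'b \<Rightarrow> 'c \<Rightarrow> ('b \<Rightarrow>\<^sub>0 'c::zero)" where "single \<equiv> Poly_Mapping.single"

section \<open>Monomials\<close>

lemma total_degree_superset:
  assumes "finite S" "keys M \<subseteq> S"
  shows "total_degree M = (\<Sum>k\<in>S. lookup M k)"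
  unfolding total_degree_def
  by (rule sum.mono_neutral_left) (use assms in \<open>auto simp: in_keys_iff\<close>)

lemma total_degree_zero [simp]: "total_degree 0 = 0"
  by (simp add: total_degree_def)

lemma total_degree_single [simp]: "total_degree (single k a) = a"
  by (simp add: total_degree_def)

lemma total_degree_add [simp]: "total_degree (A + B) = total_degree A + total_degree B"
proof -
  let ?S = "keys A \<union> keys B"
  have "keys (A + B) \<subseteq> ?S" by (rule Poly_Mapping.keys_add)
  then show ?thesis
    using total_degree_superset[of ?S A] total_degree_superset[of ?S B] total_degree_superset[of ?S "A+B"]
    by (simp add: lookup_add sum.distrib)
qed

lemma total_degree_sum [simp]: "total_degree (sum f S) = (\<Sum>i\<in>S. total_degree (f i))"
  by (induction S rule: infinite_finite_induct) auto

lemma total_degree_eq_0_iff [simp]: "total_degree M = 0 \<longleftrightarrow> M = 0"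
  by (auto simp: total_degree_def in_keys_iff intro!: poly_mapping_eqI)

lemma lookup_le_total_degree: "lookup M k \<le> total_degree M"
proof (cases "k \<in> keys M")
  case True
  then show ?thesis unfolding total_degree_def by (intro member_le_sum) auto
qed (simp add: in_keys_iff)

lemma keys_add_nat: "keys (A + B) = keys A \<union> keys (B :: monom)"
  by (auto simp: in_keys_iff lookup_add)

lemma finite_monoms:
  assumes "finite V"
  shows "finite {A :: monom. keys A \<subseteq> V \<and> total_degree A \<le> N}"
proof -
  have "lookup ` {A :: monom. keys A \<subseteq> V \<and> total_degree A \<le> N}
      \<subseteq> {f. \<forall>i. (i \<in> V \<longrightarrow> f i \<in> {..N}) \<and> (i \<notin> V \<longrightarrow> f i = 0)}"
    using order_trans[OF lookup_le_total_degree] by (auto simp: in_keys_iff)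
  then have "finite (lookup ` {A :: monom. keys A \<subseteq> V \<and> total_degree A \<le> N})"
    by (rule finite_subset) (intro finite_set_of_finite_funs assms, simp)
  then show ?thesis
    by (rule finite_imageD) (auto intro!: inj_onI poly_mapping_eqI)
qed

definition splits :: "monom \<Rightarrow> (monom \<times> monom) set" where
  "splits M = {(A, B). A + B = M}"

lemma finite_splits [simp]: "finite (splits M)"
proof -
  let ?T = "{A :: monom. keys A \<subseteq> keys M \<and> total_degree A \<le> total_degree M}"
  have "splits M \<subseteq> ?T \<times> ?T"
    by (auto simp: splits_def keys_add_nat)
  moreover have "finite (?T \<times> ?T)" using finite_monoms[of "keys M"] by auto
  ultimately show ?thesis by (rule finite_subset)
qed

section \<open>The ring of power series\<close>

text \<open>A copy of the function type on which the ring structure can be a type class instance, so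
  that ordinary ring arithmetic applies; \<open>mps_ring_simps\<close> carries results over to the
  record \<open>mps_ring\<close>.\<close>

typedef 'a ps = "UNIV :: 'a mps set" morphisms cf Ps ..

lemma cf_Ps [simp]: "cf (Ps f) = f" by (simp add: Ps_inverse)
lemma Ps_cf [simp]: "Ps (cf f) = f" by (simp add: cf_inverse)

lemma ps_eqI: "(\<And>M. cf f M = cf g M) \<Longrightarrow> f = g"
  by (metis cf_inverse ext)

instantiation ps :: (comm_ring_1) comm_ring_1
begin

definition "0 = Ps (\<lambda>M. 0)"
definition "1 = Ps (\<lambda>M. if M = 0 then 1 else 0)"
definition "f + g = Ps (\<lambda>M. cf f M + cf g M)"
definition "f - g = Ps (\<lambda>M. cf f M - cf g M)"
definition "- f = Ps (\<lambda>M. - cf f M)" for f :: "'a ps"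
definition "f * g = Ps (\<lambda>M. \<Sum>(A, B)\<in>splits M. cf f A * cf g B)"

lemma cf_basic:
  "cf (0 :: 'a ps) M = 0"
  "cf (1 :: 'a ps) M = (if M = 0 then 1 else 0)"
  "cf (f + g) M = cf f M + cf g M"
  "cf (f - g) M = cf f M - cf g M"
  "cf (- f) M = - cf f M" for f g :: "'a ps"
  by (simp_all add: zero_ps_def one_ps_def plus_ps_def minus_ps_def uminus_ps_def)

lemma cf_mult: "cf (f * g) M = (\<Sum>(A, B)\<in>splits M. cf f A * cf g B)" for f g :: "'a ps"
  by (simp add: times_ps_def)

instance
proof
  fix a b c :: "'a ps"
  show "a * b * c = a * (b * c)"
  proof (rule ps_eqI)
    fix M
    have "cf (a * b * c) M = (\<Sum>(X, C)\<in>splits M. \<Sum>(A, B)\<in>splits X. cf a A * cf b B * cf c C)"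
      by (simp add: cf_mult sum_distrib_right case_prod_beta)
    also have "\<dots> = (\<Sum>((X, C), (A, B))\<in>(SIGMA p:splits M. splits (fst p)). cf a A * cf b B * cf c C)"
      by (simp add: sum.Sigma case_prod_beta)
    also have "\<dots> = (\<Sum>((A, X), (B, C))\<in>(SIGMA p:splits M. splits (snd p)). cf a A * cf b B * cf c C)"
      by (rule sum.reindex_bij_witness[of _ "\<lambda>((A, X), (B, C)). ((A + B, C), (A, B))"
            "\<lambda>((X, C), (A, B)). ((A, B + C), (B, C))"])
         (auto simp: splits_def ac_simps)
    also have "\<dots> = (\<Sum>(A, X)\<in>splits M. \<Sum>(B, C)\<in>splits X. cf a A * cf b B * cf c C)"
      by (simp add: sum.Sigma case_prod_beta)
    also have "\<dots> = cf (a * (b * c)) M"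
      by (simp add: cf_mult sum_distrib_left case_prod_beta mult.assoc)
    finally show "cf (a * b * c) M = cf (a * (b * c)) M" .
  qed
  show "a * b = b * a"
  proof (rule ps_eqI)
    fix M
    show "cf (a * b) M = cf (b * a) M"
      unfolding cf_mult
      by (rule sum.reindex_bij_witness[of _ "\<lambda>(A, B). (B, A)" "\<lambda>(A, B). (B, A)"])
         (auto simp: splits_def ac_simps)
  qed
  show "1 * a = a"
  proof (rule ps_eqI)
    fix M
    have "cf (1 * a) M = (\<Sum>(A, B)\<in>splits M. if (A, B) = (0, M) then cf a M else 0)"
      unfolding cf_mult by (rule sum.cong) (auto simp: cf_basic splits_def)
    also have "\<dots> = (\<Sum>p\<in>splits M. if p = (0, M) then cf a M else 0)"
      by (rule sum.cong) (auto split: if_splits)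
    also have "\<dots> = cf a M"
      by (subst sum.delta) (auto, auto simp: splits_def)
    finally show "cf (1 * a) M = cf a M" .
  qed
  show "(a + b) * c = a * c + b * c"
    by (rule ps_eqI) (simp add: cf_mult cf_basic algebra_simps sum.distrib case_prod_beta)
  show "(0 :: 'a ps) \<noteq> 1"
    by (metis cf_basic(1,2) zero_neq_one)
qed (auto intro!: ps_eqI simp: cf_basic)

end

lemmas [simp] = cf_basic

lemma cf_sum [simp]: "cf (sum f S) M = (\<Sum>i\<in>S. cf (f i) M)"
  by (induction S rule: infinite_finite_induct) auto

definition cst :: "'a::comm_ring_1 \<Rightarrow> 'a ps" where "cst a = Ps (mps_const a)"
definition xm :: "monom \<Rightarrow> 'a::comm_ring_1 ps" where "xm A = Ps (\<lambda>M. if M = A then 1 else 0)"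
definition var :: "nat \<Rightarrow> 'a::comm_ring_1 ps" where "var k = Ps (mps_var k)"

lemma cf_xm [simp]: "cf (xm A) M = (if M = A then 1 else 0)"
  by (simp add: xm_def)

lemma cf_cst: "cf (cst a) M = (if M = 0 then a else 0)"
  by (simp add: cst_def mps_const_def)

lemma var_eq_xm: "var k = xm (single k 1)"
  by (simp add: var_def xm_def mps_var_def)

lemma xm_0 [simp]: "xm 0 = 1"
  by (rule ps_eqI) simp

lemma cf_cst_mult [simp]: "cf (cst a * f) M = a * cf f M"
proof -
  have "cf (cst a * f) M = (\<Sum>p\<in>splits M. if p = (0, M) then a * cf f M else 0)"
    unfolding cf_mult by (rule sum.cong) (auto simp: splits_def cf_cst split: if_splits)
  also have "\<dots> = a * cf f M" by (subst sum.delta) (auto, auto simp: splits_def)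
  finally show ?thesis .
qed

lemma cst_0 [simp]: "cst 0 = 0" and cst_1 [simp]: "cst 1 = 1"
  by (rule ps_eqI; simp add: cf_cst)+

lemma cst_add: "cst (a + b) = cst a + cst b"
  by (rule ps_eqI) (simp add: cf_cst)

lemma cst_mult: "cst (a * b) = cst a * cst b"
  by (rule ps_eqI) (simp add: cf_cst)

lemma cst_uminus: "cst (- a) = - cst a"
  by (rule ps_eqI) (simp add: cf_cst)

lemma cf_numeral_mult [simp]: "cf (numeral k * f) M = numeral k * cf f M"
proof -
  have "of_nat m = cst (of_nat m :: 'a)" for m
    by (induction m) (auto simp: cst_add)
  from this[of "numeral k"] have "(numeral k :: 'a ps) = cst (numeral k)" by simp
  then show ?thesis by (metis cf_cst_mult)
qed

lemma cf_xm_mult: "cf (xm A * f) (A + M) = cf f M"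
proof -
  have "cf (xm A * f) (A + M) = (\<Sum>p\<in>splits (A + M). if p = (A, M) then cf f M else 0)"
    unfolding cf_mult by (rule sum.cong) (auto simp: splits_def split: if_splits)
  also have "\<dots> = cf f M" by (subst sum.delta) (auto, auto simp: splits_def)
  finally show ?thesis .
qed

lemma cf_xm_mult_eq_0: "(\<And>B. M \<noteq> A + B) \<Longrightarrow> cf (xm A * f) M = 0"
  unfolding cf_mult by (rule sum.neutral) (auto simp: splits_def)

lemma xm_add: "xm (A + B) = xm A * xm B"
proof (rule ps_eqI)
  fix M
  show "cf (xm (A + B)) M = cf (xm A * xm B) M"
  proof (cases "\<exists>C. M = A + C")
    case True
    then show ?thesis by (auto simp: cf_xm_mult)
  next
    case False
    then show ?thesis by (auto simp: cf_xm_mult_eq_0)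
  qed
qed

lemma xm_sum: "xm (\<Sum>i\<in>S. f i) = (\<Prod>i\<in>S. xm (f i))"
  by (induction S rule: infinite_finite_induct) (auto simp: xm_add)

lemma var_power: "var k ^ a = xm (single k a)"
  by (induction a) (auto simp: var_eq_xm simp flip: xm_add single_add)

section \<open>Order filtration\<close>

definition ordge :: "nat \<Rightarrow> 'a::comm_ring_1 ps \<Rightarrow> bool" where
  "ordge N f \<longleftrightarrow> (\<forall>M. total_degree M < N \<longrightarrow> cf f M = 0)"

lemma ordgeD: "ordge N f \<Longrightarrow> total_degree M < N \<Longrightarrow> cf f M = 0"
  by (simp add: ordge_def)

lemma ordge_0 [simp]: "ordge 0 f" by (simp add: ordge_def)
lemma ordge_zero [simp]: "ordge N 0" by (simp add: ordge_def)
lemma ordge_add: "ordge N f \<Longrightarrow> ordge N g \<Longrightarrow> ordge N (f + g)" by (simp add: ordge_def)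
lemma ordge_diff: "ordge N f \<Longrightarrow> ordge N g \<Longrightarrow> ordge N (f - g)" by (simp add: ordge_def)
lemma ordge_uminus: "ordge N f \<Longrightarrow> ordge N (- f)" by (simp add: ordge_def)
lemma ordge_sum: "(\<And>i. i \<in> S \<Longrightarrow> ordge N (f i)) \<Longrightarrow> ordge N (sum f S)" by (simp add: ordge_def)
lemma ordge_mono: "ordge N f \<Longrightarrow> N' \<le> N \<Longrightarrow> ordge N' f" by (auto simp: ordge_def)

lemma ordge_mult: "ordge a f \<Longrightarrow> ordge b g \<Longrightarrow> ordge (a + b) (f * g)"
  unfolding ordge_def cf_mult
proof (intro allI impI sum.neutral ballI)
  fix M p
  assume h: "\<forall>M. total_degree M < a \<longrightarrow> cf f M = 0" "\<forall>M. total_degree M < b \<longrightarrow> cf g M = 0"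
    "total_degree M < a + b" "p \<in> splits M"
  obtain A B where p: "p = (A, B)" by force
  with h have "total_degree A + total_degree B < a + b"
    by (auto simp: splits_def)
  then have "total_degree A < a \<or> total_degree B < b" by linarith
  with h p show "(case p of (A, B) \<Rightarrow> cf f A * cf g B) = 0" by auto
qed

lemma ordge_power: "ordge a f \<Longrightarrow> ordge (a * k) (f ^ k)"
  by (induction k) (auto dest: ordge_mult)

lemma ordge_prod: "(\<And>i. i \<in> S \<Longrightarrow> ordge (a i) (f i)) \<Longrightarrow> ordge (sum a S) (prod f S)"
  by (induction S rule: infinite_finite_induct) (auto intro: ordge_mult)

lemma ordge_xm [simp]: "N \<le> total_degree A \<Longrightarrow> ordge N (xm A)"
  by (auto simp: ordge_def)

lemma ordge_var [simp]: "ordge 1 (var k)"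
  by (simp add: var_eq_xm)

lemma ordge_var_Suc [simp]: "ordge (Suc 0) (var k)"
  by (simp add: var_eq_xm)

lemma ordge_diff_iff: "ordge N (f - g) \<longleftrightarrow> (\<forall>M. total_degree M < N \<longrightarrow> cf f M = cf g M)"
  by (auto simp: ordge_def)

lemma ordge_1_iff: "ordge 1 f \<longleftrightarrow> cf f 0 = 0"
  by (auto simp: ordge_def)

text \<open>The leading form of a product depends only on the leading forms of its factors: the
  difference is f (g - g') + (f - f') g', where g' inherits the order of g.\<close>

lemma ordge_mult_diff:
  assumes "ordge a f" "ordge b g" "ordge (Suc a) (f - f')" "ordge (Suc b) (g - g')"
  shows "ordge (Suc (a + b)) (f * g - f' * g')"
proof -
  have g': "ordge b g'"
    using ordge_diff[OF assms(2) ordge_mono[OF assms(4)]] by simp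
  have "f * g - f' * g' = f * (g - g') + (f - f') * g'" by (simp add: algebra_simps)
  moreover have "ordge (Suc (a + b)) (f * (g - g'))"
    using ordge_mult[OF assms(1,4)] by simp
  moreover have "ordge (Suc (a + b)) ((f - f') * g')"
    using ordge_mult[OF assms(3) g'] by simp
  ultimately show ?thesis by (metis ordge_add)
qed

lemma ordge_prod_diff:
  assumes "finite S" "\<And>i. i \<in> S \<Longrightarrow> ordge (a i) (f i)" "\<And>i. i \<in> S \<Longrightarrow> ordge (Suc (a i)) (f i - g i)"
  shows "ordge (Suc (sum a S)) (prod f S - prod g S)"
  using assms
proof (induction S rule: finite_induct)
  case (insert x S)
  show ?case
    using insert.hyps ordge_mult_diff[of "a x" "f x" "sum a S" "prod f S" "g x" "prod g S"]
      insert.prems insert.IH ordge_prod[of S a f]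
    by (auto simp: add.commute)
qed simp

lemma ordge_power_diff:
  assumes "ordge a f" "ordge (Suc a) (f - g)"
  shows "ordge (Suc (a * k)) (f ^ k - g ^ k)"
  using ordge_prod_diff[of "{..<k}" "\<lambda>_. a" "\<lambda>_. f" "\<lambda>_. g"] assms by (simp add: mult.commute)

text \<open>The difference f^k - g^k is f - g times a sum of products of k - 1 factors of positive
  order. The gain of k - 1 orders makes substitution into a series without linear term a
  contraction.\<close>

lemma ordge_power_diff':
  assumes "ordge 1 f" "ordge 1 g" "ordge N (f - g)" "1 \<le> k"
  shows "ordge (N + k - 1) (f ^ k - g ^ k)"
  using \<open>1 \<le> k\<close>
proof (induction k rule: dec_induct)
  case (step k)
  have "f ^ Suc k - g ^ Suc k = f * (f ^ k - g ^ k) + (f - g) * g ^ k" by (simp add: algebra_simps)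
  moreover have "ordge (N + Suc k - 1) (f * (f ^ k - g ^ k))"
    using ordge_mult[OF assms(1) step.IH] step.hyps by simp
  moreover have "ordge (N + Suc k - 1) ((f - g) * g ^ k)"
    using ordge_mult[OF assms(3) ordge_power[OF assms(2)], of k] by simp
  ultimately show ?case by (metis ordge_add)
qed (use assms in simp)

section \<open>Contractions\<close>

text \<open>Banach's theorem for families graded by \<open>deg\<close>: agreement below
  \<open>N\<close> improves to agreement up to \<open>N\<close>, so the iterates stabilise degree by
  degree. Working inside a closed set \<open>C\<close> lets the fixed point inherit properties such
  as homogeneity, integrality or symmetry.\<close>

lemma contraction_fixpoint:
  fixes deg :: "'i \<Rightarrow> nat" and \<Phi> :: "('i \<Rightarrow> 'a) \<Rightarrow> ('i \<Rightarrow> 'a)"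
  assumes "z \<in> C" and maps: "\<And>f. f \<in> C \<Longrightarrow> \<Phi> f \<in> C"
    and contr: "\<And>f g N. f \<in> C \<Longrightarrow> g \<in> C \<Longrightarrow> (\<And>i. deg i < N \<Longrightarrow> f i = g i) \<Longrightarrow>
      (\<And>i. deg i \<le> N \<Longrightarrow> \<Phi> f i = \<Phi> g i)"
    and closed: "\<And>f. (\<And>N. \<exists>g\<in>C. \<forall>i. deg i < N \<longrightarrow> f i = g i) \<Longrightarrow> f \<in> C"
  shows "\<exists>!f. f \<in> C \<and> \<Phi> f = f"
proof -
  define F where "F N = (\<Phi> ^^ N) z" for N
  have FC: "F N \<in> C" for N
    by (induction N) (auto simp: F_def assms(1) maps)
  have step: "\<forall>i. deg i < N \<longrightarrow> F N i = F (N + k) i" for N k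
  proof (induction N)
    case (Suc N)
    have "\<And>i. deg i \<le> N \<Longrightarrow> \<Phi> (F N) i = \<Phi> (F (N + k)) i"
      by (rule contr[OF FC FC]) (use Suc.IH in auto)
    then show ?case by (auto simp: F_def)
  qed simp
  \<comment> \<open>The value at \<open>i\<close> no longer changes from iterate
    \<open>deg i + 1\<close> on, so this is the limit of the iterates.\<close>
  define f where "f i = F (Suc (deg i)) i" for i
  have fF: "f i = F N i" if "deg i < N" for i N
    using step[rule_format, of i "Suc (deg i)" "N - Suc (deg i)"] that by (simp add: f_def)
  have fC: "f \<in> C"
    using closed[of f] FC fF by blast
  have "\<Phi> f i = f i" for i
  proof -
    have "\<Phi> f i = \<Phi> (F (deg i)) i"
      by (rule contr[OF fC FC, of "deg i"]) (auto simp: fF)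
    also have "\<dots> = f i" by (simp add: f_def F_def)
    finally show ?thesis .
  qed
  then have "\<Phi> f = f" by auto
  moreover have "g = f" if "g \<in> C" "\<Phi> g = g" for g
  proof -
    have "\<forall>i. deg i < N \<longrightarrow> g i = f i" for N
    proof (induction N)
      case (Suc N)
      show ?case
        using contr[OF that(1) fC, of N] Suc.IH that(2) \<open>\<Phi> f = f\<close> by auto
    qed simp
    then show ?thesis by (auto intro!: ext)
  qed
  ultimately show ?thesis using fC by blast
qed

lemma ps_contraction_fixpoint:
  fixes \<Phi> :: "'a::comm_ring_1 ps \<Rightarrow> 'a ps"
  assumes "z \<in> C" and maps: "\<And>f. f \<in> C \<Longrightarrow> \<Phi> f \<in> C"
    and contr: "\<And>f g N. f \<in> C \<Longrightarrow> g \<in> C \<Longrightarrow> ordge N (f - g) \<Longrightarrow> ordge (Suc N) (\<Phi> f - \<Phi> g)"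
    and closed: "\<And>f. (\<And>N. \<exists>g\<in>C. ordge N (f - g)) \<Longrightarrow> f \<in> C"
  shows "\<exists>!f. f \<in> C \<and> \<Phi> f = f"
proof -
  have "\<exists>!f. f \<in> cf ` C \<and> (\<lambda>g. cf (\<Phi> (Ps g))) f = f"
  proof (rule contraction_fixpoint[where deg = total_degree and z = "cf z"])
    show "cf z \<in> cf ` C" using assms(1) by auto
    fix f assume "f \<in> cf ` C"
    then show "cf (\<Phi> (Ps f)) \<in> cf ` C" by (auto simp: maps)
  next
    fix f g :: "'a mps" and N i
    assume "f \<in> cf ` C" "g \<in> cf ` C" "\<And>i. total_degree i < N \<Longrightarrow> f i = g i" "total_degree i \<le> N"
    then show "cf (\<Phi> (Ps f)) i = cf (\<Phi> (Ps g)) i"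
      using contr[of "Ps f" "Ps g" N] by (auto simp: ordge_diff_iff)
  next
    fix f :: "'a mps"
    assume *: "\<And>N. \<exists>g\<in>cf ` C. \<forall>i. total_degree i < N \<longrightarrow> f i = g i"
    have "Ps f \<in> C"
      by (rule closed) (use * in \<open>auto simp: ordge_diff_iff\<close>)
    then show "f \<in> cf ` C" by (metis cf_Ps imageI)
  qed
  then show ?thesis
  proof (elim ex1E, intro ex1I)
    fix f assume f: "f \<in> cf ` C \<and> cf (\<Phi> (Ps f)) = f"
      "\<forall>y. y \<in> cf ` C \<and> cf (\<Phi> (Ps y)) = y \<longrightarrow> y = f"
    then show "Ps f \<in> C \<and> \<Phi> (Ps f) = Ps f" by (metis Ps_cf imageE)
    fix g assume "g \<in> C \<and> \<Phi> g = g"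
    with f(2)[rule_format, of "cf g"] show "g = Ps f" by (metis Ps_cf imageI)
  qed
qed

section \<open>Substitution of power series\<close>

lemma sum_swap3:
  "(\<Sum>p\<in>P. \<Sum>a\<in>A. \<Sum>b\<in>B. t p a b) = (\<Sum>a\<in>A. \<Sum>b\<in>B. \<Sum>p\<in>P. t p a b)"
  by (subst sum.swap, rule sum.cong[OF refl], rule sum.swap)

definition evm :: "(nat \<Rightarrow> 'a::comm_ring_1 ps) \<Rightarrow> monom \<Rightarrow> 'a ps" where
  "evm y A = (\<Prod>i\<in>keys A. y i ^ lookup A i)"

lemma evm_superset:
  assumes "finite S" "keys A \<subseteq> S"
  shows "evm y A = (\<Prod>i\<in>S. y i ^ lookup A i)"
  unfolding evm_def
  by (rule prod.mono_neutral_left) (use assms in \<open>auto simp: in_keys_iff\<close>)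

lemma evm_0 [simp]: "evm y 0 = 1"
  by (simp add: evm_def)

lemma evm_single [simp]: "evm y (single i a) = y i ^ a"
  by (simp add: evm_def)

lemma evm_add: "evm y (A + B) = evm y A * evm y B"
proof -
  let ?S = "keys A \<union> keys B"
  show ?thesis
    using evm_superset[of ?S A y] evm_superset[of ?S B y] evm_superset[of ?S "A + B" y]
    by (simp add: keys_add_nat lookup_add power_add prod.distrib)
qed

lemma ordge_evm:
  assumes "\<And>i. i \<in> keys A \<Longrightarrow> ordge 1 (y i)"
  shows "ordge (total_degree A) (evm y A)"
  unfolding evm_def total_degree_def
  by (rule ordge_prod) (use ordge_power[of 1 "y _"] assms in auto)

text \<open>Monomials of degree above that of \<open>M\<close> are cut off, which makes the sum
  finite for finite \<open>V\<close>; they contribute nothing when the \<open>y i\<close> have no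
  constant term. Monomials with variables outside \<open>V\<close> are discarded.\<close>

definition msubst :: "nat set \<Rightarrow> (nat \<Rightarrow> 'a::comm_ring_1 ps) \<Rightarrow> 'a ps \<Rightarrow> 'a ps" where
  "msubst V y f = Ps (\<lambda>M. \<Sum>A | keys A \<subseteq> V \<and> total_degree A \<le> total_degree M. cf f A * cf (evm y A) M)"

locale substitution =
  fixes V :: "nat set" and y :: "nat \<Rightarrow> 'a::comm_ring_1 ps"
  assumes finite_V [simp]: "finite V"
    and ordge_y: "\<And>i. i \<in> V \<Longrightarrow> ordge 1 (y i)"
begin

abbreviation "ms \<equiv> msubst V y"
abbreviation "below N \<equiv> {A :: monom. keys A \<subseteq> V \<and> total_degree A \<le> N}"

lemma finite_below [simp]: "finite (below N)"
  by (rule finite_monoms) simp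

lemma cf_evm_eq_0: "keys A \<subseteq> V \<Longrightarrow> total_degree M < total_degree A \<Longrightarrow> cf (evm y A) M = 0"
  using ordge_evm[of A y] ordge_y by (auto dest: ordgeD)

text \<open>Any larger cutoff gives the same coefficient, so that several coefficients can be
  computed with a common cutoff.\<close>

lemma cf_msubst:
  assumes "total_degree M \<le> N"
  shows "cf (ms f) M = (\<Sum>A\<in>below N. cf f A * cf (evm y A) M)"
  unfolding msubst_def cf_Ps
  by (rule sum.mono_neutral_left) (use assms in \<open>auto simp: not_le cf_evm_eq_0\<close>)

lemma ms_add: "ms (f + g) = ms f + ms g"
  by (rule ps_eqI) (simp add: msubst_def algebra_simps sum.distrib)

lemma ms_diff: "ms (f - g) = ms f - ms g"
  by (rule ps_eqI) (simp add: msubst_def algebra_simps sum_subtractf)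

lemma ms_0: "ms 0 = 0"
  by (rule ps_eqI) (simp add: msubst_def)

lemma ms_cst_mult: "ms (cst a * f) = cst a * ms f"
  by (rule ps_eqI) (simp add: msubst_def sum_distrib_left mult.assoc)

lemma ms_sum: "ms (sum f S) = (\<Sum>i\<in>S. ms (f i))"
  by (induction S rule: infinite_finite_induct) (auto simp: ms_add ms_0)

lemma ms_xm:
  assumes "keys A \<subseteq> V"
  shows "ms (xm A) = evm y A"
proof (rule ps_eqI)
  fix M
  let ?N = "max (total_degree M) (total_degree A)"
  have "cf (ms (xm A)) M = (\<Sum>B\<in>below ?N. if B = A then cf (evm y A) M else 0)"
    by (subst cf_msubst[of M ?N]) (auto simp: if_distrib[of "\<lambda>t. t * _"] cong: if_cong intro!: sum.cong)
  also have "\<dots> = cf (evm y A) M"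
    using assms by (subst sum.delta) auto
  finally show "cf (ms (xm A)) M = cf (evm y A) M" .
qed

lemma ms_1: "ms 1 = 1"
  using ms_xm[of 0] by simp

lemma ms_var: "i \<in> V \<Longrightarrow> ms (var i) = y i"
  using ms_xm[of "single i 1"] by (simp add: var_eq_xm)

lemma ms_mult: "ms (f * g) = ms f * ms g"
proof (rule ps_eqI)
  fix M
  let ?D = "total_degree M"
  have deg: "total_degree A \<le> ?D \<and> total_degree B \<le> ?D" if "(A, B) \<in> splits M" for A B
    using that by (auto simp: splits_def)
  have "cf (ms f * ms g) M = (\<Sum>(X, Y)\<in>splits M.
      (\<Sum>A\<in>below ?D. cf f A * cf (evm y A) X) * (\<Sum>B\<in>below ?D. cf g B * cf (evm y B) Y))"
    unfolding cf_mult by (rule sum.cong) (use deg in \<open>auto simp: cf_msubst[of _ ?D]\<close>)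
  also have "\<dots> = (\<Sum>p\<in>splits M. \<Sum>A\<in>below ?D. \<Sum>B\<in>below ?D.
      (cf f A * cf (evm y A) (fst p)) * (cf g B * cf (evm y B) (snd p)))"
    by (simp add: sum_product case_prod_beta)
  also have "\<dots> = (\<Sum>A\<in>below ?D. \<Sum>B\<in>below ?D. \<Sum>p\<in>splits M.
      (cf f A * cf (evm y A) (fst p)) * (cf g B * cf (evm y B) (snd p)))"
    by (rule sum_swap3)
  also have "\<dots> = (\<Sum>A\<in>below ?D. \<Sum>B\<in>below ?D. cf f A * cf g B * cf (evm y (A + B)) M)"
    by (intro sum.cong refl) (simp add: evm_add cf_mult sum_distrib_left case_prod_beta ac_simps)
  also have "\<dots> = (\<Sum>(A, B)\<in>below ?D \<times> below ?D. cf f A * cf g B * cf (evm y (A + B)) M)"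
    by (simp add: sum.cartesian_product)
  \<comment> \<open>Pairs whose combined degree exceeds that of \<open>M\<close> drop out because
    \<open>evm y (A + B)\<close> has at least that order; the remaining ones can be grouped by their
    sum.\<close>
  also have "\<dots> = (\<Sum>(A, B)\<in>{p. fst p + snd p \<in> below ?D}. cf f A * cf g B * cf (evm y (A + B)) M)"
  proof (rule sum.mono_neutral_right)
    show "\<forall>p\<in>below ?D \<times> below ?D - {p. fst p + snd p \<in> below ?D}.
        (case p of (A, B) \<Rightarrow> cf f A * cf g B * cf (evm y (A + B)) M) = 0"
      using cf_evm_eq_0[of "_ + _" M] by (force simp: keys_add_nat not_le)
  qed (auto simp: keys_add_nat)
  also have "\<dots> = (\<Sum>(C, A, B)\<in>(SIGMA C:below ?D. splits C). cf f A * cf g B * cf (evm y C) M)"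
    by (rule sum.reindex_bij_witness[of _ "\<lambda>(C, A, B). (A, B)" "\<lambda>(A, B). (A + B, A, B)"])
       (auto simp: splits_def)
  also have "\<dots> = cf (ms (f * g)) M"
    by (subst cf_msubst[of M ?D])
       (auto simp: cf_mult sum.Sigma case_prod_beta sum_distrib_right)
  finally show "cf (ms (f * g)) M = cf (ms f * ms g) M" by simp
qed

lemma ms_power: "ms (f ^ k) = ms f ^ k"
  by (induction k) (auto simp: ms_1 ms_mult)

lemma ms_prod: "ms (prod f S) = (\<Prod>i\<in>S. ms (f i))"
  by (induction S rule: infinite_finite_induct) (auto simp: ms_mult ms_1)

lemma ordge_ms: "ordge N f \<Longrightarrow> ordge N (ms f)"
  unfolding ordge_def msubst_def cf_Ps by (auto intro!: sum.neutral)

end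

section \<open>Substitution into a power series in one variable\<close>

definition fpsub :: "'a::comm_ring_1 fps \<Rightarrow> 'a ps \<Rightarrow> 'a ps" where
  "fpsub g f = Ps (\<lambda>M. \<Sum>j\<le>total_degree M. fps_nth g j * cf (f ^ j) M)"

lemma cf_fpsub:
  assumes "ordge 1 f" "total_degree M \<le> N"
  shows "cf (fpsub g f) M = (\<Sum>j\<le>N. fps_nth g j * cf (f ^ j) M)"
  unfolding fpsub_def cf_Ps
proof (rule sum.mono_neutral_left)
  show "\<forall>j\<in>{..N} - {..total_degree M}. fps_nth g j * cf (f ^ j) M = 0"
    using ordge_power[OF assms(1)] by (auto simp: ordge_def)
qed (use assms in auto)

lemma ordge_fpsub_truncate:
  assumes "ordge 1 f"
  shows "ordge (Suc N) (fpsub g f - (\<Sum>j\<le>N. cst (fps_nth g j) * f ^ j))"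
  by (auto simp: ordge_diff_iff cf_fpsub[OF assms])

lemma fpsub_add: "fpsub (g + h) f = fpsub g f + fpsub h f"
  by (rule ps_eqI) (simp add: fpsub_def algebra_simps sum.distrib)

lemma fpsub_uminus: "fpsub (- g) f = - fpsub g f"
  by (rule ps_eqI) (simp add: fpsub_def sum_negf)

lemma fpsub_1 [simp]: "fpsub 1 f = 1"
proof (rule ps_eqI)
  fix M
  have "cf (fpsub 1 f) M = (\<Sum>j\<le>total_degree M. if j = 0 then cf (f ^ 0) M else 0)"
    unfolding fpsub_def cf_Ps by (rule sum.cong) auto
  then show "cf (fpsub 1 f) M = cf 1 M" by simp
qed

lemma fpsub_X:
  assumes "ordge 1 f"
  shows "fpsub fps_X f = f"
proof (rule ps_eqI)
  fix M
  have "cf (fpsub fps_X f) M = (\<Sum>j\<le>Suc (total_degree M). if j = 1 then cf (f ^ 1) M else 0)"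
    by (subst cf_fpsub[OF assms, of _ "Suc (total_degree M)"], simp, rule sum.cong) auto
  also have "\<dots> = cf f M" by (subst sum.delta) auto
  finally show "cf (fpsub fps_X f) M = cf f M" .
qed

lemma fpsub_mult:
  assumes "ordge 1 f"
  shows "fpsub (g * h) f = fpsub g f * fpsub h f"
proof (rule ps_eqI)
  fix M
  let ?D = "total_degree M"
  have deg: "total_degree A \<le> ?D \<and> total_degree B \<le> ?D" if "(A, B) \<in> splits M" for A B
    using that by (auto simp: splits_def)
  have "cf (fpsub g f * fpsub h f) M = (\<Sum>(X, Y)\<in>splits M.
      (\<Sum>i\<le>?D. fps_nth g i * cf (f ^ i) X) * (\<Sum>j\<le>?D. fps_nth h j * cf (f ^ j) Y))"
    unfolding cf_mult by (rule sum.cong) (use deg assms in \<open>auto simp: cf_fpsub[of f _ ?D]\<close>)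
  also have "\<dots> = (\<Sum>p\<in>splits M. \<Sum>i\<le>?D. \<Sum>j\<le>?D.
      (fps_nth g i * cf (f ^ i) (fst p)) * (fps_nth h j * cf (f ^ j) (snd p)))"
    by (simp add: sum_product case_prod_beta)
  also have "\<dots> = (\<Sum>i\<le>?D. \<Sum>j\<le>?D. \<Sum>p\<in>splits M.
      (fps_nth g i * cf (f ^ i) (fst p)) * (fps_nth h j * cf (f ^ j) (snd p)))"
    by (rule sum_swap3)
  also have "\<dots> = (\<Sum>i\<le>?D. \<Sum>j\<le>?D. fps_nth g i * fps_nth h j * cf (f ^ (i + j)) M)"
    by (intro sum.cong refl) (simp add: power_add cf_mult sum_distrib_left case_prod_beta ac_simps)
  also have "\<dots> = (\<Sum>(i, j)\<in>{..?D} \<times> {..?D}. fps_nth g i * fps_nth h j * cf (f ^ (i + j)) M)"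
    by (simp add: sum.cartesian_product)
  also have "\<dots> = (\<Sum>(i, j)\<in>{p. fst p + snd p \<le> ?D}. fps_nth g i * fps_nth h j * cf (f ^ (i + j)) M)"
  proof (rule sum.mono_neutral_right)
    have "cf (f ^ (i + j)) M = 0" if "\<not> i + j \<le> ?D" for i j
      using ordge_power[OF assms, of "i + j"] that by (simp add: ordge_def)
    then have "(case p of (i, j) \<Rightarrow> fps_nth g i * fps_nth h j * cf (f ^ (i + j)) M) = 0"
      if "\<not> fst p + snd p \<le> ?D" for p
      using that by (simp add: case_prod_beta)
    then show "\<forall>p\<in>{..?D} \<times> {..?D} - {p. fst p + snd p \<le> ?D}.
        (case p of (i, j) \<Rightarrow> fps_nth g i * fps_nth h j * cf (f ^ (i + j)) M) = 0"
      by blast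
  qed auto
  also have "\<dots> = (\<Sum>(m, i)\<in>(SIGMA m:{..?D}. {0..m}). fps_nth g i * fps_nth h (m - i) * cf (f ^ m) M)"
    by (rule sum.reindex_bij_witness[of _ "\<lambda>(m, i). (i, m - i)" "\<lambda>(i, j). (i + j, i)"]) auto
  also have "\<dots> = cf (fpsub (g * h) f) M"
    by (simp add: fpsub_def fps_mult_nth sum.Sigma[symmetric] sum_distrib_right)
  finally show "cf (fpsub (g * h) f) M = cf (fpsub g f * fpsub h f) M" by simp
qed

lemma fpsub_power: "ordge 1 f \<Longrightarrow> fpsub (g ^ k) f = fpsub g f ^ k"
  by (induction k) (auto simp: fpsub_mult)

lemma ordge_fpsub:
  assumes "ordge 1 f" "fps_nth g 0 = 0"
  shows "ordge 1 (fpsub g f)"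
  unfolding ordge_1_iff fpsub_def using assms by simp

lemma fpsub_compose:
  assumes "ordge 1 f" "fps_nth b 0 = 0"
  shows "fpsub (a oo b) f = fpsub a (fpsub b f)"
proof (rule ps_eqI)
  fix M
  let ?D = "total_degree M"
  have "cf (fpsub a (fpsub b f)) M = (\<Sum>j\<le>?D. fps_nth a j * cf (fpsub (b ^ j) f) M)"
    by (simp add: fpsub_def[of a] fpsub_power[OF assms(1)])
  also have "\<dots> = (\<Sum>j\<le>?D. \<Sum>i\<le>?D. fps_nth a j * fps_nth (b ^ j) i * cf (f ^ i) M)"
    by (simp add: fpsub_def sum_distrib_left mult.assoc)
  also have "\<dots> = (\<Sum>i\<le>?D. (\<Sum>j\<le>?D. fps_nth a j * fps_nth (b ^ j) i) * cf (f ^ i) M)"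
    by (subst sum.swap) (simp add: sum_distrib_right)
  also have "\<dots> = (\<Sum>i\<le>?D. fps_nth (a oo b) i * cf (f ^ i) M)"
  proof (rule sum.cong)
    fix i assume "i \<in> {..?D}"
    then have "(\<Sum>j\<le>?D. fps_nth a j * fps_nth (b ^ j) i) = (\<Sum>j\<in>{0..i}. fps_nth a j * fps_nth (b ^ j) i)"
      by (intro sum.mono_neutral_right) (auto simp: startsby_zero_power_prefix assms(2))
    then show "(\<Sum>j\<le>?D. fps_nth a j * fps_nth (b ^ j) i) * cf (f ^ i) M = fps_nth (a oo b) i * cf (f ^ i) M"
      by (simp add: fps_compose_nth)
  qed simp
  finally show "cf (fpsub (a oo b) f) M = cf (fpsub a (fpsub b f)) M"
    by (simp add: fpsub_def)
qed

text \<open>A series in one variable can be recovered from its value at a variable, so identities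
  between such series may be proved among series in several variables.\<close>

lemma fpsub_var_single: "cf (fpsub g (var k)) (single k N) = fps_nth g N"
proof -
  have "cf (fpsub g (var k)) (single k N) = (\<Sum>j\<le>N. if j = N then fps_nth g N else 0)"
    unfolding fpsub_def cf_Ps
    by (rule sum.cong) (auto simp: var_power dest: arg_cong[of _ _ "\<lambda>M. lookup M k"])
  then show ?thesis by simp
qed

lemma fpsub_var_other:
  assumes "\<And>N. M \<noteq> single k N"
  shows "cf (fpsub g (var k)) M = 0"
  unfolding fpsub_def by (simp add: var_power assms)

lemma ordge_fpsub_diff:
  assumes "ordge 1 f" "ordge 1 f'" "ordge N (f - f')"
  shows "ordge N (fpsub g f - fpsub g f')"
proof (subst ordge_diff_iff, intro allI impI)
  fix M assume M: "total_degree M < N"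
  have "cf (f ^ j) M = cf (f' ^ j) M" for j
  proof (cases "j = 0")
    case False
    then have "ordge N (f ^ j - f' ^ j)"
      using ordge_mono[OF ordge_power_diff'[OF assms, of j], of N] by simp
    then show ?thesis using M by (auto simp: ordge_diff_iff)
  qed simp
  then show "cf (fpsub g f) M = cf (fpsub g f') M" by (simp add: fpsub_def)
qed

text \<open>Without a linear term only powers with exponent at least 2 depend on the argument, and
  each of these gains an order.\<close>

lemma fpsub_contraction:
  assumes "ordge 1 f" "ordge 1 f'" "ordge N (f - f')" "fps_nth g 1 = 0"
  shows "ordge (Suc N) (fpsub g f - fpsub g f')"
proof (subst ordge_diff_iff, intro allI impI)
  fix M assume M: "total_degree M < Suc N"
  have "fps_nth g j * cf (f ^ j) M = fps_nth g j * cf (f' ^ j) M" for j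
  proof (cases "j = 0 \<or> j = 1")
    case False
    then have "ordge (Suc N) (f ^ j - f' ^ j)"
      using ordge_mono[OF ordge_power_diff'[OF assms(1-3), of j], of "Suc N"] by (cases j) auto
    then show ?thesis using M by (auto simp: ordge_diff_iff)
  qed (use assms(4) in auto)
  then show "cf (fpsub g f) M = cf (fpsub g f') M" by (simp add: fpsub_def)
qed

lemma fpsub_solve:
  fixes l :: "'a::comm_ring_1 fps" and R :: "'a ps"
  assumes "fps_nth l 0 = 0" "fps_nth l 1 = 1" "ordge 1 R"
    and "z \<in> C" "C \<subseteq> Collect (ordge 1)"
    and "\<And>f. f \<in> C \<Longrightarrow> R - fpsub (l - fps_X) f \<in> C"
    and "\<And>f. (\<And>N. \<exists>g\<in>C. ordge N (f - g)) \<Longrightarrow> f \<in> C"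
  shows "\<exists>!f. f \<in> C \<and> fpsub l f = R"
proof -
  have "\<exists>!f. f \<in> C \<and> R - fpsub (l - fps_X) f = f"
  proof (rule ps_contraction_fixpoint[where z = z])
    fix f g :: "'a ps" and N
    assume "f \<in> C" "g \<in> C" "ordge N (f - g)"
    then have "ordge (Suc N) (fpsub (l - fps_X) g - fpsub (l - fps_X) f)"
      using assms(2,5) ordge_uminus[of N "f - g"] by (intro fpsub_contraction) auto
    then show "ordge (Suc N) (R - fpsub (l - fps_X) f - (R - fpsub (l - fps_X) g))"
      by simp
  qed (use assms in auto)
  moreover have "R - fpsub (l - fps_X) f = f \<longleftrightarrow> fpsub l f = R" if "f \<in> C" for f
  proof -
    have "fpsub l f = fpsub (l - fps_X) f + fpsub fps_X f"
      by (simp flip: fpsub_add)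
    then show ?thesis using fpsub_X[of f] that assms(5) by (auto simp: algebra_simps)
  qed
  ultimately show ?thesis by metis
qed

lemma fpsub_solve_unique:
  fixes l :: "'a::comm_ring_1 fps" and R :: "'a ps"
  assumes "fps_nth l 0 = 0" "fps_nth l 1 = 1" "ordge 1 R"
  shows "\<exists>!f. ordge 1 f \<and> fpsub l f = R"
proof -
  have "\<exists>!f. f \<in> Collect (ordge 1) \<and> fpsub l f = R"
  proof (rule fpsub_solve[OF assms, where z = 0])
    fix f :: "'a ps" assume "f \<in> Collect (ordge 1)"
    then show "R - fpsub (l - fps_X) f \<in> Collect (ordge 1)"
      using assms by (auto intro!: ordge_diff ordge_fpsub[unfolded One_nat_def])
  next
    fix f :: "'a ps" assume "\<And>N. \<exists>g\<in>Collect (ordge 1). ordge N (f - g)"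
    from this[of 1] show "f \<in> Collect (ordge 1)" by (auto simp: ordge_def)
  qed auto
  then show ?thesis by simp
qed

text \<open>Below any given order \<open>g\<close> may be replaced by a polynomial, and for
  polynomials the claim holds because \<open>ms\<close> is a ring homomorphism.\<close>

lemma (in substitution) ms_fpsub:
  assumes "ordge 1 f"
  shows "ms (fpsub g f) = fpsub g (ms f)"
proof (rule ps_eqI)
  fix M
  let ?D = "total_degree M" and ?T = "(\<Sum>j\<le>total_degree M. cst (fps_nth g j) * f ^ j)"
  have "ordge (Suc ?D) (ms (fpsub g f) - ms ?T)"
    using ordge_ms[OF ordge_fpsub_truncate[OF assms, of ?D g]] by (simp add: ms_diff)
  then have "cf (ms (fpsub g f)) M = cf (ms ?T) M"
    by (auto simp: ordge_diff_iff)
  also have "\<dots> = cf (fpsub g (ms f)) M"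
    by (simp add: ms_sum ms_cst_mult ms_power fpsub_def)
  finally show "cf (ms (fpsub g f)) M = cf (fpsub g (ms f)) M" .
qed

section \<open>Change of coefficients\<close>

definition map_ps :: "('a \<Rightarrow> 'b) \<Rightarrow> 'a ps \<Rightarrow> 'b ps" where
  "map_ps h f = Ps (\<lambda>M. h (cf f M))"

lemma cf_map_ps [simp]: "cf (map_ps h f) M = h (cf f M)"
  by (simp add: map_ps_def)

definition over :: "'a set \<Rightarrow> 'a ps \<Rightarrow> bool" where
  "over S f \<longleftrightarrow> (\<forall>M. cf f M \<in> S)"

lemma over_UNIV [simp]: "over UNIV f" by (simp add: over_def)

text \<open>Homomorphisms defined on a subring only, so that reduction modulo \<open>2\<close> is one of them.\<close>

locale subring_hom =
  fixes S :: "'a::comm_ring_1 set" and h :: "'a \<Rightarrow> 'b::comm_ring_1"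
  assumes S_0: "0 \<in> S" and S_1: "1 \<in> S"
    and S_add: "a \<in> S \<Longrightarrow> b \<in> S \<Longrightarrow> a + b \<in> S"
    and S_uminus: "a \<in> S \<Longrightarrow> - a \<in> S"
    and S_mult: "a \<in> S \<Longrightarrow> b \<in> S \<Longrightarrow> a * b \<in> S"
    and h_0: "h 0 = 0" and h_1: "h 1 = 1"
    and h_add: "a \<in> S \<Longrightarrow> b \<in> S \<Longrightarrow> h (a + b) = h a + h b"
    and h_mult: "a \<in> S \<Longrightarrow> b \<in> S \<Longrightarrow> h (a * b) = h a * h b"
begin

lemma S_sum: "(\<And>i. i \<in> T \<Longrightarrow> f i \<in> S) \<Longrightarrow> sum f T \<in> S"
  by (induction T rule: infinite_finite_induct) (auto simp: S_0 S_add)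

lemma h_sum: "(\<And>i. i \<in> T \<Longrightarrow> f i \<in> S) \<Longrightarrow> h (sum f T) = (\<Sum>i\<in>T. h (f i))"
  by (induction T rule: infinite_finite_induct) (auto simp: h_0 h_add S_sum)

lemma S_diff: "a \<in> S \<Longrightarrow> b \<in> S \<Longrightarrow> a - b \<in> S"
  using S_add[of a "- b"] S_uminus by simp

lemma h_uminus: "a \<in> S \<Longrightarrow> h (- a) = - h a"
  using h_add[of a "- a"] S_uminus by (simp add: h_0 eq_neg_iff_add_eq_0 add.commute)

lemma h_diff: "a \<in> S \<Longrightarrow> b \<in> S \<Longrightarrow> h (a - b) = h a - h b"
  using h_add[of a "- b"] S_uminus[of b] by (simp add: h_uminus)

lemma over_0: "over S 0" by (simp add: over_def S_0)
lemma over_xm: "over S (xm A)" by (simp add: over_def S_0 S_1)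
lemma over_1: "over S 1" by (simp add: over_def S_0 S_1)
lemma over_cst: "a \<in> S \<Longrightarrow> over S (cst a)" by (simp add: over_def cf_cst S_0)
lemma over_add: "over S f \<Longrightarrow> over S g \<Longrightarrow> over S (f + g)" by (simp add: over_def S_add)
lemma over_diff: "over S f \<Longrightarrow> over S g \<Longrightarrow> over S (f - g)" by (simp add: over_def S_diff)
lemma over_uminus: "over S f \<Longrightarrow> over S (- f)" by (simp add: over_def S_uminus)
lemma over_mult: "over S f \<Longrightarrow> over S g \<Longrightarrow> over S (f * g)"
  by (auto simp: over_def cf_mult intro!: S_sum S_mult)
lemma over_power: "over S f \<Longrightarrow> over S (f ^ k)"
  by (induction k) (auto simp: over_1 over_mult)
lemma over_fpsub: "(\<And>j. fps_nth g j \<in> S) \<Longrightarrow> over S f \<Longrightarrow> over S (fpsub g f)"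
  using over_power[of f] by (auto simp: over_def fpsub_def intro!: S_sum S_mult)

lemma map_ps_0: "map_ps h 0 = 0" by (rule ps_eqI) (simp add: h_0)
lemma map_ps_xm: "map_ps h (xm A) = xm A" by (rule ps_eqI) (simp add: h_0 h_1)
lemma map_ps_1: "map_ps h 1 = 1" by (rule ps_eqI) (simp add: h_0 h_1)
lemma map_ps_var: "map_ps h (var k) = var k" by (simp add: var_eq_xm map_ps_xm)
lemma map_ps_add: "over S f \<Longrightarrow> over S g \<Longrightarrow> map_ps h (f + g) = map_ps h f + map_ps h g"
  by (rule ps_eqI) (simp add: h_add over_def)
lemma map_ps_diff: "over S f \<Longrightarrow> over S g \<Longrightarrow> map_ps h (f - g) = map_ps h f - map_ps h g"
  by (rule ps_eqI) (simp add: h_diff over_def)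
lemma map_ps_mult: "over S f \<Longrightarrow> over S g \<Longrightarrow> map_ps h (f * g) = map_ps h f * map_ps h g"
  by (rule ps_eqI) (auto simp: cf_mult over_def S_mult h_sum h_mult case_prod_beta intro!: sum.cong)
lemma map_ps_power: "over S f \<Longrightarrow> map_ps h (f ^ k) = map_ps h f ^ k"
  by (induction k) (auto simp: map_ps_1 map_ps_mult over_power)
lemma map_ps_sum: "(\<And>i. i \<in> T \<Longrightarrow> over S (f i)) \<Longrightarrow> map_ps h (sum f T) = (\<Sum>i\<in>T. map_ps h (f i))"
  by (rule ps_eqI) (auto simp: over_def h_sum)
lemma map_ps_fpsub:
  assumes "\<And>j. fps_nth g j \<in> S" "over S f"
  shows "map_ps h (fpsub g f) = fpsub (Abs_fps (\<lambda>j. h (fps_nth g j))) (map_ps h f)"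
proof (rule ps_eqI)
  fix M
  have "cf (f ^ j) M \<in> S" for j using over_power[OF assms(2)] by (simp add: over_def)
  moreover have "cf (map_ps h f ^ j) M = h (cf (f ^ j) M)" for j
    using assms by (simp flip: map_ps_power)
  ultimately show "cf (map_ps h (fpsub g f)) M = cf (fpsub (Abs_fps (\<lambda>j. h (fps_nth g j))) (map_ps h f)) M"
    using assms by (simp add: fpsub_def h_sum S_mult h_mult)
qed
lemma ordge_map_ps: "ordge N f \<Longrightarrow> ordge N (map_ps h f)"
  by (simp add: ordge_def h_0)

end

section \<open>The locale-based ring of power series\<close>

lemma splits_Collect: "{(A, B). A + B = M} = splits M"
  by (simp add: splits_def)

lemma mps_ring_simps [simp]:
  "carrier mps_ring = UNIV"
  "f \<otimes>\<^bsub>mps_ring\<^esub> g = cf (Ps f * Ps g)"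
  "f \<oplus>\<^bsub>mps_ring\<^esub> g = cf (Ps f + Ps g)"
  "\<one>\<^bsub>mps_ring\<^esub> = cf 1"
  "\<zero>\<^bsub>mps_ring\<^esub> = cf 0"
  by (auto simp: mps_ring_def cf_mult splits_Collect intro!: ext)

lemma cring_mps_ring: "cring (mps_ring :: 'a::comm_ring_1 mps ring)"
proof (rule cringI)
  show "abelian_group (mps_ring :: 'a mps ring)"
  proof (rule abelian_groupI)
    fix f :: "'a mps"
    show "\<exists>g\<in>carrier mps_ring. g \<oplus>\<^bsub>mps_ring\<^esub> f = \<zero>\<^bsub>mps_ring\<^esub>"
      by (rule bexI[of _ "cf (- Ps f)"]) auto
  qed (auto simp: ac_simps)
  show "Group.comm_monoid (mps_ring :: 'a mps ring)"
    by (rule comm_monoidI) (auto simp: ac_simps)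
qed (auto simp: algebra_simps)

lemma mps_ring_pow [simp]:
  fixes f :: "'a::comm_ring_1 mps"
  shows "f [^]\<^bsub>mps_ring\<^esub> (j::nat) = cf (Ps f ^ j)"
proof -
  interpret cring "mps_ring :: 'a mps ring" by (rule cring_mps_ring)
  show ?thesis by (induction j) (auto simp: mult.commute)
qed

lemma mps_ring_finprod:
  fixes f :: "_ \<Rightarrow> 'a::comm_ring_1 mps"
  shows "finite S \<Longrightarrow> (\<Otimes>\<^bsub>mps_ring\<^esub>i\<in>S. f i) = cf (\<Prod>i\<in>S. Ps (f i))"
proof -
  interpret cring "mps_ring :: 'a mps ring" by (rule cring_mps_ring)
  show "finite S \<Longrightarrow> (\<Otimes>\<^bsub>mps_ring\<^esub>i\<in>S. f i) = cf (\<Prod>i\<in>S. Ps (f i))"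
    by (induction S rule: finite_induct) auto
qed

lemma mps_ring_finsum:
  fixes f :: "_ \<Rightarrow> 'a::comm_ring_1 mps"
  shows "finite S \<Longrightarrow> (\<Oplus>\<^bsub>mps_ring\<^esub>i\<in>S. f i) = cf (\<Sum>i\<in>S. Ps (f i))"
proof -
  interpret cring "mps_ring :: 'a mps ring" by (rule cring_mps_ring)
  show "finite S \<Longrightarrow> (\<Oplus>\<^bsub>mps_ring\<^esub>i\<in>S. f i) = cf (\<Sum>i\<in>S. Ps (f i))"
    by (induction S rule: finite_induct) auto
qed

lemma fps_subst_eq: "fps_subst g f = cf (fpsub g (Ps f))"
  by (simp add: fps_subst_def fpsub_def)

definition esym :: "nat \<Rightarrow> nat \<Rightarrow> (nat \<Rightarrow> 'a::comm_ring_1 ps) \<Rightarrow> 'a ps" where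
  "esym q k y = (\<Sum>S\<in>{S. S \<subseteq> {1..q} \<and> card S = k}. \<Prod>j\<in>S. y j)"

lemma elem_sym_eq: "elem_sym q k y = cf (esym q k (\<lambda>j. Ps (y j)))"
proof -
  have fin: "finite {S. S \<subseteq> {1..q} \<and> card S = k}"
    by (rule finite_subset[of _ "Pow {1..q}"]) auto
  have *: "(\<Otimes>\<^bsub>mps_ring\<^esub>j\<in>S. y j) = cf (\<Prod>j\<in>S. Ps (y j))" if "S \<subseteq> {1..q}" for S
    using finite_subset[OF that] by (simp add: mps_ring_finprod)
  have "Ps (\<Otimes>\<^bsub>mps_ring\<^esub>j\<in>S. y j) = (\<Prod>j\<in>S. Ps (y j))" if "S \<in> {S. S \<subseteq> {1..q} \<and> card S = k}" for S
    using * that by simp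
  then show ?thesis
    unfolding elem_sym_def esym_def mps_ring_finsum[OF fin] by (metis (no_types, lifting) sum.cong)
qed

declare add_bit_eq_xor [simp del] mult_bit_eq_and [simp del] power_bit_unfold [simp del]
  minus_bit_def [simp del] uminus_bit_def [simp del] divide_bit_def [simp del]

section \<open>Laurent polynomials and homogeneity\<close>

text \<open>Evaluation of a Laurent polynomial at \<open>v\<^sub>n = 1\<close>.\<close>

definition aug :: "(int \<Rightarrow>\<^sub>0 'a::comm_ring_1) \<Rightarrow> 'a" where
  "aug p = (\<Sum>k\<in>keys p. lookup p k)"

lemma aug_superset: "finite T \<Longrightarrow> keys p \<subseteq> T \<Longrightarrow> aug p = (\<Sum>k\<in>T. lookup p k)"
  unfolding aug_def by (rule sum.mono_neutral_left) (auto simp: in_keys_iff)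

lemma aug_single [simp]: "aug (single k a) = a"
  by (simp add: aug_def)

lemma aug_0 [simp]: "aug 0 = 0" by (simp add: aug_def)

lemma aug_add: "aug (p + q) = aug p + aug q"
proof -
  let ?T = "keys p \<union> keys q"
  show ?thesis
    using aug_superset[of ?T p] aug_superset[of ?T q] aug_superset[of ?T "p + q"] Poly_Mapping.keys_add[of p q]
    by (simp add: lookup_add sum.distrib)
qed

lemma aug_sum: "aug (sum f T) = (\<Sum>i\<in>T. aug (f i))"
  by (induction T rule: infinite_finite_induct) (auto simp: aug_add)

lemma sum_single_lookup: "(\<Sum>k\<in>keys p. single k (lookup p k)) = p"
  by (rule poly_mapping_eqI) (auto simp: lookup_sum lookup_single when_def in_keys_iff)

lemma aug_mult: "aug (p * q) = aug p * aug q"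
proof -
  have "p * q = (\<Sum>k\<in>keys p. \<Sum>l\<in>keys q. single (k + l) (lookup p k * lookup q l))"
    by (subst sum_single_lookup[of p, symmetric], subst sum_single_lookup[of q, symmetric])
       (simp add: sum_product mult_single)
  then show ?thesis
    by (simp add: aug_sum) (simp add: aug_def sum_product)
qed

lemma subring_hom_aug: "subring_hom UNIV (aug :: (int \<Rightarrow>\<^sub>0 'a::comm_ring_1) \<Rightarrow> 'a)"
  by unfold_locales (auto simp: aug_add aug_mult simp flip: single_one)

text \<open>The grading is by half the cohomological degree: each variable counts 1 and
  \<open>v\<^sub>n\<close> counts \<open>-(2^n - 1)\<close>.\<close>

definition homog :: "nat \<Rightarrow> int \<Rightarrow> (int \<Rightarrow>\<^sub>0 'a::comm_ring_1) ps \<Rightarrow> bool" where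
  "homog n e f \<longleftrightarrow> (\<forall>M k. k \<in> keys (cf f M) \<longrightarrow> int (total_degree M) - (2 ^ n - 1) * k = e)"

lemma homogD: "homog n e f \<Longrightarrow> k \<in> keys (cf f M) \<Longrightarrow> int (total_degree M) - (2 ^ n - 1) * k = e"
  by (auto simp: homog_def)

lemma homog_0 [simp]: "homog n e 0" by (simp add: homog_def)

lemma homog_add: "homog n e f \<Longrightarrow> homog n e g \<Longrightarrow> homog n e (f + g)"
  using Poly_Mapping.keys_add by (fastforce simp: homog_def)

lemma homog_uminus: "homog n e f \<Longrightarrow> homog n e (- f)"
  by (auto simp: homog_def)

lemma homog_diff: "homog n e f \<Longrightarrow> homog n e g \<Longrightarrow> homog n e (f - g)"
  using homog_add[of n e f "- g"] homog_uminus[of n e g] by simp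

lemma homog_sum: "(\<And>i. i \<in> T \<Longrightarrow> homog n e (f i)) \<Longrightarrow> homog n e (sum f T)"
  by (induction T rule: infinite_finite_induct) (auto simp: homog_add)

lemma homog_mult:
  assumes "homog n e f" "homog n e' g"
  shows "homog n (e + e') (f * g)"
  unfolding homog_def
proof (intro allI impI)
  fix M k assume "k \<in> keys (cf (f * g) M)"
  then have "k \<in> (\<Union>p\<in>splits M. keys (cf f (fst p) * cf g (snd p)))"
    unfolding cf_mult using keys_sum[of _ "splits M"] by (fastforce simp: case_prod_beta)
  then obtain A B where AB: "A + B = M" and "k \<in> keys (cf f A * cf g B)"
    by (auto simp: splits_def)
  with keys_mult[of "cf f A" "cf g B"] obtain a b
    where "k = a + b" "a \<in> keys (cf f A)" "b \<in> keys (cf g B)" by blast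
  with homogD[OF assms(1), of a A] homogD[OF assms(2), of b B] AB
  show "int (total_degree M) - (2 ^ n - 1) * k = e + e'"
    by (auto simp: algebra_simps)
qed

lemma homog_1: "homog n 0 1"
  by (auto simp: homog_def split: if_splits)

lemma homog_var: "homog n 1 (var i)"
  by (auto simp: homog_def var_eq_xm split: if_splits)

lemma homog_power: "homog n e f \<Longrightarrow> homog n (int k * e) (f ^ k)"
proof (induction k)
  case (Suc k)
  then show ?case using homog_mult[of n e f "int k * e" "f ^ k"] by (simp add: algebra_simps)
qed (simp add: homog_1)

lemma homog_prod: "(\<And>i. i \<in> T \<Longrightarrow> homog n (e i) (f i)) \<Longrightarrow> homog n (sum e T) (prod f T)"
  by (induction T rule: infinite_finite_induct) (auto simp: homog_1 homog_mult)

text \<open>The condition on \<open>g\<close> says that g(x) is itself homogeneous of degree 1, as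
  holds for the logarithm and for the formal inverse.\<close>

lemma homog_fpsub:
  assumes "\<And>j k. k \<in> keys (fps_nth g j) \<Longrightarrow> int j - (2 ^ n - 1) * k = 1" "homog n 1 f"
  shows "homog n 1 (fpsub g f)"
  unfolding homog_def
proof (intro allI impI)
  fix M k assume "k \<in> keys (cf (fpsub g f) M)"
  then obtain j where "k \<in> keys (fps_nth g j * cf (f ^ j) M)"
    unfolding fpsub_def using keys_sum[of _ "{..total_degree M}"] by fastforce
  with keys_mult[of "fps_nth g j" "cf (f ^ j) M"] obtain a b
    where "k = a + b" "a \<in> keys (fps_nth g j)" "b \<in> keys (cf (f ^ j) M)" by blast
  with homogD[OF homog_power[OF assms(2)], of b j M] assms(1)[of a j]
  show "int (total_degree M) - (2 ^ n - 1) * k = 1"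
    by (auto simp: algebra_simps)
qed

lemma homog_closed: "(\<And>N. \<exists>g. homog n e g \<and> ordge N (f - g)) \<Longrightarrow> homog n e f"
  unfolding homog_def ordge_diff_iff by (metis lessI)

text \<open>In a fixed degree the monomial determines the power of \<open>v\<^sub>n\<close>, because
  2^n - 1 is nonzero for n \<ge> 1. Hence a homogeneous series can be recovered from its value at
  \<open>v\<^sub>n = 1\<close>.\<close>

lemma homog_unique_key:
  assumes "n \<ge> 1" "homog n e f" "k \<in> keys (cf f M)"
  shows "cf f M = single k (lookup (cf f M) k)"
proof (rule poly_mapping_eqI)
  fix k'
  have "k' = k" if "k' \<in> keys (cf f M)"
  proof -
    have "(2 ^ n - 1) * k = (2 ^ n - 1) * k'"
      using homogD[OF assms(2,3)] homogD[OF assms(2) that] by linarith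
    moreover have "(2::int) ^ n - 1 \<noteq> 0"
      using assms(1) self_le_power[of "2::int" n] by auto
    ultimately show ?thesis by simp
  qed
  then show "lookup (cf f M) k' = lookup (single k (lookup (cf f M) k)) k'"
    by (auto simp: lookup_single when_def in_keys_iff)
qed

section \<open>Doubling of exponents\<close>

text \<open>The series f(x_1^2, x_2^2, ...). Its n-fold iterate replaces every variable by its Q-th
  power, the substitution in the functional equation of the logarithm.\<close>

definition dbl :: "'a::comm_ring_1 ps \<Rightarrow> 'a ps" where
  "dbl f = Ps (\<lambda>M. if \<exists>A. M = A + A then cf f (THE A. M = A + A) else 0)"

lemma monom_double_eq_iff [simp]: "A + A = B + B \<longleftrightarrow> A = (B :: monom)"
proof
  assume *: "A + A = B + B"
  show "A = B"
  proof (rule poly_mapping_eqI)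
    fix k show "lookup A k = lookup B k"
      using arg_cong[OF *, of "\<lambda>M. lookup M k"] by (simp add: lookup_add)
  qed
qed simp

lemma cf_dbl [simp]: "cf (dbl f) (A + A) = cf f A"
  by (auto simp: dbl_def)

lemma cf_dbl_0: "(\<And>A. M \<noteq> A + A) \<Longrightarrow> cf (dbl f) M = 0"
  by (auto simp: dbl_def)

lemma dbl_eqI: "(\<And>A. cf g (A + A) = cf f A) \<Longrightarrow> (\<And>M. (\<And>A. M \<noteq> A + A) \<Longrightarrow> cf g M = 0) \<Longrightarrow> dbl f = g"
proof (rule ps_eqI)
  fix M assume *: "\<And>A. cf g (A + A) = cf f A" "\<And>M. (\<And>A. M \<noteq> A + A) \<Longrightarrow> cf g M = 0"
  show "cf (dbl f) M = cf g M"
  proof (cases "\<exists>A. M = A + A")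
    case True
    then show ?thesis using *(1) by auto
  next
    case False
    then have "cf g M = 0" by (intro *(2)) auto
    then show ?thesis using False by (subst cf_dbl_0) auto
  qed
qed

lemma dbl_add: "dbl (f + g) = dbl f + dbl g"
  by (rule dbl_eqI) (auto simp: cf_dbl_0)

lemma dbl_diff: "dbl (f - g) = dbl f - dbl g"
  by (rule dbl_eqI) (auto simp: cf_dbl_0)

lemma dbl_uminus: "dbl (- f) = - dbl f"
  by (rule dbl_eqI) (auto simp: cf_dbl_0)

lemma dbl_1: "dbl 1 = 1"
proof (rule dbl_eqI)
  show "cf 1 (A + A) = cf 1 A" for A
    using monom_double_eq_iff[of A 0] by simp
  show "cf 1 M = 0" if "\<And>A. M \<noteq> A + A" for M
    using that[of 0] by simp
qed

lemma dbl_mult: "dbl (f * g) = dbl f * dbl g"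
proof (rule dbl_eqI)
  fix A
  \<comment> \<open>Only pairs of doubled monomials carry nonzero coefficients; their halves are
    exactly the splittings of \<open>A\<close>.\<close>
  have "cf (dbl f * dbl g) (A + A) = (\<Sum>(X, Y)\<in>(\<lambda>(X, Y). (X + X, Y + Y)) ` splits A. cf (dbl f) X * cf (dbl g) Y)"
    unfolding cf_mult
  proof (rule sum.mono_neutral_right)
    show "(\<lambda>(X, Y). (X + X, Y + Y)) ` splits A \<subseteq> splits (A + A)"
      by (auto simp: splits_def ac_simps)
    show "\<forall>p\<in>splits (A + A) - (\<lambda>(X, Y). (X + X, Y + Y)) ` splits A.
       (case p of (X, Y) \<Rightarrow> cf (dbl f) X * cf (dbl g) Y) = 0"
    proof
      fix p assume p: "p \<in> splits (A + A) - (\<lambda>(X, Y). (X + X, Y + Y)) ` splits A"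
      obtain X Y where XY: "p = (X, Y)" by force
      have "\<not> (\<exists>X' Y'. X = X' + X' \<and> Y = Y' + Y')"
      proof clarify
        fix X' Y' assume *: "X = X' + X'" "Y = Y' + Y'"
        with p XY have "(X' + Y') + (X' + Y') = A + A" by (simp add: splits_def ac_simps)
        then have "(X', Y') \<in> splits A" by (simp only: monom_double_eq_iff) (simp add: splits_def)
        with p XY * show False by force
      qed
      then show "(case p of (X, Y) \<Rightarrow> cf (dbl f) X * cf (dbl g) Y) = 0"
        using XY by (metis (mono_tags, lifting) case_prod_conv cf_dbl_0 mult_zero_left mult_zero_right)
    qed
  qed simp
  also have "\<dots> = cf (f * g) A"
    unfolding cf_mult by (subst sum.reindex) (auto simp: inj_on_def case_prod_beta)
  finally show "cf (dbl f * dbl g) (A + A) = cf (f * g) A" .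
next
  fix M :: monom assume M: "\<And>A. M \<noteq> A + A"
  have "cf (dbl f) X * cf (dbl g) Y = 0" if "(X, Y) \<in> splits M" for X Y
  proof (cases "\<exists>X' Y'. X = X' + X' \<and> Y = Y' + Y'")
    case True
    then obtain X' Y' where "X = X' + X'" "Y = Y' + Y'" by blast
    then have "M = (X' + Y') + (X' + Y')" using that by (simp add: splits_def ac_simps)
    with M show ?thesis by blast
  next
    case False
    then show ?thesis by (metis cf_dbl_0 mult_zero_left mult_zero_right)
  qed
  then show "cf (dbl f * dbl g) M = 0"
    unfolding cf_mult by (intro sum.neutral) auto
qed

lemma dbl_power: "dbl (f ^ k) = dbl f ^ k"
  by (induction k) (auto simp: dbl_1 dbl_mult)

lemma dbl_xm: "dbl (xm A) = xm (A + A)"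
  by (rule dbl_eqI) auto

lemma dbl_var: "dbl (var i) = var i ^ 2"
  by (simp add: var_eq_xm dbl_xm power2_eq_square flip: xm_add)

lemma ordge_dbl: "ordge N f \<Longrightarrow> ordge (2 * N) (dbl f)"
  by (auto simp: ordge_def dbl_def)

lemma dbl_fpsub:
  assumes "ordge 1 f"
  shows "dbl (fpsub g f) = fpsub g (dbl f)"
proof (rule dbl_eqI)
  fix A
  have "cf (fpsub g (dbl f)) (A + A) = (\<Sum>j\<le>total_degree (A + A). fps_nth g j * cf (f ^ j) A)"
    by (simp add: fpsub_def flip: dbl_power del: total_degree_add)
  also have "\<dots> = cf (fpsub g f) A"
    using assms by (intro cf_fpsub[symmetric]) auto
  finally show "cf (fpsub g (dbl f)) (A + A) = cf (fpsub g f) A" .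
next
  fix M :: monom assume "\<And>A. M \<noteq> A + A"
  then show "cf (fpsub g (dbl f)) M = 0"
    by (simp add: fpsub_def cf_dbl_0 flip: dbl_power)
qed

lemma over_dbl: "0 \<in> S \<Longrightarrow> over S f \<Longrightarrow> over S (dbl f)"
  by (auto simp: over_def dbl_def)

lemma map_ps_dbl: "h 0 = 0 \<Longrightarrow> map_ps h (dbl f) = dbl (map_ps h f)"
  by (rule dbl_eqI[symmetric]) (auto simp: cf_dbl_0)

lemma dblpow_diff: "(dbl ^^ n) (f - g) = (dbl ^^ n) f - (dbl ^^ n) g"
  by (induction n) (auto simp: dbl_diff)

lemma dblpow_add: "(dbl ^^ n) (f + g) = (dbl ^^ n) f + (dbl ^^ n) g"
  by (induction n) (auto simp: dbl_add)

lemma dblpow_uminus: "(dbl ^^ n) (- f) = - (dbl ^^ n) f"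
  by (induction n) (auto simp: dbl_uminus)

lemma ordge_dblpow: "ordge N f \<Longrightarrow> ordge (2 ^ n * N) ((dbl ^^ n) f)"
  by (induction n) (auto simp: mult.assoc dest: ordge_dbl)

lemma dblpow_fpsub: "ordge 1 f \<Longrightarrow> (dbl ^^ n) (fpsub g f) = fpsub g ((dbl ^^ n) f)"
proof (induction n)
  case (Suc n)
  have "ordge 1 ((dbl ^^ n) f)"
    by (rule ordge_mono[OF ordge_dblpow[OF Suc.prems]]) simp
  then show ?case using Suc by (simp add: dbl_fpsub)
qed simp

lemma dblpow_var: "(dbl ^^ n) (var i) = var i ^ (2 ^ n)"
  by (induction n) (auto simp: dbl_power dbl_var simp flip: power_mult)

lemma over_dblpow: "0 \<in> S \<Longrightarrow> over S f \<Longrightarrow> over S ((dbl ^^ n) f)"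
  by (induction n) (auto intro: over_dbl)

lemma map_ps_dblpow: "h 0 = 0 \<Longrightarrow> map_ps h ((dbl ^^ n) f) = (dbl ^^ n) (map_ps h f)"
  by (induction n) (auto simp: map_ps_dbl)

section \<open>Frobenius over the field with two elements\<close>

lemma bit_add_self [simp]: "a + a = (0 :: bit)"
  by (cases a) auto

lemma bit_mult_self: "a * a = (a :: bit)"
  by (cases a) auto

text \<open>The two members of a nontrivial orbit contribute equal bits, which cancel. Each
  induction step removes one such orbit.\<close>

lemma sum_bit_involution:
  fixes f :: "'b \<Rightarrow> bit"
  assumes "finite S" "\<And>x. x \<in> S \<Longrightarrow> \<tau> x \<in> S" "\<And>x. x \<in> S \<Longrightarrow> \<tau> (\<tau> x) = x" "\<And>x. x \<in> S \<Longrightarrow> f (\<tau> x) = f x"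
  shows "sum f S = sum f {x \<in> S. \<tau> x = x}"
  using assms
proof (induction "card S" arbitrary: S rule: less_induct)
  case less
  show ?case
  proof (cases "\<exists>x\<in>S. \<tau> x \<noteq> x")
    case True
    then obtain x where x: "x \<in> S" "\<tau> x \<noteq> x" by blast
    let ?T = "S - {x, \<tau> x}"
    have S: "S = insert x (insert (\<tau> x) ?T)" using x less.prems by auto
    have fin: "finite ?T" using less.prems by simp
    have "card ?T < card S" using x less.prems by (intro psubset_card_mono) auto
    then have "sum f ?T = sum f {y \<in> ?T. \<tau> y = y}"
    proof (rule less.hyps)
      fix y assume y: "y \<in> ?T"
      then show "\<tau> (\<tau> y) = y" "f (\<tau> y) = f y"
        using less.prems by auto
      have "\<tau> y \<noteq> x" "\<tau> y \<noteq> \<tau> x"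
        using y x less.prems(3) by (metis DiffE insertCI)+
      then show "\<tau> y \<in> ?T" using y less.prems(2) by auto
    qed (use fin in auto)
    also have "{y \<in> ?T. \<tau> y = y} = {y \<in> S. \<tau> y = y}"
      using x less.prems by auto
    also have "sum f ?T = sum f S"
      by (subst S) (use fin x less.prems in \<open>auto simp: add.assoc[symmetric]\<close>)
    finally show ?thesis .
  next
    case False
    then have "{x \<in> S. \<tau> x = x} = S" by auto
    then show ?thesis by simp
  qed
qed

lemma swap_eq_self_iff: "prod.swap p = p \<longleftrightarrow> fst p = snd p"
  by (metis fst_swap prod.expand snd_swap)

text \<open>Exchanging the two factors pairs off the cross terms, which cancel in characteristic 2;
  the coefficients on the diagonal, being bits, are their own squares.\<close>

lemma bit_square_eq_dbl: "f ^ 2 = dbl f" for f :: "bit ps"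
proof (rule dbl_eqI[symmetric])
  have *: "cf (f ^ 2) M = (\<Sum>(A, B)\<in>{p \<in> splits M. prod.swap p = p}. cf f A * cf f B)" for M
    unfolding power2_eq_square cf_mult
  proof (rule sum_bit_involution)
    fix p assume "p \<in> splits M"
    then show "prod.swap p \<in> splits M" by (simp add: splits_def case_prod_beta add.commute)
    show "(case prod.swap p of (A, B) \<Rightarrow> cf f A * cf f B) = (case p of (A, B) \<Rightarrow> cf f A * cf f B)"
      by (simp add: case_prod_beta mult.commute)
  qed simp_all
  show "cf (f ^ 2) (A + A) = cf f A" for A
  proof -
    have eq: "{p \<in> splits (A + A). prod.swap p = p} = {(A, A)}"
      unfolding swap_eq_self_iff splits_def by auto
    show ?thesis unfolding * eq by (simp add: bit_mult_self)
  qed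
  fix M :: monom assume M: "\<And>A. M \<noteq> A + A"
  then have eq: "{p \<in> splits M. prod.swap p = p} = {}"
    unfolding swap_eq_self_iff splits_def by auto
  show "cf (f ^ 2) M = 0" unfolding * eq by simp
qed

lemma bit_power_eq_dblpow: "f ^ (2 ^ n) = (dbl ^^ n) f" for f :: "bit ps"
proof (induction n)
  case (Suc n)
  have "f ^ (2 ^ Suc n) = (f ^ (2 ^ n)) ^ 2"
    by (simp only: power_Suc mult.commute[of 2 "2 ^ n"] power_mult)
  then show ?case by (simp add: Suc bit_square_eq_dbl)
qed simp

section \<open>Reduction modulo 2\<close>

definition zloc :: "rat set" where "zloc = {r. odd (snd (quotient_of r))}"

lemma of_int_bit: "(of_int x :: bit) = (if even x then 0 else 1)"
proof (cases "even x")
  case True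
  then obtain y where "x = 2 * y" by (elim evenE)
  then show ?thesis by simp
next
  case False
  then obtain y where "x = 2 * y + 1" by (elim oddE)
  then show ?thesis by simp
qed

text \<open>\<open>rat_mod2\<close> refers to lowest terms. Cross multiplication with an arbitrary
  fraction of odd denominator frees it from them, so that sums and products can be computed on
  unreduced fractions.\<close>

lemma rat_mod2_frac:
  assumes "odd b"
  shows "of_int a / of_int b \<in> zloc" "rat_mod2 (of_int a / of_int b) = of_int a"
proof -
  obtain p q where pq: "quotient_of (of_int a / of_int b) = (p, q)" by force
  have "of_int a / of_int b = (of_int p / of_int q :: rat)" by (rule quotient_of_div[OF pq])
  moreover have "q > 0" "b \<noteq> 0" using quotient_of_denom_pos[OF pq] assms by auto
  ultimately have "(of_int (a * q) :: rat) = of_int (p * b)" by (simp add: field_simps)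
  then have eq: "a * q = p * b" by (simp only: of_int_eq_iff)
  have "coprime p q" by (rule quotient_of_coprime[OF pq])
  have "odd q"
  proof
    assume "even q"
    then have "even (p * b)" using eq by (metis dvd_mult)
    then have "even p" using assms by simp
    with \<open>even q\<close> \<open>coprime p q\<close> show False by (meson coprime_common_divisor odd_one)
  qed
  then show "of_int a / of_int b \<in> zloc" by (simp add: zloc_def pq)
  have "even a \<longleftrightarrow> even p" using arg_cong[OF eq, of even] \<open>odd q\<close> assms by simp
  then show "rat_mod2 (of_int a / of_int b) = of_int a" by (simp add: rat_mod2_def pq of_int_bit)
qed

lemma zlocE:
  assumes "r \<in> zloc"
  obtains a b where "odd b" "r = of_int a / of_int b"
proof -
  obtain p q where "quotient_of r = (p, q)" by force
  with assms that show ?thesis by (auto simp: zloc_def dest: quotient_of_div)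
qed

lemma subring_hom_mod2: "subring_hom zloc rat_mod2"
proof
  show "0 \<in> zloc" "1 \<in> zloc" "rat_mod2 0 = 0" "rat_mod2 1 = 1"
    using rat_mod2_frac[of 1 0] rat_mod2_frac[of 1 1] by auto
  fix x y assume "x \<in> zloc" "y \<in> zloc"
  then obtain a b c d where *: "odd b" "x = of_int a / of_int b" "odd d" "y = of_int c / of_int d"
    by (metis zlocE)
  have nz: "b \<noteq> 0" "d \<noteq> 0" using * by auto
  have xy: "x + y = of_int (a * d + c * b) / of_int (b * d)" "x * y = of_int (a * c) / of_int (b * d)"
    "- x = of_int (- a) / of_int b"
    using * nz by (auto simp: field_simps)
  have bd: "odd (b * d)" using * by simp
  have one: "(of_int b :: bit) = 1" "(of_int d :: bit) = 1"
    using * by (simp_all add: of_int_bit)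
  show "x + y \<in> zloc" "x * y \<in> zloc" "- x \<in> zloc"
    unfolding xy by (intro rat_mod2_frac bd *(1))+
  show "rat_mod2 (x + y) = rat_mod2 x + rat_mod2 y" "rat_mod2 (x * y) = rat_mod2 x * rat_mod2 y"
    unfolding xy rat_mod2_frac(2)[OF bd] unfolding *(2,4) rat_mod2_frac(2)[OF *(1)] rat_mod2_frac(2)[OF *(3)]
    by (simp_all add: one)
qed

interpretation mod2: subring_hom zloc rat_mod2 by (rule subring_hom_mod2)

lemma zloc_of_nat: "of_nat k \<in> zloc"
  using rat_mod2_frac(1)[of 1 "int k"] by simp

lemma zloc_half: 
  assumes "r \<in> zloc" "rat_mod2 r = 0"
  shows "r / 2 \<in> zloc"
proof -
  obtain a b where ab: "odd b" "r = of_int a / of_int b" using zlocE[OF assms(1)] by blast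
  then have "(of_int a :: bit) = 0" using assms(2) rat_mod2_frac(2) by simp
  then have "even a" by (simp add: of_int_bit split: if_splits)
  then obtain c where "a = 2 * c" by (elim evenE)
  then have "r / 2 = of_int c / of_int b" using ab by simp
  then show ?thesis using rat_mod2_frac(1)[OF ab(1)] by simp
qed

definition half :: "rat ps \<Rightarrow> rat ps" where "half f = cst (1/2) * f"

lemma cf_half [simp]: "cf (half f) M = cf f M / 2" by (simp add: half_def)

lemma over_half: "over zloc f \<Longrightarrow> map_ps rat_mod2 f = 0 \<Longrightarrow> over zloc (half f)"
  unfolding over_def by (metis cf_half cf_map_ps cf_basic(1) zloc_half)

text \<open>If A and B agree modulo 2, then their 2^t-th powers agree modulo 2^(t+1): with a and b
  the current powers, a^2 - b^2 = (a - b)(2b + (a - b)) gains a further factor 2. This compensates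
  the denominators of the logarithm.\<close>

lemma over_half_pow_diff:
  assumes "over zloc A" "over zloc B" "over zloc (cst (1/2) * (A - B))"
  shows "over zloc (cst (1 / 2 ^ Suc t) * (A ^ (2 ^ t) - B ^ (2 ^ t)))"
proof (induction t)
  case 0
  show ?case using assms(3) by (simp only: power_0 power_one_right power_Suc mult_1_right)
next
  case (Suc t)
  have two: "2 * f = cst 2 * f" for f :: "rat ps" by (rule ps_eqI) simp
  have four: "cst 4 = cst 2 * cst (2 :: rat)" by (simp flip: cst_mult)
  define C where "C = cst (1 / 2 ^ Suc t) * (A ^ (2 ^ t) - B ^ (2 ^ t))"
  have C: "over zloc C" using Suc by (simp only: C_def)
  have AB: "A ^ (2 ^ t) - B ^ (2 ^ t) = cst (2 ^ Suc t) * C"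
    by (rule ps_eqI) (simp add: C_def)
  have "A ^ (2 ^ Suc t) - B ^ (2 ^ Suc t) =
      (A ^ (2 ^ t) - B ^ (2 ^ t)) * (2 * B ^ (2 ^ t) + (A ^ (2 ^ t) - B ^ (2 ^ t)))"
    by (simp add: power_mult mult.commute[of 2] power2_eq_square) (simp add: algebra_simps)
  also have "\<dots> = cst (2 ^ Suc t) * C * (cst 2 * B ^ (2 ^ t) + cst (2 ^ Suc t) * C)"
    unfolding AB by (simp add: two)
  also have "\<dots> = cst (2 ^ Suc (Suc t)) * (C * (B ^ (2 ^ t) + cst (2 ^ t) * C))"
    by (simp add: cst_mult four algebra_simps)
  finally have "A ^ (2 ^ Suc t) - B ^ (2 ^ Suc t) =
      cst (2 ^ Suc (Suc t)) * (C * (B ^ (2 ^ t) + cst (2 ^ t) * C))" .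
  moreover have "cst (1 / 2 ^ k) * (cst (2 ^ k) * f) = f" for k and f :: "rat ps"
    by (simp flip: cst_mult mult.assoc)
  ultimately have "cst (1 / 2 ^ Suc (Suc t)) * (A ^ (2 ^ Suc t) - B ^ (2 ^ Suc t)) =
      C * (B ^ (2 ^ t) + cst (2 ^ t) * C)"
    by (simp only:)
  moreover have "2 ^ t \<in> zloc" using zloc_of_nat[of "2 ^ t"] by simp
  then have "over zloc (C * (B ^ (2 ^ t) + cst (2 ^ t) * C))"
    by (intro mod2.over_mult mod2.over_add mod2.over_power mod2.over_cst C assms)
  ultimately show ?case by (simp only:)
qed

section \<open>The logarithm\<close>

lemma fps_nth_compose_X_pow:
  fixes f :: "'a::comm_ring_1 fps"
  assumes "d > 0"
  shows "fps_nth (f oo fps_X ^ d) j = (if d dvd j then fps_nth f (j div d) else 0)"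
proof -
  have "fps_nth (f oo fps_X ^ d) j = (\<Sum>i\<in>{0..j}. if d dvd j \<and> i = j div d then fps_nth f i else 0)"
    unfolding fps_compose_nth
    by (rule sum.cong) (use assms in \<open>auto simp flip: power_mult\<close>)
  then show ?thesis by (auto simp: div_le_dividend)
qed

locale morava =
  fixes n :: nat
  assumes n_ge_1: "n \<ge> 1"
begin

abbreviation "Q \<equiv> (2 :: nat) ^ n"

lemma Q_ge_2: "Q \<ge> 2"
  using self_le_power[of 2 n] n_ge_1 by simp

definition vgen :: "nat \<Rightarrow> (int \<Rightarrow>\<^sub>0 rat)" where
  "vgen i = (if i = n then single 1 1 else 0)"

abbreviation "logv \<equiv> BP_log vgen"

definition log1 :: "rat fps" where "log1 = Abs_fps (\<lambda>j. aug (fps_nth logv j))"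

definition lc :: "nat \<Rightarrow> rat" where "lc k = aug (BP_log_coeff vgen k)"

lemma aug_power: "aug (p ^ k) = aug p ^ k"
  by (induction k) (auto simp: aug_mult simp flip: single_one)

lemma lc_0: "lc 0 = 1"
  by (simp add: lc_def flip: single_one)

text \<open>Only the summand of Hazewinkel's recursion that contains \<open>v\<^sub>n\<close>
  survives, the one with i = k + 1 - n. Consequently \<open>lc (m * n)\<close> is 2^(-m), and
  \<open>lc\<close> vanishes at all indices not divisible by n.\<close>

lemma lc_Suc: "lc (Suc k) = (if n \<le> Suc k then lc (Suc k - n) / 2 else 0)"
proof -
  have "lc (Suc k) = 1/2 * (\<Sum>i\<le>k. lc i * aug (vgen (Suc k - i)) ^ (2 ^ i))"
    by (simp add: lc_def aug_mult aug_sum aug_power)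
  also have "(\<Sum>i\<le>k. lc i * aug (vgen (Suc k - i)) ^ (2 ^ i)) = (\<Sum>i\<le>k. if i = Suc k - n \<and> n \<le> Suc k then lc i else 0)"
    by (rule sum.cong) (auto simp: vgen_def)
  also have "\<dots> = (if n \<le> Suc k then lc (Suc k - n) else 0)"
    using n_ge_1 by (cases "n \<le> Suc k") auto
  finally show ?thesis by (cases "n \<le> Suc k") simp_all
qed

lemma lc_add: "lc (n + k) = lc k / 2"
  using lc_Suc[of "n + k - 1"] n_ge_1 by simp

lemma lc_less: "0 < k \<Longrightarrow> k < n \<Longrightarrow> lc k = 0"
  using lc_Suc[of "k - 1"] by simp

lemma logv_pow2: "fps_nth logv (2 ^ k) = BP_log_coeff vgen k"
proof -
  have "{i. (2::nat) ^ i = 2 ^ k} = {k}" by auto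
  then show ?thesis by (simp add: BP_log_def)
qed

lemma logv_other: "(\<And>k. j \<noteq> 2 ^ k) \<Longrightarrow> fps_nth logv j = 0"
proof -
  assume "\<And>k. j \<noteq> 2 ^ k"
  then have "{k. 2 ^ k = j} = {}" by auto
  then show ?thesis by (simp add: BP_log_def)
qed

lemma log1_pow2: "fps_nth log1 (2 ^ k) = lc k"
  by (simp add: log1_def logv_pow2 lc_def)

lemma log1_other: "(\<And>k. j \<noteq> 2 ^ k) \<Longrightarrow> fps_nth log1 j = 0"
  by (simp add: log1_def logv_other)

lemma logv_0: "fps_nth logv 0 = 0" and logv_1: "fps_nth logv 1 = 1"
  using logv_other[of 0] logv_pow2[of 0] by auto

lemma log1_0: "fps_nth log1 0 = 0" and log1_1: "fps_nth log1 1 = 1"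
  using log1_other[of 0] log1_pow2[of 0] lc_0 by auto

text \<open>Homogeneity of the logarithm. Hazewinkel's recursion passes from index t to index n + t
  and multiplies by the 2^t-th power of \<open>v\<^sub>n\<close>, which matches 2^(n+t) - 2^t = (2^n
  - 1) 2^t.\<close>

lemma keys_log_coeff: "i \<in> keys (BP_log_coeff vgen k) \<Longrightarrow> 2 ^ k - (2 ^ n - 1) * i = 1"
proof (induction k arbitrary: i rule: less_induct)
  case (less k)
  show ?case
  proof (cases k)
    case 0
    with less.prems show ?thesis by simp
  next
    case (Suc m)
    from less.prems have "i \<in> keys (single 0 (1/2) * (\<Sum>t\<le>m. BP_log_coeff vgen t * vgen (Suc m - t) ^ (2 ^ t)))"
      by (simp add: Suc)
    with keys_mult[of "single 0 (1/2 :: rat)"]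
    have "i \<in> keys (\<Sum>t\<le>m. BP_log_coeff vgen t * vgen (Suc m - t) ^ (2 ^ t))"
      by fastforce
    with keys_sum[of _ "{..m}"] obtain t where t: "t \<le> m" "i \<in> keys (BP_log_coeff vgen t * vgen (Suc m - t) ^ (2 ^ t))"
      by fastforce
    have "vgen (Suc m - t) \<noteq> 0"
      using t(2) by (auto simp: zero_power)
    then have nt: "Suc m - t = n" by (simp add: vgen_def split: if_splits)
    have "single 1 1 ^ a = (single (int a) 1 :: int \<Rightarrow>\<^sub>0 rat)" for a
      by (induction a) (auto simp: mult_single)
    then have "vgen (Suc m - t) ^ (2 ^ t) = single (2 ^ t) 1" by (simp add: nt vgen_def)
    with t(2) keys_mult[of "BP_log_coeff vgen t" "single (2 ^ t) (1 :: rat)"]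
    obtain j where j: "i = j + 2 ^ t" "j \<in> keys (BP_log_coeff vgen t)"
      by (force split: if_splits)
    have "2 ^ t - (2 ^ n - 1) * j = 1" using less.IH[of t j] t(1) j(2) Suc by simp
    moreover have "k = n + t" using nt t(1) n_ge_1 Suc by linarith
    then have "(2::int) ^ k = 2 ^ n * 2 ^ t" by (simp add: power_add)
    moreover have "(2 ^ n - 1) * i = (2 ^ n - 1) * j + 2 ^ n * 2 ^ t - 2 ^ t"
      by (simp add: j(1) algebra_simps)
    ultimately show ?thesis by linarith
  qed
qed

lemma keys_logv: "k \<in> keys (fps_nth logv j) \<Longrightarrow> int j - (2 ^ n - 1) * k = 1"
proof -
  assume k: "k \<in> keys (fps_nth logv j)"
  then obtain i where "j = 2 ^ i" using logv_other[of j] by (metis keys_zero empty_iff)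
  with k keys_log_coeff[of k i] show ?thesis by (simp add: logv_pow2)
qed

text \<open>This is \<open>lc_add\<close> read coefficientwise; the separate summand x accounts for
  \<open>lc 0 = 1\<close>.\<close>

lemma log1_functional: "log1 = fps_X + fps_const (1/2) * (log1 oo fps_X ^ Q)"
proof (rule fps_ext)
  fix j
  have "fps_nth log1 j = (if j = 1 then 1 else 0) + 1/2 * (if Q dvd j then fps_nth log1 (j div Q) else 0)"
  proof (cases "\<exists>k. j = 2 ^ k")
    case True
    then obtain k where k: "j = 2 ^ k" by blast
    show ?thesis
    proof (cases "n \<le> k")
      case True
      then obtain m where m: "k = n + m" using le_Suc_ex by blast
      have "j div Q = 2 ^ m" "Q dvd j" by (auto simp: k m power_add)
      then show ?thesis using Q_ge_2 n_ge_1 by (simp add: k m log1_pow2 lc_add)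
    next
      case False
      have "\<not> Q dvd j" using False k power_dvd_imp_le[of "2::nat" n k] by auto
      moreover have "k = 0 \<or> 0 < k" by auto
      ultimately show ?thesis using False lc_less[of k] by (auto simp: k log1_pow2 lc_0)
    qed
  next
    case False
    then have "fps_nth log1 j = 0" "j \<noteq> 1" using log1_other[of j] power_0[of "2::nat"] by (blast, metis)
    moreover have "fps_nth log1 (j div Q) = 0" if "Q dvd j"
    proof (rule log1_other)
      fix k
      have "j = 2 ^ (n + k)" if "j div Q = 2 ^ k"
        using that \<open>Q dvd j\<close> by (auto simp: power_add)
      with False show "j div Q \<noteq> 2 ^ k" by blast
    qed
    ultimately show ?thesis by auto
  qed
  then show "fps_nth log1 j = fps_nth (fps_X + fps_const (1/2) * (log1 oo fps_X ^ Q)) j"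
    by (simp add: fps_nth_compose_X_pow)
qed

lemma fpsub_log1:
  assumes "ordge 1 f"
  shows "fpsub log1 f = f + half (fpsub log1 (f ^ Q))"
proof -
  have const: "fpsub (fps_const a * h) f = cst a * fpsub h f" for a :: rat and h
    by (rule ps_eqI) (simp add: fpsub_def sum_distrib_left mult.assoc)
  have "fpsub log1 f = fpsub (fps_X + fps_const (1/2) * (log1 oo fps_X ^ Q)) f"
    using log1_functional by simp
  also have "\<dots> = f + half (fpsub (log1 oo fps_X ^ Q) f)"
    using assms by (simp only: fpsub_add fpsub_X const half_def)
  also have "fpsub (log1 oo fps_X ^ Q) f = fpsub log1 (fpsub (fps_X ^ Q) f)"
    by (rule fpsub_compose) (use assms in auto)
  also have "fpsub (fps_X ^ Q) f = f ^ Q"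
    using assms by (simp add: fpsub_power fpsub_X)
  finally show ?thesis .
qed

section \<open>Integrality\<close>

text \<open>Raising the index by n costs one factor 2 in the denominator, while the power of 2 in
  front grows by n \<ge> 1 factors.\<close>

lemma two_power_lc: "2 ^ k * lc k \<in> zloc"
proof (induction k rule: less_induct)
  case (less k)
  show ?case
  proof (cases "n \<le> k")
    case True
    then obtain m where m: "k = n + m" using le_Suc_ex by blast
    have "(2::rat) ^ n = 2 * 2 ^ (n - 1)" using n_ge_1 by (simp flip: power_Suc)
    then have eq: "2 ^ k * lc k = of_nat (2 ^ (n - 1)) * (2 ^ m * lc m)"
      by (simp add: m lc_add power_add)
    have "2 ^ m * lc m \<in> zloc" using less.IH[of m] m n_ge_1 by simp
    then show ?thesis unfolding eq by (rule mod2.S_mult[OF zloc_of_nat])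
  next
    case False
    then have "k = 0 \<or> lc k = 0" using lc_less[of k] by auto
    then show ?thesis using mod2.S_0 mod2.S_1 lc_0 by auto
  qed
qed

text \<open>The logarithm preserves congruence modulo 2 of integral series, although its values need
  not be integral: the coefficient of the 2^t-th power has denominator at most 2^t, and the
  difference of the 2^t-th powers is divisible by 2^(t+1).\<close>

lemma half_fpsub_diff:
  assumes "over zloc A" "over zloc B" "over zloc (half (A - B))"
  shows "over zloc (half (fpsub log1 A - fpsub log1 B))"
  unfolding over_def
proof
  fix M
  have in_zloc: "fps_nth log1 j * (cf (A ^ j) M - cf (B ^ j) M) / 2 \<in> zloc" for j
  proof (cases "\<exists>t. j = 2 ^ t")
    case True
    then obtain t where t: "j = 2 ^ t" by blast
    have "cf (cst (1 / 2 ^ Suc t) * (A ^ (2 ^ t) - B ^ (2 ^ t))) M \<in> zloc"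
      using over_half_pow_diff[OF assms(1,2), of t] assms(3) by (simp add: over_def half_def)
    then have "(2 ^ t * lc t) * (1 / 2 ^ Suc t * (cf (A ^ (2 ^ t)) M - cf (B ^ (2 ^ t)) M)) \<in> zloc"
      by (intro mod2.S_mult[OF two_power_lc]) (simp only: cf_cst_mult cf_basic)
    then show ?thesis by (simp add: t log1_pow2)
  next
    case False
    then show ?thesis using log1_other[of j] mod2.S_0 by auto
  qed
  have "cf (half (fpsub log1 A - fpsub log1 B)) M =
      (\<Sum>j\<le>total_degree M. fps_nth log1 j * (cf (A ^ j) M - cf (B ^ j) M) / 2)"
    by (simp add: fpsub_def right_diff_distrib sum_subtractf diff_divide_distrib flip: sum_divide_distrib)
  then show "cf (half (fpsub log1 A - fpsub log1 B)) M \<in> zloc"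
    using in_zloc by (auto intro: mod2.S_sum)
qed

abbreviation frob :: "'a::comm_ring_1 ps \<Rightarrow> 'a ps" where "frob \<equiv> dbl ^^ n"

lemma ordge_frob: "ordge N f \<Longrightarrow> ordge (Q * N) (frob f)"
  by (rule ordge_dblpow)

text \<open>After reduction modulo 2, raising to the Q-th power is the same as replacing all
  variables by their Q-th powers.\<close>

lemma half_power_diff_frob:
  assumes "over zloc f"
  shows "over zloc (half (frob f - f ^ Q))"
proof (rule over_half)
  have 0: "over zloc (frob f)" "over zloc (f ^ Q)"
    using assms mod2.S_0 by (auto intro: over_dblpow mod2.over_power)
  then show "over zloc (frob f - f ^ Q)" by (rule mod2.over_diff)
  have "map_ps rat_mod2 (frob f) = map_ps rat_mod2 (f ^ Q)"
    using assms by (simp add: map_ps_dblpow mod2.h_0 mod2.map_ps_power bit_power_eq_dblpow)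
  then show "map_ps rat_mod2 (frob f - f ^ Q) = 0"
    using 0 by (simp add: mod2.map_ps_diff)
qed

text \<open>The functional equation lemma: \<open>G\<close> is the fixed point of a contraction that preserves
  integrality.\<close>

lemma integrality:
  assumes G: "ordge 1 G" and U: "over zloc U" "fpsub log1 G - half (fpsub log1 (frob G)) = U"
  shows "over zloc G"
proof -
  \<comment> \<open>By \<open>fpsub_log1\<close> the logarithm of G is G plus half the logarithm of
    G^Q, so the hypothesis on G says that it is a fixed point of \<Psi>. For integral f the series
    \<open>frob f\<close> and \<open>f ^ Q\<close> agree modulo 2, so \<open>half_fpsub_diff\<close>
    keeps the values of \<Psi> integral.\<close>
  define \<Psi> where "\<Psi> f = U + half (fpsub log1 (frob f) - fpsub log1 (f ^ Q))" for f
  have frob1: "ordge 1 (frob f)" "ordge 1 (f ^ Q)" if "ordge 1 f" for f :: "rat ps"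
    using ordge_mono[OF ordge_frob[OF that]] ordge_mono[OF ordge_power[OF that, of Q]] by auto
  have half: "ordge N f \<Longrightarrow> ordge N (half f)" for N f by (auto simp: ordge_def)
  have \<Psi>1: "ordge 1 (\<Psi> f)" if "ordge 1 f" for f
    unfolding \<Psi>_def U(2)[symmetric]
    by (intro ordge_add ordge_diff half ordge_fpsub frob1 that G log1_0)
  have contr: "ordge (Suc N) (\<Psi> f - \<Psi> g)" if "ordge 1 f" "ordge 1 g" "ordge N (f - g)" for f g N
  proof -
    have frobN: "ordge (Suc N) (frob f - frob g)"
    proof (cases "N = 0")
      case True
      then show ?thesis using ordge_diff[OF frob1(1)[OF that(1)] frob1(1)[OF that(2)]] by simp
    next
      case False
      then have "Suc N \<le> Q * N" using mult_le_mono1[OF Q_ge_2, of N] by linarith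
      then show ?thesis
        using ordge_mono[OF ordge_frob[OF that(3)]] by (simp add: dblpow_diff)
    qed
    have powN: "ordge (Suc N) (f ^ Q - g ^ Q)"
      using ordge_mono[OF ordge_power_diff'[OF that, of Q], of "Suc N"] Q_ge_2 by simp
    have "\<Psi> f - \<Psi> g = half (fpsub log1 (frob f) - fpsub log1 (frob g)) - half (fpsub log1 (f ^ Q) - fpsub log1 (g ^ Q))"
      by (simp add: \<Psi>_def half_def algebra_simps)
    then show ?thesis
      by (simp only:) (intro ordge_diff half ordge_fpsub_diff frob1 that frobN powN)
  qed
  have fp: "\<exists>!f. f \<in> C \<and> \<Psi> f = f"
    if "0 \<in> C" "\<And>f. f \<in> C \<Longrightarrow> \<Psi> f \<in> C" "C \<subseteq> Collect (ordge 1)"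
      "\<And>f. (\<And>N. \<exists>g\<in>C. ordge N (f - g)) \<Longrightarrow> f \<in> C" for C
  proof (rule ps_contraction_fixpoint[where z = 0])
    fix f g N assume "f \<in> C" "g \<in> C" "ordge N (f - g)"
    then show "ordge (Suc N) (\<Psi> f - \<Psi> g)" using that(3) by (intro contr) auto
  qed (fact that)+
  have closed1: "ordge 1 f" if "\<And>N. \<exists>g. ordge 1 g \<and> ordge N (f - g)" for f :: "rat ps"
    using that[of 1] by (auto simp: ordge_def)
  \<comment> \<open>Uniqueness among all series without constant term identifies G with the fixed
    point that is found inside the integral ones.\<close>
  have unique: "\<exists>!f. f \<in> Collect (ordge 1) \<and> \<Psi> f = f"
  proof (rule fp)
    fix f :: "rat ps" assume "\<And>N. \<exists>g\<in>Collect (ordge 1). ordge N (f - g)"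
    then show "f \<in> Collect (ordge 1)" using closed1[of f] by auto
  qed (use \<Psi>1 in auto)
  have "\<exists>!f. f \<in> {f. ordge 1 f \<and> over zloc f} \<and> \<Psi> f = f"
  proof (rule fp)
    fix f assume f: "f \<in> {f. ordge 1 f \<and> over zloc f}"
    then have f': "over zloc f" by simp
    have "over zloc (half (fpsub log1 (frob f) - fpsub log1 (f ^ Q)))"
      by (rule half_fpsub_diff)
         (use f' half_power_diff_frob[OF f'] mod2.S_0 in \<open>auto intro: over_dblpow mod2.over_power\<close>)
    then show "\<Psi> f \<in> {f. ordge 1 f \<and> over zloc f}"
      using f \<Psi>1[of f] U(1) by (auto simp: \<Psi>_def intro: mod2.over_add)
  next
    fix f :: "rat ps" assume *: "\<And>N. \<exists>g\<in>{f. ordge 1 f \<and> over zloc f}. ordge N (f - g)"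
    have "cf f M \<in> zloc" for M
    proof -
      obtain g where g: "over zloc g" "ordge (Suc (total_degree M)) (f - g)" using * by blast
      then have "cf f M = cf g M" by (simp add: ordge_diff_iff)
      then show ?thesis using g(1) by (simp add: over_def)
    qed
    moreover have "ordge 1 f" by (rule closed1) (use * in blast)
    ultimately show "f \<in> {f. ordge 1 f \<and> over zloc f}" by (simp add: over_def)
  qed (auto simp: mod2.over_0)
  then obtain f where f: "ordge 1 f" "over zloc f" "\<Psi> f = f" by auto
  have "\<Psi> G = G"
  proof -
    have "half (f - g) = half f - half g" for f g by (simp add: half_def algebra_simps)
    then show ?thesis
      unfolding \<Psi>_def U(2)[symmetric] fpsub_log1[OF G] by simp
  qed
  with unique f G have "G = f" by auto
  with f show ?thesis by simp
qed

end

section \<open>Formal inverses\<close>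

text \<open>For \<iota>(0) = 0, the coefficient of x^N in F(x, \<iota>(x)), in the form in which it
  occurs in \<open>formal_inverse\<close>.\<close>

definition inv_term :: "'a::comm_ring_1 ps \<Rightarrow> 'a fps \<Rightarrow> nat \<Rightarrow> 'a" where
  "inv_term F \<iota> N = (\<Sum>a\<le>N. \<Sum>b\<le>N. cf F (single 1 a + single 2 b) * fps_nth (fps_X ^ a * \<iota> ^ b) N)"

abbreviation emb :: "'a::comm_ring_1 fps \<Rightarrow> 'a ps" where "emb \<iota> \<equiv> fpsub \<iota> (var 1)"

lemma fpsub_zero:
  assumes "fps_nth g 0 = 0"
  shows "fpsub g 0 = 0"
proof (rule ps_eqI)
  fix M
  have "fps_nth g j * cf (0 ^ j) M = 0" for j by (cases j) (auto simp: assms)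
  then show "cf (fpsub g 0) M = cf 0 M" by (simp add: fpsub_def)
qed

lemma ordge_emb: "fps_nth \<iota> 0 = 0 \<Longrightarrow> ordge 1 (emb \<iota>)"
  by (rule ordge_fpsub) simp_all

lemma nth_X_pow_mult_pow:
  assumes "fps_nth \<iota> 0 = 0"
  shows "fps_nth (fps_X ^ a * \<iota> ^ b) N = cf (var 1 ^ a * emb \<iota> ^ b) (single 1 N)"
proof -
  have "var 1 ^ a * emb \<iota> ^ b = fpsub (fps_X ^ a * \<iota> ^ b) (var 1)"
    by (simp add: fpsub_mult fpsub_power fpsub_X)
  then show ?thesis by (simp only: fpsub_var_single)
qed

lemma emb_diff_ordge:
  assumes "\<And>j. j < N \<Longrightarrow> fps_nth \<iota> j = fps_nth \<kappa> j"
  shows "ordge N (emb \<iota> - emb \<kappa>)"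
proof (subst ordge_diff_iff, intro allI impI)
  fix M :: monom assume M: "total_degree M < N"
  show "cf (emb \<iota>) M = cf (emb \<kappa>) M"
  proof (cases "\<exists>j. M = single 1 j")
    case True
    then show ?thesis using M assms fpsub_var_single[of \<iota> 1] fpsub_var_single[of \<kappa> 1] by auto
  next
    case False
    then show ?thesis using fpsub_var_other[of M 1 \<iota>] fpsub_var_other[of M 1 \<kappa>] by auto
  qed
qed

text \<open>The map sending \<iota> to \<iota> - F(x, \<iota>) is a contraction: the summand y of F
  cancels against \<iota>, and every other monomial of F containing y has a further factor x or y,
  hence improves agreement by an order.\<close>

lemma inv_term_contraction:
  assumes F: "cf F (single 2 1) = 1"
    and "fps_nth \<iota> 0 = 0" "fps_nth \<kappa> 0 = 0" "\<And>j. j < N \<Longrightarrow> fps_nth \<iota> j = fps_nth \<kappa> j" "i \<le> N"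
  shows "fps_nth \<iota> i - inv_term F \<iota> i = fps_nth \<kappa> i - inv_term F \<kappa> i"
proof -
  have ord: "ordge 1 (emb \<iota>)" "ordge 1 (emb \<kappa>)" "ordge N (emb \<iota> - emb \<kappa>)"
    using assms by (simp_all add: ordge_emb emb_diff_ordge del: One_nat_def)
  have same: "fps_nth (fps_X ^ a * \<iota> ^ b) i = fps_nth (fps_X ^ a * \<kappa> ^ b) i" if "(a, b) \<noteq> (0, 1)" for a b
  proof (cases "b = 0")
    case False
    have "ordge (a + (N + b - 1)) (var 1 ^ a * (emb \<iota> ^ b - emb \<kappa> ^ b))"
      using ordge_mult[OF ordge_power[OF ordge_var[of 1], of a] ordge_power_diff'[OF ord, of b]] False by simp
    then have "cf (var 1 ^ a * (emb \<iota> ^ b - emb \<kappa> ^ b)) (single 1 i) = 0"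
      using False that \<open>i \<le> N\<close> by (intro ordgeD) auto
    then show ?thesis
      using assms by (simp add: nth_X_pow_mult_pow right_diff_distrib del: One_nat_def)
  qed simp
  have split: "inv_term F \<iota> i = (\<Sum>p\<in>{..i} \<times> {..i} - {(0, 1)}. cf F (single 1 (fst p) + single 2 (snd p)) * fps_nth (fps_X ^ fst p * \<iota> ^ snd p) i)
      + fps_nth \<iota> i" if "fps_nth \<iota> 0 = 0" for \<iota>
  proof (cases "i = 0")
    \<comment> \<open>The index (0, 1) lies outside the range of summation here, but the extra
      summand vanishes since \<iota> has no constant term.\<close>
    case True
    then show ?thesis using that by (simp add: inv_term_def)
  next
    case False
    have "inv_term F \<iota> i = (\<Sum>p\<in>{..i} \<times> {..i}. cf F (single 1 (fst p) + single 2 (snd p)) * fps_nth (fps_X ^ fst p * \<iota> ^ snd p) i)"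
      by (simp add: inv_term_def sum.cartesian_product case_prod_beta)
    also have "\<dots> = cf F (single 1 0 + single 2 1) * fps_nth (fps_X ^ 0 * \<iota> ^ 1) i + (\<Sum>p\<in>{..i} \<times> {..i} - {(0, 1)}. cf F (single 1 (fst p) + single 2 (snd p)) * fps_nth (fps_X ^ fst p * \<iota> ^ snd p) i)"
      using False by (subst sum.remove[of _ "(0, 1)"]) auto
    finally show ?thesis using F by simp
  qed
  show ?thesis
    unfolding split[OF assms(2)] split[OF assms(3)]
    by (simp add: same cong: sum.cong) (intro sum.cong refl arg_cong2[of _ _ _ _ "(*)"] same, auto)
qed

lemma inv_term_unique:
  assumes F: "cf F (single 2 1) = 1"
    and "fps_nth \<iota> 0 = 0" "fps_nth \<kappa> 0 = 0" "\<And>N. inv_term F \<iota> N = 0" "\<And>N. inv_term F \<kappa> N = 0"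
  shows "\<iota> = \<kappa>"
proof (rule fps_ext)
  fix N show "fps_nth \<iota> N = fps_nth \<kappa> N"
  proof (induction N rule: less_induct)
    case (less N)
    then show ?case
      using inv_term_contraction[OF F assms(2,3), of N N] assms(4,5) by simp
  qed
qed

lemma (in subring_hom) inv_term_hom:
  assumes "over S F" "\<And>j. fps_nth \<iota> j \<in> S" "fps_nth \<iota> 0 = 0"
  shows "inv_term (map_ps h F) (Abs_fps (\<lambda>j. h (fps_nth \<iota> j))) N = h (inv_term F \<iota> N)"
proof -
  let ?\<kappa> = "Abs_fps (\<lambda>j. h (fps_nth \<iota> j))"
  have ov: "over S (var 1 ^ a * emb \<iota> ^ b)" for a b
    unfolding var_eq_xm by (intro over_mult over_power over_fpsub over_xm assms)
  have "map_ps h (var 1 ^ a * emb \<iota> ^ b) = var 1 ^ a * emb ?\<kappa> ^ b" for a b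
  proof -
    have o: "over S (var 1)" "over S (emb \<iota>)" unfolding var_eq_xm by (intro over_fpsub over_xm assms)+
    show ?thesis
      using o assms(2) by (simp add: map_ps_mult over_power map_ps_power map_ps_fpsub map_ps_var)
  qed
  then have eq: "cf (var 1 ^ a * emb ?\<kappa> ^ b) M = h (cf (var 1 ^ a * emb \<iota> ^ b) M)" for a b M
    by (metis cf_map_ps)
  have "fps_nth (fps_X ^ a * ?\<kappa> ^ b) N = h (fps_nth (fps_X ^ a * \<iota> ^ b) N)"
    "fps_nth (fps_X ^ a * \<iota> ^ b) N \<in> S" for a b
    using assms(3) ov[of a b] by (simp_all only: nth_X_pow_mult_pow fps_nth_Abs_fps h_0 eq) (simp add: over_def)
  then show ?thesis
    unfolding inv_term_def using assms(1)
    by (simp add: h_sum h_mult S_sum S_mult over_def)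
qed

text \<open>The double sum is the substitution of (x, \<iota>(x)) into F cut off at degree N. As a
  substitution it commutes with the logarithm, which is how a candidate for the inverse is
  checked.\<close>

lemma inv_term_msubst:
  assumes "fps_nth \<iota> 0 = 0"
  shows "inv_term F \<iota> N = cf (msubst {1, 2} (\<lambda>i. if i = 1 then var 1 else emb \<iota>) F) (single 1 N)"
proof -
  let ?y = "\<lambda>i::nat. if i = 1 then var 1 else emb \<iota>"
  interpret substitution "{1, 2}" ?y
    using ordge_emb[OF assms] by unfold_locales (auto simp del: One_nat_def simp: ordge_var)
  let ?m = "\<lambda>p. single 1 (fst p) + single (2::nat) (snd p) :: monom"
  have ev: "evm ?y (?m p) = var 1 ^ fst p * emb \<iota> ^ snd p" for p
    by (simp add: evm_add)
  have "inv_term F \<iota> N = (\<Sum>p\<in>{..N} \<times> {..N}. cf F (?m p) * cf (evm ?y (?m p)) (single 1 N))"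
    unfolding inv_term_def ev nth_X_pow_mult_pow[OF assms] by (simp add: sum.cartesian_product case_prod_beta)
  also have "\<dots> = (\<Sum>p\<in>{p. fst p + snd p \<le> N}. cf F (?m p) * cf (evm ?y (?m p)) (single 1 N))"
  proof (rule sum.mono_neutral_right)
    have "cf (evm ?y (?m p)) (single 1 N) = 0" if "\<not> fst p + snd p \<le> N" for p
      by (rule cf_evm_eq_0) (use that in \<open>auto simp: keys_add_nat split: if_splits\<close>)
    then show "\<forall>p\<in>{..N} \<times> {..N} - {p. fst p + snd p \<le> N}. cf F (?m p) * cf (evm ?y (?m p)) (single 1 N) = 0"
      by (simp del: fst_conv)
  qed auto
  also have "\<dots> = (\<Sum>A\<in>below N. cf F A * cf (evm ?y A) (single 1 N))"
  proof (rule sum.reindex_bij_witness[of _ "\<lambda>A. (lookup A 1, lookup A 2)" ?m])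
    fix A :: monom assume A: "A \<in> below N"
    show m: "?m (lookup A 1, lookup A 2) = A"
    proof (rule poly_mapping_eqI)
      fix k show "lookup (?m (lookup A 1, lookup A 2)) k = lookup A k"
        using A by (auto simp: lookup_add lookup_single when_def in_keys_iff subset_iff)
    qed
    have "total_degree A = lookup A 1 + lookup A 2" by (subst m[symmetric]) simp
    then show "(lookup A 1, lookup A 2) \<in> {p. fst p + snd p \<le> N}" using A by simp
  next
    fix p assume "p \<in> {p. fst p + snd p \<le> N}"
    then show "?m p \<in> below N" by (auto simp: keys_add_nat split: if_splits)
    show "(lookup (?m p) 1, lookup (?m p) 2) = p"
      by (simp add: lookup_add lookup_single prod_eq_iff)
  qed auto
  also have "\<dots> = cf (ms F) (single 1 N)"
    by (rule cf_msubst[symmetric]) simp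
  finally show ?thesis .
qed

context morava
begin

section \<open>The formal group law and its inverse\<close>

text \<open>Solving once among all series without constant term and once among the homogeneous ones
  shows that the series singled out by \<open>FGL_of_log\<close> is homogeneous.\<close>

lemma FGL_exists:
  "\<exists>!F. (ordge 1 F \<and> homog n 1 F) \<and> fpsub logv F = fpsub logv (var 1) + fpsub logv (var 2)"
  "\<exists>!F. ordge 1 F \<and> fpsub logv F = fpsub logv (var 1) + fpsub logv (var 2)"
proof -
  let ?R = "fpsub logv (var 1) + fpsub logv (var 2)"
  have R: "ordge 1 ?R" "homog n 1 ?R"
    by (intro ordge_add ordge_fpsub homog_add homog_fpsub ordge_var homog_var logv_0 keys_logv; assumption)+
  show "\<exists>!F. ordge 1 F \<and> fpsub logv F = ?R"
    by (rule fpsub_solve_unique[OF logv_0 logv_1 R(1)])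
  have keysX: "k \<in> keys (fps_nth (logv - fps_X) j) \<Longrightarrow> int j - (2 ^ n - 1) * k = 1" for k j
    using keys_logv[of k j] logv_1 by (cases "j = 1") auto
  have "\<exists>!F. F \<in> {F. ordge 1 F \<and> homog n 1 F} \<and> fpsub logv F = ?R"
  proof (rule fpsub_solve[OF logv_0 logv_1 R(1), where z = 0])
    fix f :: "(int \<Rightarrow>\<^sub>0 rat) ps" assume "f \<in> {F. ordge 1 F \<and> homog n 1 F}"
    then show "?R - fpsub (logv - fps_X) f \<in> {F. ordge 1 F \<and> homog n 1 F}"
      using R logv_0 keysX by (auto intro!: ordge_diff homog_diff homog_fpsub ordge_fpsub[unfolded One_nat_def])
  next
    fix f :: "(int \<Rightarrow>\<^sub>0 rat) ps" assume *: "\<And>N. \<exists>g\<in>{F. ordge 1 F \<and> homog n 1 F}. ordge N (f - g)"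
    have "homog n 1 f" by (rule homog_closed) (use * in blast)
    moreover obtain g where "ordge 1 g" "ordge 1 (f - g)" using *[of 1] by blast
    then have "ordge 1 f" by (simp add: ordge_def)
    ultimately show "f \<in> {F. ordge 1 F \<and> homog n 1 F}" by simp
  qed auto
  then show "\<exists>!F. (ordge 1 F \<and> homog n 1 F) \<and> fpsub logv F = ?R" by simp
qed

definition FL :: "(int \<Rightarrow>\<^sub>0 rat) ps" where "FL = Ps (FGL_of_log logv)"

lemma FL: "ordge 1 FL" "homog n 1 FL" "fpsub logv FL = fpsub logv (var 1) + fpsub logv (var 2)"
proof -
  let ?R = "fpsub logv (var 1) + fpsub logv (var 2)"
  obtain F where F: "ordge 1 F" "homog n 1 F" "fpsub logv F = ?R" using FGL_exists(1) by blast
  have iff: "(g 0 = 0 \<and> fps_subst logv g = fps_subst logv (mps_var 1) \<oplus>\<^bsub>mps_ring\<^esub> fps_subst logv (mps_var 2)) \<longleftrightarrow>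
      ordge 1 (Ps g) \<and> fpsub logv (Ps g) = ?R" for g
    by (simp add: ordge_1_iff fps_subst_eq var_def cf_inject del: One_nat_def)
  have "FGL_of_log logv = cf F"
    unfolding FGL_of_log_def iff
  proof (rule the_equality)
    show "ordge 1 (Ps (cf F)) \<and> fpsub logv (Ps (cf F)) = ?R" using F by simp
    fix g assume "ordge 1 (Ps g) \<and> fpsub logv (Ps g) = ?R"
    then have "Ps g = F" using FGL_exists(2) F by blast
    then show "g = cf F" by auto
  qed
  then have "FL = F" by (simp add: FL_def)
  with F show "ordge 1 FL" "homog n 1 FL" "fpsub logv FL = ?R" by simp_all
qed

definition F1 :: "rat ps" where "F1 = map_ps aug FL"

interpretation aug: subring_hom UNIV "aug :: (int \<Rightarrow>\<^sub>0 rat) \<Rightarrow> rat" by (rule subring_hom_aug)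

lemma map_ps_aug_fpsub_logv: "map_ps aug (fpsub logv f) = fpsub log1 (map_ps aug f)"
  by (simp add: aug.map_ps_fpsub log1_def)

lemma F1: "ordge 1 F1" "fpsub log1 F1 = fpsub log1 (var 1) + fpsub log1 (var 2)"
proof -
  show "ordge 1 F1" unfolding F1_def by (rule aug.ordge_map_ps[OF FL(1)])
  show "fpsub log1 F1 = fpsub log1 (var 1) + fpsub log1 (var 2)"
    using arg_cong[OF FL(3), of "map_ps aug"]
    by (simp add: F1_def map_ps_aug_fpsub_logv aug.map_ps_add aug.map_ps_var)
qed

lemma half_add: "half (f + g) = half f + half g" and half_uminus: "half (- f) = - half f"
  by (simp_all add: half_def algebra_simps)

lemma log1_var: "fpsub log1 (var i) - half (fpsub log1 (frob (var i))) = var i"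
  using fpsub_log1[of "var i"] by (simp add: dblpow_var)

text \<open>Substituting Q-th powers commutes with the logarithm, so the expression in
  \<open>integrality\<close> splits into the same expressions for the two variables. By the
  functional equation these are the variables themselves.\<close>

lemma F1_integral: "over zloc F1"
proof (rule integrality[OF F1(1)])
  show "over zloc (var 1 + var 2)" by (intro mod2.over_add) (simp_all add: var_eq_xm mod2.over_xm)
  have "fpsub log1 (frob F1) = frob (fpsub log1 F1)"
    by (rule dblpow_fpsub[OF F1(1), symmetric])
  also have "\<dots> = fpsub log1 (frob (var 1)) + fpsub log1 (frob (var 2))"
    by (simp add: F1(2) dblpow_add dblpow_fpsub)
  finally show "fpsub log1 F1 - half (fpsub log1 (frob F1)) = var 1 + var 2"
    using log1_var[of 1] log1_var[of 2] by (simp add: F1(2) half_add algebra_simps)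
qed

definition g1 :: "rat fps" where "g1 = fps_inv log1 oo (- log1)"

lemma g1_0: "fps_nth g1 0 = 0"
  by (simp add: g1_def fps_inv_def)

lemma log1_g1: "log1 oo g1 = - log1"
proof -
  have nz: "fps_nth log1 0 = 0" "fps_nth log1 1 \<noteq> 0" using log1_0 log1_1 by simp_all
  have "log1 oo g1 = (log1 oo fps_inv log1) oo (- log1)"
    unfolding g1_def by (rule fps_compose_assoc) (simp_all add: fps_inv_def log1_0)
  also have "\<dots> = fps_X oo (- log1)" by (simp only: fps_inv_right[OF nz])
  also have "\<dots> = - log1" by (rule fps_X_fps_compose_startby0) (simp add: log1_0)
  finally show ?thesis .
qed

lemma log1_inj:
  assumes "ordge 1 f" "ordge 1 g" "fpsub log1 f = fpsub log1 g"
  shows "f = g"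
proof -
  have "\<exists>!h. ordge 1 h \<and> fpsub log1 h = fpsub log1 g"
    by (rule fpsub_solve_unique[OF log1_0 log1_1 ordge_fpsub[OF assms(2) log1_0]])
  then show ?thesis
  proof (elim ex1E)
    fix h assume "\<forall>k. ordge 1 k \<and> fpsub log1 k = fpsub log1 g \<longrightarrow> k = h"
    from this[rule_format, of f] this[rule_format, of g] show ?thesis using assms by simp
  qed
qed

lemma fpsub_log1_g1: "ordge 1 f \<Longrightarrow> fpsub log1 (fpsub g1 f) = - fpsub log1 f"
  using fpsub_compose[of f g1 log1] by (simp add: g1_0 log1_g1 fpsub_uminus)

lemma fpsub_g1_g1:
  assumes "ordge 1 f"
  shows "fpsub g1 (fpsub g1 f) = f"
proof (rule log1_inj)
  have o: "ordge 1 (fpsub g1 f)" by (rule ordge_fpsub[OF assms g1_0])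
  show "ordge 1 (fpsub g1 (fpsub g1 f))" by (rule ordge_fpsub[OF o g1_0])
  show "fpsub log1 (fpsub g1 (fpsub g1 f)) = fpsub log1 f"
    by (simp only: fpsub_log1_g1[OF o] fpsub_log1_g1[OF assms] minus_minus)
qed (rule assms)

text \<open>Since l(g1(x)) = -l(x), the criterion \<open>integrality\<close> applies with -x_1 in
  place of U.\<close>

lemma emb_g1_integral: "over zloc (emb g1)"
proof (rule integrality)
  show o: "ordge 1 (emb g1)" by (rule ordge_emb[OF g1_0])
  show "over zloc (- var 1)" unfolding var_eq_xm by (rule mod2.over_uminus[OF mod2.over_xm])
  have a: "fpsub log1 (emb g1) = - fpsub log1 (var 1)"
    by (rule fpsub_log1_g1[OF ordge_var])
  have "fpsub log1 (frob (emb g1)) = frob (fpsub log1 (emb g1))"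
    by (rule dblpow_fpsub[OF o, symmetric])
  also have "\<dots> = - frob (fpsub log1 (var 1))"
    unfolding a by (rule dblpow_uminus)
  also have "frob (fpsub log1 (var 1)) = fpsub log1 (frob (var 1))"
    by (rule dblpow_fpsub[OF ordge_var])
  finally have b: "fpsub log1 (frob (emb g1)) = - fpsub log1 (frob (var 1))" .
  have "- x - - y = - v" if "x - y = v" for x y v :: "rat ps"
    by (simp flip: that)
  from this[OF log1_var[of 1]]
  show "fpsub log1 (emb g1) - half (fpsub log1 (frob (emb g1))) = - var 1"
    unfolding a b half_uminus .
qed

lemma g1_integral: "fps_nth g1 j \<in> zloc"
proof -
  have "cf (emb g1) (single 1 j) \<in> zloc" using emb_g1_integral unfolding over_def by blast
  then show ?thesis by (simp only: fpsub_var_single)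
qed

text \<open>The logarithm of F(x, g1(x)) is l(x) + l(g1(x)) = 0, and the logarithm is
  injective.\<close>

lemma inv_term_F1_g1: "inv_term F1 g1 N = 0"
proof -
  let ?y = "\<lambda>i::nat. if i = 1 then var 1 else emb g1"
  interpret substitution "{1, 2}" ?y
    using ordge_emb[OF g1_0] by unfold_locales (auto simp del: One_nat_def simp: ordge_var)
  have m: "ms (var 1) = var 1" "ms (var 2) = emb g1"
    using ms_var[of 1] ms_var[of 2] by simp_all
  have "fpsub log1 (ms F1) = ms (fpsub log1 (var 1) + fpsub log1 (var 2))"
    by (simp only: ms_fpsub[OF F1(1), symmetric] F1(2))
  also have "\<dots> = fpsub log1 (var 1) + fpsub log1 (emb g1)"
    by (simp only: ms_add ms_fpsub[OF ordge_var] m)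
  also have "\<dots> = fpsub log1 0"
    by (simp only: fpsub_log1_g1[OF ordge_var] fpsub_zero[OF log1_0] right_minus)
  finally have "ms F1 = 0"
    by (rule log1_inj[OF ordge_ms[OF F1(1)] ordge_zero])
  then show ?thesis by (simp add: inv_term_msubst[OF g1_0])
qed

interpretation aug_bit: subring_hom UNIV "aug :: K_coeff \<Rightarrow> bit" by (rule subring_hom_aug)

section \<open>Low coefficients of the formal inverse\<close>

lemma log1_small: "1 < j \<Longrightarrow> j < Q \<Longrightarrow> fps_nth log1 j = 0"
proof -
  assume j: "1 < j" "j < Q"
  show ?thesis
  proof (cases "\<exists>k. j = 2 ^ k")
    case True
    then obtain k where k: "j = 2 ^ k" by blast
    then have "0 < k" "k < n" using j by (auto intro: Nat.gr0I)
    then show ?thesis using k lc_less log1_pow2 by simp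
  next
    case False
    then show ?thesis using log1_other by blast
  qed
qed

lemma log1_Q: "fps_nth log1 Q = 1 / 2"
  using lc_add[of 0] lc_0 log1_pow2[of n] by simp

text \<open>Below degree Q the logarithm is x, so comparing coefficients in l(g1(x)) = -l(x) gives
  g1(x) = -x there.\<close>

lemma g1_less: "j < Q \<Longrightarrow> fps_nth g1 j = (if j = 1 then - 1 else 0)"
proof -
  assume j: "j < Q"
  have "- fps_nth log1 j = fps_nth (log1 oo g1) j" by (simp add: log1_g1)
  also have "\<dots> = (\<Sum>i\<in>{0..j}. if i = 1 then fps_nth g1 j else 0)"
    unfolding fps_compose_nth
  proof (rule sum.cong[OF refl])
    fix i assume "i \<in> {0..j}"
    then consider "i = 0" | "i = 1" | "1 < i" "i < Q" using j by force
    then show "fps_nth log1 i * fps_nth (g1 ^ i) j = (if i = 1 then fps_nth g1 j else 0)"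
      by cases (use log1_0 log1_1 log1_small in auto)
  qed
  also have "\<dots> = fps_nth g1 j" using g1_0 by (cases "j = 0") auto
  finally have "fps_nth g1 j = - fps_nth log1 j" by simp
  moreover have "j = 0 \<or> j = 1 \<or> 1 < j" by linarith
  ultimately show ?thesis using log1_0 log1_1 log1_small j by auto
qed

lemma g1_1: "fps_nth g1 1 = - 1"
  using g1_less[of 1] Q_ge_2 by simp

text \<open>In degree Q the comparison reads -1/2 = c + (1/2)(-1)^Q with c the coefficient sought,
  and Q is even. Modulo 2 this becomes the coefficient 1 of x^Q in the conjugation, the source of
  the leading forms.\<close>

lemma g1_Q: "fps_nth g1 Q = - 1"
proof -
  have "- fps_nth log1 Q = fps_nth (log1 oo g1) Q" by (simp add: log1_g1)
  also have "\<dots> = (\<Sum>i\<in>{0..Q}. (if i = 1 then fps_nth g1 Q else 0) + (if i = Q then 1 / 2 else 0))"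
    unfolding fps_compose_nth
  proof (rule sum.cong[OF refl])
    fix i assume "i \<in> {0..Q}"
    then consider "i = 0" | "i = 1" | "1 < i" "i < Q" | "i = Q" by force
    then show "fps_nth log1 i * fps_nth (g1 ^ i) Q = (if i = 1 then fps_nth g1 Q else 0) + (if i = Q then 1 / 2 else 0)"
    proof cases
      case 4
      have "fps_nth (g1 ^ Q) Q = (- 1) ^ Q"
        using startsby_zero_power_nth_same[OF g1_0, of Q] g1_1 by simp
      also have "\<dots> = 1" using n_ge_1 by simp
      finally show ?thesis using 4 log1_Q Q_ge_2 n_ge_1 by simp
    qed (use log1_0 log1_1 log1_small Q_ge_2 in auto)
  qed
  also have "\<dots> = fps_nth g1 Q + 1 / 2" using Q_ge_2 by (simp add: sum.distrib)
  finally show ?thesis using log1_Q by simp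
qed

definition gb :: "bit fps" where "gb = Abs_fps (\<lambda>j. rat_mod2 (fps_nth g1 j))"

lemma mod2_minus_1: "rat_mod2 (- 1) = 1"
  using rat_mod2_frac(2)[of 1 "-1"] by (simp add: of_int_bit)

lemma gb_0: "fps_nth gb 0 = 0" by (simp add: gb_def g1_0 mod2.h_0)
lemma gb_1: "fps_nth gb 1 = 1" using g1_1 by (simp add: gb_def mod2_minus_1)
lemma gb_Q: "fps_nth gb Q = 1" using g1_Q by (simp add: gb_def mod2_minus_1)
lemma gb_between: "1 < j \<Longrightarrow> j < Q \<Longrightarrow> fps_nth gb j = 0"
  using g1_less[of j] by (simp add: gb_def mod2.h_0)

text \<open>The corresponding identity for \<open>g1\<close> is evaluated at a variable, where all
  series are integral and can be reduced modulo 2.\<close>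

lemma gb_gb: "gb oo gb = fps_X"
proof (rule fps_ext)
  fix N
  have o: "over zloc (var 1)" unfolding var_eq_xm by (rule mod2.over_xm)
  have "var 1 = map_ps rat_mod2 (fpsub g1 (emb g1))"
    by (simp only: fpsub_g1_g1[OF ordge_var] mod2.map_ps_var)
  also have "\<dots> = fpsub gb (fpsub gb (var 1))"
    unfolding gb_def
    by (subst mod2.map_ps_fpsub[OF g1_integral emb_g1_integral], subst mod2.map_ps_fpsub[OF g1_integral o])
       (simp only: mod2.map_ps_var)
  also have "\<dots> = emb (gb oo gb)"
    by (rule fpsub_compose[symmetric]) (simp_all add: gb_0)
  finally have "emb fps_X = emb (gb oo gb)" unfolding fpsub_X[OF ordge_var] .
  then have "cf (emb fps_X) (single 1 N) = cf (emb (gb oo gb)) (single 1 N)" by (simp only:)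
  then show "fps_nth (gb oo gb) N = fps_nth fps_X N"
    by (simp only: fpsub_var_single)
qed

lemma fpsub_gb_gb: "ordge 1 f \<Longrightarrow> fpsub gb (fpsub gb f) = f"
  using fpsub_compose[of f gb gb] gb_gb gb_0 by (simp add: fpsub_X)

section \<open>Formal group law and inverse over the coefficients of K(n)\<close>

definition FK :: "K_coeff ps" where "FK = Ps (K_FGL n)"

lemma cf_FK: "cf FK M = Poly_Mapping.map rat_mod2 (cf FL M)"
proof -
  have "vgen = (\<lambda>i. if i = n then single 1 1 else 0)" by (auto simp: vgen_def)
  then show ?thesis unfolding FK_def K_FGL_def FL_def cf_Ps by (simp only:)
qed

lemma lookup_map_mod2: "lookup (Poly_Mapping.map rat_mod2 p) k = rat_mod2 (lookup p k)"
  by (simp add: Poly_Mapping.map.rep_eq when_def mod2.h_0)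

lemma keys_map_mod2: "keys (Poly_Mapping.map rat_mod2 p) \<subseteq> keys p"
proof
  fix k assume k: "k \<in> keys (Poly_Mapping.map rat_mod2 p)"
  show "k \<in> keys p"
  proof (rule ccontr)
    assume "k \<notin> keys p"
    then show False using k by (simp add: in_keys_iff lookup_map_mod2 mod2.h_0)
  qed
qed

lemma map_mod2_0: "Poly_Mapping.map rat_mod2 0 = 0"
  by (rule poly_mapping_eqI) (simp add: lookup_map_mod2 mod2.h_0)

lemma homog_FK: "homog n 1 FK"
  unfolding homog_def
proof (intro allI impI)
  fix M k assume "k \<in> keys (cf FK M)"
  then have "k \<in> keys (cf FL M)" unfolding cf_FK by (rule subsetD[OF keys_map_mod2])
  then show "int (total_degree M) - (2 ^ n - 1) * k = 1" by (rule homogD[OF FL(2)])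
qed

text \<open>Evaluation at \<open>v\<^sub>n = 1\<close> commutes with the reduction because
  homogeneity leaves at most one power of \<open>v\<^sub>n\<close> in each coefficient; on sums of
  several terms \<open>rat_mod2\<close>, which is not additive on all rationals, could fail to
  commute.\<close>

lemma aug_FK: "map_ps aug FK = map_ps rat_mod2 F1"
proof (rule ps_eqI)
  fix M
  have "aug (Poly_Mapping.map rat_mod2 (cf FL M)) = rat_mod2 (aug (cf FL M))"
  proof (cases "cf FL M = 0")
    case False
    then have "keys (cf FL M) \<noteq> {}" by simp
    then obtain k where "k \<in> keys (cf FL M)" by blast
    then have c: "cf FL M = single k (lookup (cf FL M) k)" by (rule homog_unique_key[OF n_ge_1 FL(2)])
    have "Poly_Mapping.map rat_mod2 (single k c) = single k (rat_mod2 c)" for c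
      by (rule poly_mapping_eqI) (simp add: lookup_map_mod2 lookup_single when_def mod2.h_0)
    then show ?thesis by (subst (1 2) c) (simp only: aug_single)
  next
    case True
    then show ?thesis by (simp only: map_mod2_0 aug_0 mod2.h_0)
  qed
  then show "cf (map_ps aug FK) M = cf (map_ps rat_mod2 F1) M"
    by (simp add: cf_FK F1_def)
qed

lemma FK_0: "cf FK 0 = 0"
  unfolding cf_FK FL(1)[unfolded ordge_1_iff] by (rule map_mod2_0)

text \<open>In degree 1 the logarithm is the identity, so the formal group law is x + y
  there.\<close>

lemma FK_single_2: "cf FK (single 2 1) = 1"
proof -
  have neq: "single (2::nat) (1::nat) \<noteq> single 1 1"
  proof
    assume "single (2::nat) (1::nat) = single 1 1"
    from arg_cong[OF this, of keys] show False by simp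
  qed
  have lin: "cf (fpsub logv f) (single 2 1) = cf f (single 2 1)" for f
    using logv_0 logv_1 by (simp add: fpsub_def)
  have "cf FL (single 2 1) = cf (fpsub logv FL) (single 2 1)" by (rule lin[symmetric])
  also have "\<dots> = cf (fpsub logv (var 1)) (single 2 1) + cf (fpsub logv (var 2)) (single 2 1)"
    by (simp only: FL(3) cf_basic)
  also have "\<dots> = 1"
    unfolding lin var_eq_xm using neq by simp
  finally have f: "cf FL (single 2 1) = 1" .
  show ?thesis
    unfolding cf_FK f by (rule poly_mapping_eqI) (simp add: lookup_map_mod2 lookup_one when_def mod2.h_0 mod2.h_1)
qed

text \<open>Coefficient sequences of the series in one variable that are homogeneous of degree 1 and
  have no constant term: the closed set in which the formal inverse is constructed.\<close>

definition good_inv :: "(nat \<Rightarrow> K_coeff) set" where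
  "good_inv = {f. f 0 = 0 \<and> (\<forall>j k. k \<in> keys (f j) \<longrightarrow> int j - (2 ^ n - 1) * k = 1)}"

lemma homog_emb_good:
  assumes "f \<in> good_inv"
  shows "homog n 1 (fpsub (Abs_fps f) (var i))"
  by (rule homog_fpsub[OF _ homog_var]) (use assms in \<open>auto simp: good_inv_def\<close>)

lemma keys_inv_term:
  assumes f: "f \<in> good_inv" and k: "k \<in> keys (inv_term FK (Abs_fps f) N)"
  shows "int N - (2 ^ n - 1) * k = 1"
proof -
  have f0: "fps_nth (Abs_fps f) 0 = 0" using f by (simp add: good_inv_def)
  from k obtain a where "k \<in> keys (\<Sum>b\<le>N. cf FK (single 1 a + single 2 b) * fps_nth (fps_X ^ a * Abs_fps f ^ b) N)"
    unfolding inv_term_def using keys_sum[of _ "{..N}"] by fastforce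
  then obtain b where "k \<in> keys (cf FK (single 1 a + single 2 b) * fps_nth (fps_X ^ a * Abs_fps f ^ b) N)"
    using keys_sum[of _ "{..N}"] by fastforce
  with keys_mult obtain i j where ij: "k = i + j" "i \<in> keys (cf FK (single 1 a + single 2 b))"
    "j \<in> keys (fps_nth (fps_X ^ a * Abs_fps f ^ b) N)" by blast
  have "int (total_degree (single 1 a + single (2::nat) b)) - (2 ^ n - 1) * i = 1"
    by (rule homogD[OF homog_FK ij(2)])
  then have "int a + int b - (2 ^ n - 1) * i = 1" by simp
  moreover have "homog n (int a * 1 + int b * 1) (var 1 ^ a * emb (Abs_fps f) ^ b)"
    by (intro homog_mult homog_power homog_var homog_emb_good f)
  from homogD[OF this ij(3)[unfolded nth_X_pow_mult_pow[OF f0]]]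
  have "int N - (2 ^ n - 1) * j = int a + int b" by simp
  ultimately show ?thesis by (simp add: ij(1) algebra_simps)
qed

lemma formal_inverse_exists:
  "\<exists>\<iota>. fps_nth \<iota> \<in> good_inv \<and> (\<forall>N. inv_term FK \<iota> N = 0)"
proof -
  have "\<exists>!f. f \<in> good_inv \<and> (\<lambda>N. f N - inv_term FK (Abs_fps f) N) = f"
  proof (rule contraction_fixpoint[where deg = "\<lambda>i. i" and z = "\<lambda>_. 0"])
    fix f assume f: "f \<in> good_inv"
    then have "f 0 - inv_term FK (Abs_fps f) 0 = 0"
      using FK_0 by (simp add: good_inv_def inv_term_def)
    moreover have "int j - (2 ^ n - 1) * k = 1" if "k \<in> keys (f j - inv_term FK (Abs_fps f) j)" for j k
      using that keys_diff[of "f j" "inv_term FK (Abs_fps f) j"] f keys_inv_term[OF f]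
      unfolding good_inv_def by blast
    ultimately show "(\<lambda>N. f N - inv_term FK (Abs_fps f) N) \<in> good_inv"
      unfolding good_inv_def by blast
  next
    fix f g :: "nat \<Rightarrow> K_coeff" and N i
    assume "f \<in> good_inv" "g \<in> good_inv" "\<And>i. i < N \<Longrightarrow> f i = g i" "i \<le> N"
    then show "f i - inv_term FK (Abs_fps f) i = g i - inv_term FK (Abs_fps g) i"
      using inv_term_contraction[OF FK_single_2, of "Abs_fps f" "Abs_fps g" N i] by (simp add: good_inv_def)
  next
    fix f :: "nat \<Rightarrow> K_coeff"
    assume *: "\<And>N. \<exists>g\<in>good_inv. \<forall>i<N. f i = g i"
    have "f 0 = 0" using *[of 1] by (auto simp: good_inv_def)
    moreover have "int j - (2 ^ n - 1) * k = 1" if "k \<in> keys (f j)" for j k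
      using *[of "Suc j"] that by (auto simp: good_inv_def)
    ultimately show "f \<in> good_inv" by (simp add: good_inv_def)
  qed (auto simp: good_inv_def)
  then obtain f where f: "f \<in> good_inv" "(\<lambda>N. f N - inv_term FK (Abs_fps f) N) = f" by blast
  have "inv_term FK (Abs_fps f) N = 0" for N
    using fun_cong[OF f(2), of N] by simp
  moreover have "fps_nth (Abs_fps f) = f" by (rule ext) simp
  ultimately show ?thesis using f(1) by (intro exI[of _ "Abs_fps f"]) (simp only: simp_thms)
qed

definition iK :: "K_coeff fps" where "iK = formal_inverse (K_FGL n)"

lemma iK: "fps_nth iK \<in> good_inv" "inv_term FK iK N = 0"
proof -
  obtain \<iota> where \<iota>: "fps_nth \<iota> \<in> good_inv" "\<And>N. inv_term FK \<iota> N = 0"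
    using formal_inverse_exists by blast
  have K: "K_FGL n = cf FK" by (simp add: FK_def)
  have "formal_inverse (K_FGL n) = \<iota>"
    unfolding formal_inverse_def K inv_term_def[symmetric]
  proof (rule the_equality)
    show "fps_nth \<iota> 0 = 0 \<and> (\<forall>N. inv_term FK \<iota> N = 0)" using \<iota> by (simp add: good_inv_def)
    fix \<kappa> assume "fps_nth \<kappa> 0 = 0 \<and> (\<forall>N. inv_term FK \<kappa> N = 0)"
    then show "\<kappa> = \<iota>"
      using \<iota> by (intro inv_term_unique[OF FK_single_2]) (simp_all add: good_inv_def)
  qed
  then have "iK = \<iota>" by (simp add: iK_def)
  with \<iota> show "fps_nth iK \<in> good_inv" "inv_term FK iK N = 0" by simp_all
qed

lemma iK_0: "fps_nth iK 0 = 0"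
  using iK(1) by (simp add: good_inv_def)

lemma homog_iK: "homog n 1 (fpsub iK (var i))"
  using homog_emb_good[OF iK(1), of i] by (simp add: fps_nth_inverse)

text \<open>Both sides are formal inverses of one formal group law over Z/2, namely that of K(n) at
  \<open>v\<^sub>n = 1\<close>, and such inverses are unique.\<close>

lemma aug_iK: "Abs_fps (\<lambda>j. aug (fps_nth iK j)) = gb"
proof (rule inv_term_unique)
  show "cf (map_ps aug FK) (single 2 1) = 1"
    by (simp only: cf_map_ps FK_single_2 aug_bit.h_1)
  show "fps_nth (Abs_fps (\<lambda>j. aug (fps_nth iK j))) 0 = 0" by (simp add: iK_0)
  show "fps_nth gb 0 = 0" by (rule gb_0)
  show "inv_term (map_ps aug FK) (Abs_fps (\<lambda>j. aug (fps_nth iK j))) N = 0" for N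
    by (subst aug_bit.inv_term_hom) (simp_all add: iK_0 iK(2))
  show "inv_term (map_ps aug FK) gb N = 0" for N
    unfolding aug_FK gb_def
    by (subst mod2.inv_term_hom[OF F1_integral g1_integral g1_0]) (simp add: inv_term_F1_g1 mod2.h_0)
qed

lemma aug_fpsub_iK: "map_ps aug (fpsub iK (var i)) = fpsub gb (var i)"
  by (simp add: aug_bit.map_ps_fpsub aug_iK aug_bit.map_ps_var)

end

section \<open>Symmetric power series\<close>

declare One_nat_def [simp del]

abbreviation map_key :: "('a \<Rightarrow> 'b) \<Rightarrow> ('b \<Rightarrow>\<^sub>0 'c::zero) \<Rightarrow> 'a \<Rightarrow>\<^sub>0 'c"
  where "map_key \<equiv> Poly_Mapping.map_key"

definition act :: "(nat \<Rightarrow> nat) \<Rightarrow> 'a ps \<Rightarrow> 'a ps" where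
  "act \<sigma> f = Ps (\<lambda>M. cf f (map_key \<sigma> M))"

lemma cf_act [simp]: "cf (act \<sigma> f) M = cf f (map_key \<sigma> M)"
  by (simp add: act_def)

locale sym_vars =
  fixes q :: nat
begin

abbreviation "perm \<sigma> \<equiv> \<sigma> permutes {1..q}"

lemma lookup_map_key: "perm \<sigma> \<Longrightarrow> lookup (map_key \<sigma> M) i = lookup M (\<sigma> i)"
  by (simp add: Poly_Mapping.map_key.rep_eq permutes_inj)

lemma map_key_inv:
  assumes "perm \<sigma>"
  shows "map_key (inv_into UNIV \<sigma>) (map_key \<sigma> M) = M"
    and "map_key \<sigma> (map_key (inv_into UNIV \<sigma>) M) = M"
proof -
  have inj: "inj \<sigma>" "inj (inv_into UNIV \<sigma>)"
    using assms permutes_inv[OF assms] by (auto intro: permutes_inj)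
  have "\<sigma> \<circ> inv_into UNIV \<sigma> = (\<lambda>x. x)" "inv_into UNIV \<sigma> \<circ> \<sigma> = (\<lambda>x. x)"
    using assms by (auto simp: fun_eq_iff permutes_inverses)
  then show "map_key (inv_into UNIV \<sigma>) (map_key \<sigma> M) = M"
    "map_key \<sigma> (map_key (inv_into UNIV \<sigma>) M) = M"
    using inj by (simp_all only: Poly_Mapping.map_key_compose Poly_Mapping.map_key_id)
qed

lemma map_key_add: "perm \<sigma> \<Longrightarrow>
    map_key \<sigma> (A + B :: monom) = map_key \<sigma> A + map_key \<sigma> B"
  by (rule Poly_Mapping.map_key_plus) (rule permutes_inj)

lemma keys_map_key: "perm \<sigma> \<Longrightarrow> keys (map_key \<sigma> (M :: monom)) = \<sigma> -` keys M"
  by (rule Poly_Mapping.keys_map_key) (rule permutes_inj)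

lemma keys_map_key_subset: "perm \<sigma> \<Longrightarrow> keys (map_key \<sigma> (M :: monom)) \<subseteq> {1..q} \<longleftrightarrow> keys M \<subseteq> {1..q}"
proof -
  assume p: "perm \<sigma>"
  have "\<sigma> -` keys M \<subseteq> {1..q} \<longleftrightarrow> keys M \<subseteq> {1..q}"
  proof
    assume *: "\<sigma> -` keys M \<subseteq> {1..q}"
    show "keys M \<subseteq> {1..q}"
    proof
      fix k assume "k \<in> keys M"
      then have "inv_into UNIV \<sigma> k \<in> \<sigma> -` keys M" using permutes_inverses[OF p] by simp
      then have "inv_into UNIV \<sigma> k \<in> {1..q}" using * by blast
      then show "k \<in> {1..q}" using permutes_in_image[OF permutes_inv[OF p]] by blast
    qed
  next
    assume *: "keys M \<subseteq> {1..q}"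
    show "\<sigma> -` keys M \<subseteq> {1..q}"
      using * permutes_in_image[OF p] by blast
  qed
  then show ?thesis unfolding keys_map_key[OF p] .
qed

lemma map_key_single_eq_iff:
  assumes "perm \<sigma>"
  shows "map_key \<sigma> M = single k a \<longleftrightarrow> M = single (\<sigma> k) a"
proof
  assume "map_key \<sigma> M = single k a"
  then have "M = map_key (inv_into UNIV \<sigma>) (single k a)" using map_key_inv(1)[OF assms, of M] by simp
  also have "\<dots> = single (\<sigma> k) a"
    using Poly_Mapping.map_key_single[OF permutes_inj[OF permutes_inv[OF assms]], of "\<sigma> k" a]
      permutes_inverses[OF assms] by simp
  finally show "M = single (\<sigma> k) a" .
next
  assume "M = single (\<sigma> k) a"
  then show "map_key \<sigma> M = single k a"
    using Poly_Mapping.map_key_single[OF permutes_inj[OF assms]] by simp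
qed

lemma total_degree_map_key:
  assumes "perm \<sigma>"
  shows "total_degree (map_key \<sigma> M) = total_degree M"
proof -
  have "(\<Sum>k\<in>\<sigma> -` keys M. lookup M (\<sigma> k)) = (\<Sum>k\<in>keys M. lookup M k)"
    by (rule sum.reindex_bij_witness[of _ "inv_into UNIV \<sigma>" \<sigma>]) (use permutes_inverses[OF assms] in auto)
  then show ?thesis
    unfolding total_degree_def keys_map_key[OF assms] lookup_map_key[OF assms] .
qed

lemma act_add: "act \<sigma> (f + g) = act \<sigma> f + act \<sigma> g" for f :: "'a::comm_ring_1 ps" by (rule ps_eqI) simp
lemma act_diff: "act \<sigma> (f - g) = act \<sigma> f - act \<sigma> g" for f :: "'a::comm_ring_1 ps" by (rule ps_eqI) simp
lemma act_0: "act \<sigma> 0 = 0" by (rule ps_eqI) simp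

lemma map_key_eq_0_iff: "perm \<sigma> \<Longrightarrow> map_key \<sigma> M = 0 \<longleftrightarrow> M = (0 :: monom)"
  using total_degree_map_key[of \<sigma> M] total_degree_eq_0_iff by metis

lemma act_cst: "perm \<sigma> \<Longrightarrow> act \<sigma> (cst a) = cst a"
  by (rule ps_eqI) (simp add: cf_cst map_key_eq_0_iff)

lemma act_1: "perm \<sigma> \<Longrightarrow> act \<sigma> 1 = (1 :: 'a::comm_ring_1 ps)"
  using act_cst[of \<sigma> "1 :: 'a"] by simp

lemma act_mult:
  fixes f g :: "'a::comm_ring_1 ps"
  assumes "perm \<sigma>"
  shows "act \<sigma> (f * g) = act \<sigma> f * act \<sigma> g"
proof (rule ps_eqI)
  fix M
  let ?i = "\<lambda>(A, B). (map_key (inv_into UNIV \<sigma>) A, map_key (inv_into UNIV \<sigma>) B)"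
  let ?j = "\<lambda>(A, B). (map_key \<sigma> A, map_key \<sigma> B)"
  have "(\<Sum>p\<in>splits (map_key \<sigma> M). cf f (fst p) * cf g (snd p)) =
      (\<Sum>p\<in>splits M. cf (act \<sigma> f) (fst p) * cf (act \<sigma> g) (snd p))"
  proof (rule sum.reindex_bij_witness[of _ ?j ?i])
    fix p assume "p \<in> splits (map_key \<sigma> M)"
    then have "fst p + snd p = map_key \<sigma> M" by (auto simp: splits_def)
    then have "map_key (inv_into UNIV \<sigma>) (fst p) + map_key (inv_into UNIV \<sigma>) (snd p) = M"
      using map_key_add[OF permutes_inv[OF assms]] map_key_inv(1)[OF assms] by metis
    then show "?i p \<in> splits M" by (simp add: splits_def case_prod_beta)
    show "?j (?i p) = p" by (simp add: case_prod_beta map_key_inv[OF assms])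
    show "cf (act \<sigma> f) (fst (?i p)) * cf (act \<sigma> g) (snd (?i p)) = cf f (fst p) * cf g (snd p)"
      by (simp add: case_prod_beta map_key_inv[OF assms])
  next
    fix p assume "p \<in> splits M"
    then have "fst p + snd p = M" by (auto simp: splits_def)
    then have "map_key \<sigma> (fst p) + map_key \<sigma> (snd p) = map_key \<sigma> M"
      using map_key_add[OF assms] by metis
    then show "?j p \<in> splits (map_key \<sigma> M)" by (simp add: splits_def case_prod_beta)
    show "?i (?j p) = p" by (simp add: case_prod_beta map_key_inv[OF assms])
  qed
  then show "cf (act \<sigma> (f * g)) M = cf (act \<sigma> f * act \<sigma> g) M"
    unfolding cf_act[of \<sigma> "f * g"] cf_mult by (simp only: case_prod_unfold)
qed

lemma act_power: "perm \<sigma> \<Longrightarrow> act \<sigma> (f ^ k) = act \<sigma> f ^ k" for f :: "'a::comm_ring_1 ps"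
  by (induction k) (simp_all add: act_1 act_mult)

lemma act_prod: "perm \<sigma> \<Longrightarrow> act \<sigma> (prod f S) = (\<Prod>i\<in>S. act \<sigma> (f i))" for f :: "'b \<Rightarrow> 'a::comm_ring_1 ps"
  by (induction S rule: infinite_finite_induct) (simp_all add: act_1 act_mult)

lemma act_sum: "act \<sigma> (sum f S) = (\<Sum>i\<in>S. act \<sigma> (f i))" for f :: "'b \<Rightarrow> 'a::comm_ring_1 ps"
  by (induction S rule: infinite_finite_induct) (simp_all add: act_0 act_add)

lemma act_fpsub:
  assumes "perm \<sigma>"
  shows "act \<sigma> (fpsub g f) = fpsub g (act \<sigma> f)"
proof (rule ps_eqI)
  fix M
  have "cf (f ^ j) (map_key \<sigma> M) = cf (act \<sigma> f ^ j) M" for j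
    by (simp flip: act_power[OF assms])
  then show "cf (act \<sigma> (fpsub g f)) M = cf (fpsub g (act \<sigma> f)) M"
    by (simp add: fpsub_def total_degree_map_key[OF assms])
qed

lemma act_var: "perm \<sigma> \<Longrightarrow> act \<sigma> (var j) = var (\<sigma> j)"
  by (rule ps_eqI) (simp add: var_eq_xm map_key_single_eq_iff)

section \<open>Symmetric series in finitely many variables\<close>

definition supp :: "'a::zero ps \<Rightarrow> bool" where
  "supp f \<longleftrightarrow> (\<forall>M. cf f M \<noteq> 0 \<longrightarrow> keys M \<subseteq> {1..q})"

lemma suppD: "supp f \<Longrightarrow> \<not> keys M \<subseteq> {1..q} \<Longrightarrow> cf f M = 0"
  by (auto simp: supp_def)

lemma suppI: "(\<And>M. \<not> keys M \<subseteq> {1..q} \<Longrightarrow> cf f M = 0) \<Longrightarrow> supp f"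
  unfolding supp_def by blast

lemma supp_add: "supp f \<Longrightarrow> supp g \<Longrightarrow> supp (f + g)" for f :: "'a::comm_ring_1 ps"
  by (rule suppI) (simp add: suppD)

lemma supp_diff: "supp f \<Longrightarrow> supp g \<Longrightarrow> supp (f - g)" for f :: "'a::comm_ring_1 ps"
  by (rule suppI) (simp add: suppD)

lemma supp_mult:
  fixes f g :: "'a::comm_ring_1 ps"
  assumes "supp f" "supp g"
  shows "supp (f * g)"
proof (rule suppI)
  fix M :: monom assume M: "\<not> keys M \<subseteq> {1..q}"
  have "cf f A * cf g B = 0" if "A + B = M" for A B
  proof -
    have "\<not> keys A \<subseteq> {1..q} \<or> \<not> keys B \<subseteq> {1..q}"
      using that M keys_add_nat[of A B] by auto
    then show ?thesis using assms suppD by fastforce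
  qed
  then show "cf (f * g) M = 0"
    unfolding cf_mult by (intro sum.neutral) (auto simp: splits_def)
qed

lemma supp_cst: "supp (cst a)"
  by (rule suppI) (auto simp: cf_cst)

lemma supp_1: "supp (1 :: 'a::comm_ring_1 ps)"
  using supp_cst[of "1 :: 'a"] by simp

lemma supp_0: "supp (0 :: 'a::comm_ring_1 ps)"
  by (rule suppI) simp

lemma supp_power: "supp f \<Longrightarrow> supp (f ^ k)" for f :: "'a::comm_ring_1 ps"
  by (induction k) (simp_all add: supp_1 supp_mult)

lemma supp_var: "j \<in> {1..q} \<Longrightarrow> supp (var j)"
  by (rule suppI) (auto simp: var_eq_xm)

lemma supp_fpsub: "supp f \<Longrightarrow> supp (fpsub g f)"
  by (rule suppI) (simp add: fpsub_def suppD supp_power)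

lemma supp_sum: "(\<And>i. i \<in> S \<Longrightarrow> supp (f i)) \<Longrightarrow> supp (sum f S)" for f :: "'b \<Rightarrow> 'a::comm_ring_1 ps"
  by (induction S rule: infinite_finite_induct) (simp_all add: supp_0 supp_add)

lemma supp_prod: "(\<And>i. i \<in> S \<Longrightarrow> supp (f i)) \<Longrightarrow> supp (prod f S)" for f :: "'b \<Rightarrow> 'a::comm_ring_1 ps"
  by (induction S rule: infinite_finite_induct) (simp_all add: supp_1 supp_mult)

definition symq :: "'a::zero ps \<Rightarrow> bool" where
  "symq f \<longleftrightarrow> supp f \<and> (\<forall>\<sigma>. perm \<sigma> \<longrightarrow> act \<sigma> f = f)"

lemma symq_supp: "symq f \<Longrightarrow> supp f" by (simp add: symq_def)
lemma symq_act: "symq f \<Longrightarrow> perm \<sigma> \<Longrightarrow> act \<sigma> f = f" by (simp add: symq_def)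

lemma symq_add: "symq f \<Longrightarrow> symq g \<Longrightarrow> symq (f + g)" for f :: "'a::comm_ring_1 ps"
  by (simp add: symq_def supp_add act_add)
lemma symq_diff: "symq f \<Longrightarrow> symq g \<Longrightarrow> symq (f - g)" for f :: "'a::comm_ring_1 ps"
  by (simp add: symq_def supp_diff act_diff)
lemma symq_mult: "symq f \<Longrightarrow> symq g \<Longrightarrow> symq (f * g)" for f :: "'a::comm_ring_1 ps"
  by (simp add: symq_def supp_mult act_mult)
lemma symq_cst: "symq (cst a)"
  by (simp add: symq_def supp_cst act_cst)
lemma symq_0: "symq (0 :: 'a::comm_ring_1 ps)"
  by (simp add: symq_def supp_0 act_0)
lemma symq_sum: "(\<And>i. i \<in> S \<Longrightarrow> symq (f i)) \<Longrightarrow> symq (sum f S)" for f :: "'b \<Rightarrow> 'a::comm_ring_1 ps"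
  by (induction S rule: infinite_finite_induct) (simp_all add: symq_0 symq_add)

lemma symq_esym:
  fixes g :: "'a::comm_ring_1 fps"
  shows "symq (esym q k (\<lambda>j. fpsub g (var j)))"
  unfolding symq_def
proof (intro conjI allI impI)
  show "supp (esym q k (\<lambda>j. fpsub g (var j)))"
    unfolding esym_def by (intro supp_sum supp_prod supp_fpsub supp_var) blast
next
  fix \<sigma> assume p: "perm \<sigma>"
  let ?T = "{S. S \<subseteq> {1..q} \<and> card S = k}"
  have im: "\<sigma> ` S \<in> ?T" if "S \<in> ?T" "perm \<sigma>" for S \<sigma>
  proof -
    have "\<sigma> ` S \<subseteq> {1..q}" using that permutes_in_image[OF that(2)] by blast
    moreover have "card (\<sigma> ` S) = card S"
      by (rule card_image) (rule inj_on_subset[OF permutes_inj[OF that(2)]], simp)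
    ultimately show ?thesis using that by simp
  qed
  have "act \<sigma> (esym q k (\<lambda>j. fpsub g (var j))) = (\<Sum>S\<in>?T. \<Prod>j\<in>S. fpsub g (var (\<sigma> j)))"
    unfolding esym_def by (simp add: act_sum act_prod[OF p] act_fpsub[OF p] act_var[OF p])
  also have "\<dots> = (\<Sum>S\<in>?T. \<Prod>j\<in>S. fpsub g (var j))"
  proof (rule sum.reindex_bij_witness[of _ "\<lambda>S. inv_into UNIV \<sigma> ` S" "\<lambda>S. \<sigma> ` S"])
    fix S assume S: "S \<in> ?T"
    show "inv_into UNIV \<sigma> ` \<sigma> ` S = S" "\<sigma> ` inv_into UNIV \<sigma> ` S = S"
      by (simp_all add: image_image permutes_inverses[OF p])
    show "\<sigma> ` S \<in> ?T" "inv_into UNIV \<sigma> ` S \<in> ?T" using im[OF S] p permutes_inv[OF p] by simp_all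
    show "(\<Prod>j\<in>\<sigma> ` S. fpsub g (var j)) = (\<Prod>j\<in>S. fpsub g (var (\<sigma> j)))"
      by (subst prod.reindex) (rule inj_on_subset[OF permutes_inj[OF p]], simp_all)
  qed
  finally show "act \<sigma> (esym q k (\<lambda>j. fpsub g (var j))) = esym q k (\<lambda>j. fpsub g (var j))"
    by (simp add: esym_def)
qed

text \<open>Zero exponents are included, so every monomial in
  \<open>x\<^sub>1, ..., x\<^sub>q\<close> yields a multiset of size q, and permutation orbits of
  such monomials correspond to these multisets.\<close>

definition expo :: "monom \<Rightarrow> nat multiset" where
  "expo M = image_mset (lookup M) (mset_set {1..q})"

lemma size_expo [simp]: "size (expo M) = q"
  by (simp add: expo_def)

lemma sum_expo: "keys M \<subseteq> {1..q} \<Longrightarrow> sum_mset (expo M) = total_degree M"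
  unfolding expo_def by (simp only: total_degree_superset[OF finite_atLeastAtMost] sum_unfold_sum_mset)

lemma expo_map_key:
  assumes "perm \<sigma>"
  shows "expo (map_key \<sigma> M) = expo M"
proof -
  have "lookup (map_key \<sigma> M) = lookup M \<circ> \<sigma>"
    by (rule ext) (simp add: lookup_map_key[OF assms])
  moreover have "image_mset \<sigma> (mset_set {1..q}) = mset_set {1..q}"
    using image_mset_mset_set[OF inj_on_subset[OF permutes_inj[OF assms]], of "{1..q}"]
      permutes_image[OF assms] by simp
  ultimately show ?thesis unfolding expo_def by (metis multiset.map_comp)
qed

lemma expo_eqD:
  assumes "expo M = expo M'" "keys M \<subseteq> {1..q}" "keys M' \<subseteq> {1..q}"
  obtains \<sigma> where "perm \<sigma>" "M = map_key \<sigma> M'"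
proof -
  obtain \<sigma> where \<sigma>: "perm \<sigma>" "\<forall>x\<in>{1..q}. lookup M x = lookup M' (\<sigma> x)"
    using image_mset_eq_implies_permutes[OF finite_atLeastAtMost assms(1)[unfolded expo_def]] by blast
  have "M = map_key \<sigma> M'"
  proof (rule poly_mapping_eqI)
    fix i show "lookup M i = lookup (map_key \<sigma> M') i"
    proof (cases "i \<in> {1..q}")
      case True
      then show ?thesis using \<sigma> by (simp add: lookup_map_key)
    next
      case False
      then have "\<sigma> i = i" by (rule permutes_not_in[OF \<sigma>(1)])
      moreover have "lookup M i = 0" "lookup M' i = 0"
        using False assms(2,3) by (meson in_keys_iff subsetD)+
      ultimately show ?thesis using \<sigma>(1) by (simp add: lookup_map_key)
    qed
  qed
  with \<sigma>(1) that show ?thesis by blast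
qed

lemma symq_expo:
  assumes "symq f" "expo M = expo M'" "keys M \<subseteq> {1..q}" "keys M' \<subseteq> {1..q}"
  shows "cf f M = cf f M'"
proof -
  obtain \<sigma> where \<sigma>: "perm \<sigma>" "M = map_key \<sigma> M'"
    using expo_eqD[OF assms(2-4)] .
  have "cf (act \<sigma> f) M' = cf f M'" using symq_act[OF assms(1) \<sigma>(1)] by simp
  then show ?thesis using \<sigma>(2) by simp
qed

lemma symqI:
  assumes "supp f" "\<And>\<sigma> M. perm \<sigma> \<Longrightarrow> keys M \<subseteq> {1..q} \<Longrightarrow> cf f (map_key \<sigma> M) = cf f M"
  shows "symq f"
  unfolding symq_def
proof (intro conjI allI impI ps_eqI)
  fix \<sigma> M assume p: "perm \<sigma>"
  show "cf (act \<sigma> f) M = cf f M"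
  proof (cases "keys M \<subseteq> {1..q}")
    case False
    then have "\<not> keys (map_key \<sigma> M) \<subseteq> {1..q}" by (simp only: keys_map_key_subset[OF p] simp_thms)
    then show ?thesis using False assms(1) by (simp add: suppD)
  qed (simp add: assms(2)[OF p])
qed (rule assms(1))

text \<open>The monomial symmetric function of \<mu>; it vanishes unless \<mu> has size q.\<close>

definition msym :: "nat multiset \<Rightarrow> 'a::comm_ring_1 ps" where
  "msym \<mu> = Ps (\<lambda>M. if keys M \<subseteq> {1..q} \<and> expo M = \<mu> then 1 else 0)"

lemma cf_msym: "cf (msym \<mu>) M = (if keys M \<subseteq> {1..q} \<and> expo M = \<mu> then 1 else 0)"
  by (simp add: msym_def)

lemma symq_msym: "symq (msym \<mu>)"
  by (rule symqI, rule suppI) (simp_all add: cf_msym keys_map_key_subset expo_map_key)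

section \<open>Power sums and their products with monomial symmetric functions\<close>

definition psum :: "nat \<Rightarrow> 'a::comm_ring_1 ps" where
  "psum i = (\<Sum>j\<in>{1..q}. xm (single j i))"

lemma symq_psum:
  assumes "i > 0"
  shows "symq (psum i :: 'a::comm_ring_1 ps)"
  unfolding symq_def
proof (intro conjI allI impI)
  have eq: "psum i = (\<Sum>j\<in>{1..q}. var j ^ i :: 'a ps)" by (simp add: psum_def var_power)
  show "supp (psum i :: 'a ps)" unfolding eq by (intro supp_sum supp_power supp_var)
  fix \<sigma> assume p: "perm \<sigma>"
  show "act \<sigma> (psum i) = (psum i :: 'a ps)"
    unfolding eq
    by (simp add: act_sum act_power[OF p] act_var[OF p])
       (rule sum.permute[OF p, of "\<lambda>j. var j ^ i", unfolded comp_def, symmetric])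
qed

text \<open>\<open>dsym i \<mu>\<close> is the orbit sum \<open>\<Sum>\<^sub>j x\<^sub>j\<^sup>i m\<^sub>\<mu>(x\<^sub>1, \<dots>, x\<^sub>q without x\<^sub>j)\<close>.\<close>

definition dsym :: "nat \<Rightarrow> nat multiset \<Rightarrow> 'a::comm_ring_1 ps" where
  "dsym i \<mu> = cst (of_nat (count (add_mset i \<mu>) i)) * msym (add_mset i \<mu>)"

lemma expo_remove: "j \<in> {1..q} \<Longrightarrow> expo M = add_mset (lookup M j) (image_mset (lookup M) (mset_set ({1..q} - {j})))"
  unfolding expo_def by (subst mset_set.remove[of _ j]) simp_all

lemma count_expo: "of_nat (count (expo M) c) = (\<Sum>j\<in>{1..q}. if lookup M j = c then 1 else (0 :: 'a::comm_ring_1))"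
proof -
  have "count (image_mset (lookup M) (mset_set A)) c = card {j \<in> A. lookup M j = c}" if "finite A" for A
    using that
  proof (induction A rule: finite_induct)
    case (insert x A)
    have "{j \<in> insert x A. lookup M j = c} = (if lookup M x = c then insert x {j \<in> A. lookup M j = c} else {j \<in> A. lookup M j = c})"
      by auto
    with insert show ?case by simp
  qed simp
  then have "count (expo M) c = card {j \<in> {1..q}. lookup M j = c}" by (simp add: expo_def)
  then show ?thesis by (simp flip: sum.inter_filter)
qed

text \<open>At most one summand is nonzero, the one where \<open>a\<close> is the exponent of
  \<open>x\<^sub>j\<close> that remains after M is divided by the i-th power of
  \<open>x\<^sub>j\<close>.\<close>

lemma cf_single_msym:
  assumes "j \<in> {1..q}" "keys M \<subseteq> {1..q}"
  shows "cf (xm (single j i) * msym \<nu>) M =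
    (\<Sum>a\<in>set_mset \<nu>. if lookup M j = i + a \<and> add_mset (i + a) (\<nu> - {#a#}) = expo M then 1 else (0 :: 'a::comm_ring_1))"
proof (cases "\<exists>M'. M = single j i + M'")
  case True
  then obtain M' where M': "M = single j i + M'" by blast
  let ?E = "image_mset (lookup M) (mset_set ({1..q} - {j}))"
  have E: "image_mset (lookup M') (mset_set ({1..q} - {j})) = ?E"
    by (rule image_mset_cong) (auto simp: M' lookup_add lookup_single when_def)
  have l: "lookup M j = i + lookup M' j" by (simp add: M' lookup_add)
  have e': "expo M' = add_mset (lookup M' j) ?E" using expo_remove[OF assms(1), of M'] E by simp
  have e: "expo M = add_mset (i + lookup M' j) ?E" using expo_remove[OF assms(1), of M] l by simp
  have k: "keys M' \<subseteq> {1..q}" using assms(2) by (simp add: M' keys_add_nat)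
  have "(\<Sum>a\<in>set_mset \<nu>. if lookup M j = i + a \<and> add_mset (i + a) (\<nu> - {#a#}) = expo M then 1 else (0 :: 'a)) =
      (\<Sum>a\<in>set_mset \<nu>. if a = lookup M' j then (if \<nu> - {#a#} = ?E then 1 else 0) else 0)"
    by (rule sum.cong) (auto simp: l e)
  also have "\<dots> = (if lookup M' j \<in># \<nu> \<and> \<nu> - {#lookup M' j#} = ?E then 1 else 0)"
    by (simp add: sum.delta)
  also have "\<dots> = (if expo M' = \<nu> then 1 else 0)"
  proof -
    have "lookup M' j \<in># \<nu> \<and> \<nu> - {#lookup M' j#} = ?E \<longleftrightarrow> expo M' = \<nu>"
      unfolding e' by (metis add_mset_remove_trivial insert_DiffM union_single_eq_member)
    then show ?thesis by simp
  qed
  also have "\<dots> = cf (xm (single j i) * msym \<nu>) M"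
    unfolding M' cf_xm_mult by (simp add: cf_msym k)
  finally show ?thesis by simp
next
  case False
  have "lookup M j \<noteq> i + a" for a
  proof
    assume a: "lookup M j = i + a"
    have "M = single j i + (M - single j i)"
    proof (rule poly_mapping_eqI)
      fix k show "lookup M k = lookup (single j i + (M - single j i)) k"
        using a by (cases "k = j") (auto simp: lookup_add lookup_minus lookup_single when_def)
    qed
    with False show False by blast
  qed
  moreover have "cf (xm (single j i) * msym \<nu>) M = (0 :: 'a)"
    by (rule cf_xm_mult_eq_0) (use False in blast)
  ultimately show ?thesis by simp
qed

text \<open>Multiplying by the i-th power of a variable raises one exponent a to i + a. A monomial
  is reached once for every variable on which it has exponent i + a, whence the multiplicity in
  \<open>dsym\<close>; a ranges over the distinct entries of \<nu>.\<close>

lemma psum_mult_msym: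
  assumes "i > 0"
  shows "psum i * msym \<nu> = (\<Sum>a\<in>set_mset \<nu>. dsym (i + a) (\<nu> - {#a#}) :: 'a::comm_ring_1 ps)"
proof (rule ps_eqI)
  fix M
  show "cf (psum i * msym \<nu>) M = cf (\<Sum>a\<in>set_mset \<nu>. dsym (i + a) (\<nu> - {#a#}) :: 'a ps) M"
  proof (cases "keys M \<subseteq> {1..q}")
    case False
    have "supp (psum i * msym \<nu> :: 'a ps)"
      by (intro supp_mult symq_supp symq_psum symq_msym assms)
    then show ?thesis using False by (simp add: suppD dsym_def cf_msym)
  next
    case True
    have "cf (psum i * msym \<nu>) M = (\<Sum>j\<in>{1..q}. cf (xm (single j i) * msym \<nu>) M)"
      by (simp add: psum_def sum_distrib_right)
    also have "\<dots> = (\<Sum>j\<in>{1..q}. \<Sum>a\<in>set_mset \<nu>. if lookup M j = i + a \<and> add_mset (i + a) (\<nu> - {#a#}) = expo M then 1 else (0 :: 'a))"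
      by (rule sum.cong[OF refl], rule cf_single_msym[OF _ True])
    also have "\<dots> = (\<Sum>a\<in>set_mset \<nu>. \<Sum>j\<in>{1..q}. if lookup M j = i + a \<and> add_mset (i + a) (\<nu> - {#a#}) = expo M then 1 else (0 :: 'a))"
      by (rule sum.swap)
    also have "\<dots> = (\<Sum>a\<in>set_mset \<nu>. cf (dsym (i + a) (\<nu> - {#a#}) :: 'a ps) M)"
    proof (rule sum.cong[OF refl])
      fix a
      show "(\<Sum>j\<in>{1..q}. if lookup M j = i + a \<and> add_mset (i + a) (\<nu> - {#a#}) = expo M then 1 else (0 :: 'a))
          = cf (dsym (i + a) (\<nu> - {#a#}) :: 'a ps) M"
      proof (cases "add_mset (i + a) (\<nu> - {#a#}) = expo M")
        case eq: True
        then show ?thesis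
          unfolding dsym_def cf_cst_mult cf_msym eq count_expo using True by simp
      next
        case False
        then have "expo M \<noteq> add_mset (i + a) (\<nu> - {#a#})" by (rule not_sym)
        with False show ?thesis unfolding dsym_def cf_cst_mult cf_msym by simp
      qed
    qed
    also have "\<dots> = cf (\<Sum>a\<in>set_mset \<nu>. dsym (i + a) (\<nu> - {#a#}) :: 'a ps) M"
      by (rule cf_sum[symmetric])
    finally show ?thesis .
  qed
qed

lemma msym_replicate_0: "msym (replicate_mset q 0) = 1"
proof (rule ps_eqI)
  fix M
  have "keys M \<subseteq> {1..q} \<and> expo M = replicate_mset q 0 \<longleftrightarrow> M = 0"
  proof
    assume *: "keys M \<subseteq> {1..q} \<and> expo M = replicate_mset q 0"
    then have "total_degree M = 0" using sum_expo[of M] by simp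
    then show "M = 0" by simp
  next
    assume "M = 0"
    moreover have "lookup (0 :: monom) = (\<lambda>_. 0)" by (rule ext) simp
    ultimately show "keys M \<subseteq> {1..q} \<and> expo M = replicate_mset q 0"
      by (simp add: expo_def image_mset_const_eq)
  qed
  then show "cf (msym (replicate_mset q 0)) M = cf 1 M" by (simp add: cf_msym)
qed

end

lemma of_nat_bit: "(of_nat m :: bit) = (if even m then 0 else 1)"
  using of_int_bit[of "int m"] by simp

locale morava_sym = morava n + sym_vars q for n q :: nat
begin

section \<open>The ideal of leading forms\<close>

definition lead_mset :: "nat \<Rightarrow> nat multiset" where
  "lead_mset k = add_mset Q (replicate_mset (k - 1) 1 + replicate_mset (q - k) 0)"

definition lead :: "nat \<Rightarrow> bit ps" where "lead k = msym (lead_mset k)"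

definition in_W :: "bit ps \<Rightarrow> bool" where
  "in_W p \<longleftrightarrow> (\<exists>h. (\<forall>k. symq (h k)) \<and> p = (\<Sum>k\<in>{1..q}. h k * lead k))"

lemma in_W_0: "in_W 0"
  unfolding in_W_def by (rule exI[of _ "\<lambda>_. 0"]) (simp add: symq_0)

lemma in_W_add: "in_W a \<Longrightarrow> in_W b \<Longrightarrow> in_W (a + b)"
  unfolding in_W_def
proof (elim exE conjE)
  fix h g :: "nat \<Rightarrow> bit ps"
  assume *: "\<forall>k. symq (h k)" "a = (\<Sum>k\<in>{1..q}. h k * lead k)" "\<forall>k. symq (g k)" "b = (\<Sum>k\<in>{1..q}. g k * lead k)"
  show "\<exists>h. (\<forall>k. symq (h k)) \<and> a + b = (\<Sum>k\<in>{1..q}. h k * lead k)"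
    by (rule exI[of _ "\<lambda>k. h k + g k"]) (use * in \<open>simp add: symq_add distrib_right sum.distrib\<close>)
qed

lemma in_W_mult: "in_W a \<Longrightarrow> symq f \<Longrightarrow> in_W (f * a)"
  unfolding in_W_def
proof (elim exE conjE)
  fix h :: "nat \<Rightarrow> bit ps"
  assume *: "symq f" "\<forall>k. symq (h k)" "a = (\<Sum>k\<in>{1..q}. h k * lead k)"
  show "\<exists>h. (\<forall>k. symq (h k)) \<and> f * a = (\<Sum>k\<in>{1..q}. h k * lead k)"
    by (rule exI[of _ "\<lambda>k. f * h k"]) (use * in \<open>simp add: symq_mult sum_distrib_left mult.assoc\<close>)
qed

lemma in_W_diff: "in_W a \<Longrightarrow> in_W b \<Longrightarrow> in_W (a - b)"
  using in_W_add[of a "cst (-1) * b"] in_W_mult[OF _ symq_cst, of b "-1"] by (simp add: cst_uminus)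

lemma in_W_sum: "(\<And>i. i \<in> S \<Longrightarrow> in_W (f i)) \<Longrightarrow> in_W (sum f S)"
  by (induction S rule: infinite_finite_induct) (simp_all add: in_W_0 in_W_add)

lemma in_W_lead:
  assumes "j \<in> {1..q}"
  shows "in_W (lead j)"
  unfolding in_W_def
proof (intro exI conjI allI)
  let ?h = "\<lambda>k. if k = j then 1 else (0 :: bit ps)"
  show "symq (?h k)" for k using symq_cst[of "1::bit"] by (simp add: symq_0)
  have "(\<Sum>k\<in>{1..q}. ?h k * lead k) = (\<Sum>k\<in>{1..q}. if k = j then lead j else 0)"
    by (rule sum.cong) simp_all
  then show "lead j = (\<Sum>k\<in>{1..q}. ?h k * lead k)"
    using assms by (simp add: sum.delta)
qed

lemma psum_eq_dsym: "i > 0 \<Longrightarrow> q \<ge> 1 \<Longrightarrow> psum i = dsym i (replicate_mset (q - 1) 0)"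
proof -
  assume i: "i > 0" "q \<ge> 1"
  have "psum i = psum i * msym (replicate_mset q 0)" by (simp add: msym_replicate_0)
  also have "\<dots> = (\<Sum>a\<in>set_mset (replicate_mset q 0). dsym (i + a) (replicate_mset q 0 - {#a#}))"
    by (rule psum_mult_msym[OF i(1)])
  also have "set_mset (replicate_mset q (0::nat)) = {0}" using i(2) by simp
  also have "replicate_mset q (0::nat) = add_mset 0 (replicate_mset (q - 1) 0)"
    using i(2) by (cases q) simp_all
  finally show ?thesis by simp
qed

text \<open>The product of \<open>psum i\<close> with the elementary symmetric function of degree k
  + 1 is the sum of the functions for (i + 1, k) and (i, k + 1). The second is known by induction on
  i for all k at once, and \<open>psum i\<close> itself is the known case k = 0.\<close>

lemma in_W_hook:
  assumes "i \<ge> Q"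
  shows "\<forall>k<q. in_W (dsym i (replicate_mset k 1 + replicate_mset (q - 1 - k) 0))"
  using assms
proof (induction i rule: dec_induct)
  case base
  show ?case
  proof (intro allI impI)
    fix k assume k: "k < q"
    have "dsym Q (replicate_mset k 1 + replicate_mset (q - 1 - k) 0) = lead (Suc k)"
      using Q_ge_2 n_ge_1 by (simp add: dsym_def lead_def lead_mset_def One_nat_def)
    then show "in_W (dsym Q (replicate_mset k 1 + replicate_mset (q - 1 - k) 0))"
      using in_W_lead[of "Suc k"] k by simp
  qed
next
  case (step i)
  have i: "i > 0" using step.hyps Q_ge_2 by linarith
  show ?case
  proof (intro allI impI)
    fix k assume k: "k < q"
    have psW: "in_W (psum i)"
      using step.IH[rule_format, of 0] k i by (simp add: psum_eq_dsym)
    \<comment> \<open>The exponents of the elementary symmetric function of degree k + 1. The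
      distinct entries are 1 and, unless k + 1 = q, also 0.\<close>
    let ?\<nu> = "replicate_mset (Suc k) 1 + replicate_mset (q - 1 - k) (0::nat)"
    have "in_W (msym ?\<nu> * psum i)" by (rule in_W_mult[OF psW symq_msym])
    then have W: "in_W (\<Sum>a\<in>set_mset ?\<nu>. dsym (i + a) (?\<nu> - {#a#}))"
      using psum_mult_msym[OF i, of ?\<nu>, where 'a = bit] by (simp only: mult.commute)
    have m1: "?\<nu> - {#1#} = replicate_mset k 1 + replicate_mset (q - 1 - k) 0" by simp
    show "in_W (dsym (Suc i) (replicate_mset k 1 + replicate_mset (q - 1 - k) 0))"
    proof (cases "Suc k < q")
      case False
      then have set: "set_mset ?\<nu> = {1}" using k by simp
      have "(\<Sum>a\<in>set_mset ?\<nu>. dsym (i + a) (?\<nu> - {#a#})) = (dsym (i + 1) (?\<nu> - {#1#}) :: bit ps)"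
        unfolding set by simp
      then show ?thesis using W m1 by (simp only: Suc_eq_plus1)
    next
      case True
      then have set: "set_mset ?\<nu> = {1, 0}" by auto
      have z: "replicate_mset (q - 1 - k) (0::nat) = add_mset 0 (replicate_mset (q - 1 - Suc k) 0)"
        using True by (simp flip: replicate_mset_Suc add: Suc_diff_Suc)
      have m0: "?\<nu> - {#0#} = replicate_mset (Suc k) 1 + replicate_mset (q - 1 - Suc k) 0"
        unfolding z by simp
      have "(\<Sum>a\<in>set_mset ?\<nu>. dsym (i + a) (?\<nu> - {#a#})) =
          dsym (i + 1) (?\<nu> - {#1#}) + (dsym (i + 0) (?\<nu> - {#0#}) :: bit ps)"
        unfolding set by simp
      then have "in_W (dsym (Suc i) (?\<nu> - {#1#}) + dsym i (?\<nu> - {#0#}))"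
        using W by (simp only: Suc_eq_plus1 add_0_right)
      from in_W_diff[OF this, of "dsym i (?\<nu> - {#0#})"] step.IH[rule_format, OF True]
      show ?thesis unfolding m0 m1 by (simp only: add_diff_cancel_right')
    qed
  qed
qed

lemma in_W_psum: "i \<ge> Q \<Longrightarrow> q \<ge> 1 \<Longrightarrow> in_W (psum i)"
proof -
  assume i: "i \<ge> Q" "q \<ge> 1"
  then have "i > 0" using Q_ge_2 by linarith
  then show ?thesis
    using in_W_hook[OF i(1), rule_format, of 0] i(2) by (simp add: psum_eq_dsym)
qed

text \<open>In the product of \<open>psum i\<close> with the monomial symmetric function of (0,
  \<mu>), raising a zero gives the wanted function. Raising an entry a > 0 gives the exponent i + a
  with a remainder of smaller sum, so the induction is on the sum, for arbitrary i.\<close>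

lemma in_W_dsym:
  assumes "q \<ge> 1"
  shows "i \<ge> Q \<Longrightarrow> in_W (dsym i \<mu>)"
proof (induction "sum_mset \<mu>" arbitrary: i \<mu> rule: less_induct)
  case less
  have i: "i > 0" using less.prems Q_ge_2 by linarith
  let ?\<nu> = "add_mset 0 \<mu>"
  have "in_W (msym ?\<nu> * psum i)" by (rule in_W_mult[OF in_W_psum[OF less.prems assms] symq_msym])
  then have W: "in_W (\<Sum>a\<in>set_mset ?\<nu>. dsym (i + a) (?\<nu> - {#a#}))"
    using psum_mult_msym[OF i, of ?\<nu>, where 'a = bit] by (simp only: mult.commute)
  have eq: "(\<Sum>a\<in>set_mset ?\<nu>. dsym (i + a) (?\<nu> - {#a#})) =
      dsym i \<mu> + (\<Sum>a\<in>set_mset ?\<nu> - {0}. dsym (i + a) (?\<nu> - {#a#}) :: bit ps)"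
    by (subst sum.remove[of _ 0]) simp_all
  have "in_W (dsym (i + a) (?\<nu> - {#a#}))" if a: "a \<in> set_mset ?\<nu> - {0}" for a
  proof (rule less.hyps)
    have "a \<in># \<mu>" "a > 0" using a by simp_all
    then obtain \<mu>' where "\<mu> = add_mset a \<mu>'" by (meson mset_add)
    then show "sum_mset (?\<nu> - {#a#}) < sum_mset \<mu>" using \<open>a > 0\<close> by (simp add: add_mset_commute[of 0])
    show "Q \<le> i + a" using less.prems by simp
  qed
  then have "in_W (\<Sum>a\<in>set_mset ?\<nu> - {0}. dsym (i + a) (?\<nu> - {#a#}))" by (rule in_W_sum)
  from in_W_diff[OF W[unfolded eq] this] show ?case by simp
qed

definition bad :: "nat multiset \<Rightarrow> bool" where
  "bad \<kappa> \<longleftrightarrow> (\<exists>c\<ge>Q. odd (count \<kappa> c))"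

text \<open>The multiplicity in \<open>dsym\<close> is odd here, hence 1 in Z/2.\<close>

lemma in_W_msym:
  assumes "q \<ge> 1" "bad \<kappa>"
  shows "in_W (msym \<kappa>)"
proof -
  obtain c where c: "c \<ge> Q" "odd (count \<kappa> c)" using assms(2) by (auto simp: bad_def)
  then have "c \<in># \<kappa>" by (metis count_inI even_zero)
  then have e: "add_mset c (\<kappa> - {#c#}) = \<kappa>" by simp
  have "(msym \<kappa> :: bit ps) = dsym c (\<kappa> - {#c#})"
    unfolding dsym_def e using c(2) by (simp add: of_nat_bit)
  then show ?thesis using in_W_dsym[OF assms(1) c(1)] by simp
qed

section \<open>The bad part in terms of the leading forms\<close>

definition degree_part :: "nat \<Rightarrow> 'a::zero ps \<Rightarrow> 'a ps" where
  "degree_part N f = Ps (\<lambda>M. if total_degree M = N then cf f M else 0)"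

definition bad_part :: "'a::zero ps \<Rightarrow> 'a ps" where
  "bad_part f = Ps (\<lambda>M. if bad (expo M) then cf f M else 0)"

lemma cf_degree_part: "cf (degree_part N f) M = (if total_degree M = N then cf f M else 0)"
  by (simp add: degree_part_def)

lemma cf_bad_part: "cf (bad_part f) M = (if bad (expo M) then cf f M else 0)"
  by (simp add: bad_part_def)

lemma symq_cf_map_key: "symq f \<Longrightarrow> perm \<sigma> \<Longrightarrow> cf f (map_key \<sigma> M) = cf f M"
  using symq_act[of f \<sigma>] cf_act[of \<sigma> f M] by simp

lemma symq_bad_part:
  fixes f :: "'a::zero ps"
  assumes "symq f" shows "symq (bad_part f)"
proof (rule symqI)
  show "supp (bad_part f)"
    by (rule suppI) (simp add: cf_bad_part suppD[OF symq_supp[OF assms]])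
qed (simp add: cf_bad_part expo_map_key symq_cf_map_key[OF assms])

lemma lead_homog: "k \<in> {1..q} \<Longrightarrow> cf (lead k) M \<noteq> 0 \<Longrightarrow> total_degree M = Q + k - 1"
  using sum_expo[of M] by (auto simp: lead_def lead_mset_def cf_msym split: if_splits)

definition homog_rep :: "nat \<Rightarrow> bit ps \<Rightarrow> (nat \<Rightarrow> bit ps) \<Rightarrow> bool" where
  "homog_rep N p h \<longleftrightarrow> (\<forall>k. symq (h k)) \<and> degree_part N p = (\<Sum>k\<in>{1..q}. h k * lead k) \<and>
     (\<forall>k M. cf (h k) M \<noteq> 0 \<longrightarrow> total_degree M + (Q + k - 1) = N)"

text \<open>Each \<open>lead k\<close> is homogeneous of degree Q + k - 1, so from its coefficient
  the terms of degree other than N - (Q + k - 1) may be dropped without affecting the part of degree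
  N.\<close>

lemma in_W_homog_rep:
  assumes "in_W p"
  shows "\<exists>h. homog_rep N p h"
proof -
  obtain h where h: "\<And>k. symq (h k)" "p = (\<Sum>k\<in>{1..q}. h k * lead k)"
    using assms by (auto simp: in_W_def)
  define h' where "h' k = Ps (\<lambda>M. if total_degree M + (Q + k - 1) = N then cf (h k) M else 0)" for k
  have cf_h': "cf (h' k) M = (if total_degree M + (Q + k - 1) = N then cf (h k) M else 0)" for k M
    by (simp add: h'_def)
  have "symq (h' k)" for k
  proof (rule symqI)
    show "supp (h' k)"
      by (rule suppI) (simp add: cf_h' suppD[OF symq_supp[OF h(1)]])
  qed (simp add: cf_h' total_degree_map_key symq_cf_map_key[OF h(1)])
  moreover have "degree_part N p = (\<Sum>k\<in>{1..q}. h' k * lead k)"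
  proof (rule ps_eqI)
    fix M
    have eq: "cf (h' k * lead k) M = (if total_degree M = N then cf (h k * lead k) M else 0)" if k: "k \<in> {1..q}" for k
    proof -
      have "(case p of (A, B) \<Rightarrow> cf (h' k) A * cf (lead k) B) =
          (if total_degree M = N then (case p of (A, B) \<Rightarrow> cf (h k) A * cf (lead k) B) else 0)"
        if p: "p \<in> splits M" for p
      proof -
        obtain A B where AB: "p = (A, B)" "A + B = M" using p by (auto simp: splits_def)
        then have deg: "total_degree M = total_degree A + total_degree B" by auto
        show ?thesis
        proof (cases "cf (lead k) B = 0")
          case False
          then have "total_degree B = Q + k - 1" by (rule lead_homog[OF k])
          then show ?thesis using deg by (simp add: AB(1) cf_h')
        qed (simp add: AB(1))
      qed
      then show ?thesis unfolding cf_mult by (simp cong: sum.cong)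
    qed
    show "cf (degree_part N p) M = cf (\<Sum>k\<in>{1..q}. h' k * lead k) M"
    proof (cases "total_degree M = N")
      case True
      then have "cf (degree_part N p) M = (\<Sum>k\<in>{1..q}. cf (h k * lead k) M)" by (simp add: cf_degree_part h(2))
      also have "\<dots> = (\<Sum>k\<in>{1..q}. cf (h' k * lead k) M)" by (rule sum.cong) (simp_all add: eq True)
      finally show ?thesis by simp
    next
      case False
      then have "(\<Sum>k\<in>{1..q}. cf (h' k * lead k) M) = 0" by (intro sum.neutral) (simp add: eq)
      then show ?thesis using False by (simp add: cf_degree_part)
    qed
  qed
  ultimately show ?thesis
    unfolding homog_rep_def by (intro exI[of _ h'] conjI allI impI) (auto simp: cf_h' split: if_splits)
qed

text \<open>In one degree a symmetric series is a finite combination of monomial symmetric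
  functions. The whole bad part is in general an infinite one, which is why it is treated degree by
  degree.\<close>

lemma in_W_bad_part:
  assumes "q \<ge> 1" "symq f"
  shows "in_W (degree_part N (bad_part f))"
proof -
  let ?A = "{M :: monom. keys M \<subseteq> {1..q} \<and> total_degree M \<le> N}"
  let ?T = "{\<kappa> \<in> expo ` ?A. bad \<kappa> \<and> sum_mset \<kappa> = N}"
  \<comment> \<open>By symmetry every monomial of the orbit gives the same coefficient.\<close>
  define c where "c \<kappa> = cf f (SOME M. keys M \<subseteq> {1..q} \<and> expo M = \<kappa>)" for \<kappa>
  have fin: "finite ?T" using finite_monoms[of "{1..q}" N] by simp
  have c: "c (expo M) = cf f M" if "keys M \<subseteq> {1..q}" for M
  proof -
    let ?M = "SOME M'. keys M' \<subseteq> {1..q} \<and> expo M' = expo M"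
    have "keys ?M \<subseteq> {1..q} \<and> expo ?M = expo M"
      by (rule someI[of "\<lambda>M'. keys M' \<subseteq> {1..q} \<and> expo M' = expo M" M]) (simp add: that)
    then show ?thesis unfolding c_def by (intro symq_expo[OF assms(2)] that) simp_all
  qed
  have "degree_part N (bad_part f) = (\<Sum>\<kappa>\<in>?T. cst (c \<kappa>) * msym \<kappa>)"
  proof (rule ps_eqI)
    fix M
    show "cf (degree_part N (bad_part f)) M = cf (\<Sum>\<kappa>\<in>?T. cst (c \<kappa>) * msym \<kappa>) M"
    proof (cases "keys M \<subseteq> {1..q}")
      case False
      then show ?thesis
        by (simp add: cf_degree_part cf_bad_part cf_msym suppD[OF symq_supp[OF assms(2)]])
    next
      case True
      have "cf (\<Sum>\<kappa>\<in>?T. cst (c \<kappa>) * msym \<kappa>) M = (\<Sum>\<kappa>\<in>?T. if \<kappa> = expo M then c (expo M) else 0)"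
        unfolding cf_sum by (rule sum.cong) (auto simp: cf_msym True)
      also have "\<dots> = (if expo M \<in> ?T then c (expo M) else 0)"
        by (rule sum.delta[OF fin])
      also have "expo M \<in> ?T \<longleftrightarrow> bad (expo M) \<and> total_degree M = N"
        using sum_expo[OF True] True by auto
      finally show ?thesis using c[OF True] by (simp add: cf_degree_part cf_bad_part)
    qed
  qed
  moreover have "in_W (\<Sum>\<kappa>\<in>?T. cst (c \<kappa>) * msym \<kappa>)"
  proof (rule in_W_sum)
    fix \<kappa> assume "\<kappa> \<in> ?T"
    then show "in_W (cst (c \<kappa>) * msym \<kappa>)"
      by (intro in_W_mult in_W_msym assms symq_cst) simp
  qed
  ultimately show ?thesis by (simp only:)
qed

definition rep :: "nat \<Rightarrow> bit ps \<Rightarrow> (nat \<Rightarrow> bit ps)" where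
  "rep N p = (SOME h. homog_rep N p h)"

text \<open>Glues the degreewise expressions: a monomial \<open>M\<close> in the coefficient of
  \<open>lead k\<close> belongs to the expression in degree |M| + Q + k - 1. The choice
  \<open>rep\<close> depends only on the homogeneous part, so series with equal parts get equal
  coefficients. This yields continuity although nothing makes the choices linear.\<close>

definition lead_coef :: "nat \<Rightarrow> bit ps \<Rightarrow> bit ps" where
  "lead_coef k f = Ps (\<lambda>M. cf (rep (total_degree M + (Q + k - 1))
      (degree_part (total_degree M + (Q + k - 1)) (bad_part f)) k) M)"

lemma homog_rep_rep:
  assumes "q \<ge> 1" "symq f"
  shows "homog_rep N (degree_part N (bad_part f)) (rep N (degree_part N (bad_part f)))"
  unfolding rep_def by (rule someI_ex[OF in_W_homog_rep[OF in_W_bad_part[OF assms]]])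

lemma symq_lead_coef:
  assumes "q \<ge> 1" "symq f"
  shows "symq (lead_coef k f)"
proof -
  have s: "symq (rep N (degree_part N (bad_part f)) k)" for N
    using homog_rep_rep[OF assms] by (simp add: homog_rep_def)
  show ?thesis
  proof (rule symqI)
    show "supp (lead_coef k f)"
      by (rule suppI) (simp add: lead_coef_def suppD[OF symq_supp[OF s]])
  qed (simp add: lead_coef_def total_degree_map_key symq_cf_map_key[OF s])
qed

text \<open>For a fixed monomial only the expression in its own degree is consulted: a monomial A in
  the coefficient times one of \<open>lead k\<close> has degree |A| + Q + k - 1.\<close>

lemma bad_part_eq:
  assumes "q \<ge> 1" "symq f"
  shows "bad_part f = (\<Sum>k\<in>{1..q}. lead_coef k f * lead k)"
proof (rule ps_eqI)
  fix M
  define N where "N = total_degree M"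
  let ?r = "rep N (degree_part N (bad_part f))"
  have "cf (bad_part f) M = cf (degree_part N (degree_part N (bad_part f))) M"
    by (simp add: cf_degree_part N_def)
  also have "\<dots> = cf (\<Sum>k\<in>{1..q}. ?r k * lead k) M"
    using homog_rep_rep[OF assms, of N] by (simp add: homog_rep_def)
  also have "\<dots> = (\<Sum>k\<in>{1..q}. cf (?r k * lead k) M)" by simp
  also have "\<dots> = (\<Sum>k\<in>{1..q}. cf (lead_coef k f * lead k) M)"
  proof (rule sum.cong[OF refl])
    fix k assume k: "k \<in> {1..q}"
    show "cf (?r k * lead k) M = cf (lead_coef k f * lead k) M"
      unfolding cf_mult
    proof (rule sum.cong[OF refl])
      fix p assume "p \<in> splits M"
      then obtain A B where AB: "p = (A, B)" "A + B = M" by (auto simp: splits_def)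
      then have deg: "N = total_degree A + total_degree B" by (auto simp: N_def)
      show "(case p of (A, B) \<Rightarrow> cf (?r k) A * cf (lead k) B) = (case p of (A, B) \<Rightarrow> cf (lead_coef k f) A * cf (lead k) B)"
      proof (cases "cf (lead k) B = 0")
        case False
        then have "total_degree B = Q + k - 1" by (rule lead_homog[OF k])
        then show ?thesis using deg by (simp add: AB(1) lead_coef_def)
      qed (simp add: AB(1))
    qed
  qed
  finally show "cf (bad_part f) M = cf (\<Sum>k\<in>{1..q}. lead_coef k f * lead k) M" by simp
qed

text \<open>The coefficient at \<open>M\<close> is determined by the homogeneous part of degree |M|
  + Q + k - 1. Where the subtraction is truncated to 0 the claim is empty.\<close>

lemma ordge_lead_coef_diff:
  assumes "ordge N (f - g)"
  shows "ordge (N - (Q + k - 1)) (lead_coef k f - lead_coef k g)"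
proof (subst ordge_diff_iff, intro allI impI)
  fix M :: monom assume M: "total_degree M < N - (Q + k - 1)"
  have "degree_part (total_degree M + (Q + k - 1)) (bad_part f) = degree_part (total_degree M + (Q + k - 1)) (bad_part g)"
  proof (rule ps_eqI)
    fix M'
    show "cf (degree_part (total_degree M + (Q + k - 1)) (bad_part f)) M' = cf (degree_part (total_degree M + (Q + k - 1)) (bad_part g)) M'"
      using assms M by (simp add: cf_degree_part cf_bad_part ordge_diff_iff)
  qed
  then show "cf (lead_coef k f) M = cf (lead_coef k g) M" by (simp add: lead_coef_def)
qed

end

section \<open>Leading forms of the generators\<close>

lemma bit_ps_diff: "f - g = f + (g :: bit ps)"
  by (rule ps_eqI) (simp add: minus_bit_def)

context morava_sym
begin

definition gen :: "nat \<Rightarrow> bit ps" where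
  "gen k = esym q k var - esym q k (\<lambda>j. fpsub gb (var j))"

lemma symq_gen: "symq (gen k)"
proof -
  have "esym q k var = (esym q k (\<lambda>j. fpsub fps_X (var j)) :: bit ps)"
    by (simp add: fpsub_X)
  then show ?thesis unfolding gen_def by (simp only:) (intro symq_diff symq_esym)
qed

lemma fpsub_gb_var_low:
  "ordge (Suc Q) (fpsub gb (var j) - (var j + xm (single j Q)))"
proof (subst ordge_diff_iff, intro allI impI)
  fix M :: monom assume M: "total_degree M < Suc Q"
  show "cf (fpsub gb (var j)) M = cf (var j + xm (single j Q)) M"
  proof (cases "\<exists>i. M = single j i")
    case False
    then have "cf (fpsub gb (var j)) M = 0" by (intro fpsub_var_other) blast
    then show ?thesis using False by (auto simp: var_eq_xm)
  next
    case True
    then obtain i where i: "M = single j i" by blast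
    have inj: "single j a = single j b \<longleftrightarrow> a = b" for a b :: nat
      using lookup_single_eq by metis
    have iQ: "i \<le> Q" using M i by simp
    have "cf (fpsub gb (var j)) M = fps_nth gb i" unfolding i by (rule fpsub_var_single)
    also have "\<dots> = (if i = 1 then 1 else 0) + (if i = Q then 1 else 0)"
    proof -
      consider "i = 0" | "i = 1" | "1 < i" "i < Q" | "i = Q" using iQ by linarith
      then show ?thesis using gb_0 gb_1 gb_Q gb_between Q_ge_2 n_ge_1 by cases simp_all
    qed
    also have "\<dots> = cf (var j + xm (single j Q)) M"
      by (simp add: var_eq_xm i inj)
    finally show ?thesis .
  qed
qed

text \<open>The part of the product of all x_j + x_j^Q with j in S that is linear in the Q-th
  powers.\<close>

definition lin :: "nat set \<Rightarrow> bit ps" where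
  "lin S = (\<Sum>i\<in>S. xm (single i Q) * (\<Prod>j\<in>S - {i}. var j))"

lemma ordge_prod_var: "ordge (card S) (\<Prod>j\<in>S. var j)"
  using ordge_prod[of S "\<lambda>_. 1" var] by (simp add: ordge_var)

lemma ordge_lin: "finite S \<Longrightarrow> ordge (Q + card S - 1) (lin S)"
  unfolding lin_def
proof (rule ordge_sum)
  fix i assume S: "finite S" "i \<in> S"
  then have "card (S - {i}) = card S - 1" "card S \<ge> 1" by (auto simp: card_gt_0_iff Suc_le_eq One_nat_def)
  moreover have "ordge (Q + card (S - {i})) (xm (single i Q) * (\<Prod>j\<in>S - {i}. var j))"
    by (rule ordge_mult[OF _ ordge_prod_var]) simp
  ultimately show "ordge (Q + card S - 1) (xm (single i Q) * (\<Prod>j\<in>S - {i}. var j))"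
    by simp
qed

lemma lin_insert:
  assumes "finite S" "t \<notin> S"
  shows "lin (insert t S) = xm (single t Q) * (\<Prod>j\<in>S. var j) + var t * lin S"
proof -
  have "(\<Sum>i\<in>S. xm (single i Q) * (\<Prod>j\<in>insert t S - {i}. var j)) = var t * lin S"
    unfolding lin_def sum_distrib_left
  proof (rule sum.cong[OF refl])
    fix i assume "i \<in> S"
    then have "insert t S - {i} = insert t (S - {i})" using assms by auto
    then have "(\<Prod>j\<in>insert t S - {i}. var j) = var t * (\<Prod>j\<in>S - {i}. var j :: bit ps)"
      using assms by simp
    then show "xm (single i Q) * (\<Prod>j\<in>insert t S - {i}. var j) = var t * (xm (single i Q) * (\<Prod>j\<in>S - {i}. var j) :: bit ps)"
      by (simp only: mult.left_commute)
  qed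
  moreover have "insert t S - {t} = S" using assms by auto
  ultimately show ?thesis
    using assms unfolding lin_def[of "insert t S"] by simp
qed

text \<open>Two factors contributing Q-th powers raise the order by 2(Q - 1) \<ge> Q, and a single
  higher term of the conjugation raises it by at least Q. So below order Q + |S| only the product
  itself and its part linear in Q-th powers remain.\<close>

lemma prod_conj_expansion:
  assumes "finite S"
  shows "ordge (Q + card S) ((\<Prod>j\<in>S. fpsub gb (var j)) - ((\<Prod>j\<in>S. var j) + lin S))"
  using assms
proof (induction S rule: finite_induct)
  case empty
  then show ?case by (simp add: lin_def)
next
  case (insert t S)
  let ?y = "fpsub gb (var t)" and ?Y = "\<Prod>j\<in>S. fpsub gb (var j)" and ?P = "\<Prod>j\<in>S. var j" and ?x = "xm (single t Q)"
  have eq: "(\<Prod>j\<in>insert t S. fpsub gb (var j)) - ((\<Prod>j\<in>insert t S. var j) + lin (insert t S)) =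
      ?y * (?Y - (?P + lin S)) + (?y - (var t + ?x)) * (?P + lin S) + ?x * lin S"
    using insert.hyps by (simp add: lin_insert algebra_simps)
  have card: "card (insert t S) = card S + 1" using insert.hyps by simp
  have o1: "ordge (Q + card S + 1) (?y * (?Y - (?P + lin S)))"
    using ordge_mult[OF ordge_fpsub[OF ordge_var gb_0] insert.IH] by (simp add: add_ac)
  have "ordge (card S) (lin S)"
    by (rule ordge_mono[OF ordge_lin[OF insert.hyps(1)]]) (use Q_ge_2 in linarith)
  then have "ordge (card S) (?P + lin S)" by (intro ordge_add ordge_prod_var)
  from ordge_mult[OF fpsub_gb_var_low this]
  have o2: "ordge (Q + card S + 1) ((?y - (var t + ?x)) * (?P + lin S))"
    by (rule ordge_mono) simp
  have "ordge (Q + (Q + card S - 1)) (?x * lin S)"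
    by (rule ordge_mult[OF _ ordge_lin[OF insert.hyps(1)]]) simp
  then have o3: "ordge (Q + card S + 1) (?x * lin S)"
    by (rule ordge_mono) (use Q_ge_2 in linarith)
  have "ordge (Q + card S + 1) (?y * (?Y - (?P + lin S)) + (?y - (var t + ?x)) * (?P + lin S) + ?x * lin S)"
    by (intro ordge_add o1 o2 o3)
  then show ?case unfolding eq card by (simp only: add.assoc)
qed

definition hook_monom :: "nat set \<Rightarrow> nat \<Rightarrow> monom" where
  "hook_monom S i = single i Q + (\<Sum>j\<in>S - {i}. single j 1)"

lemma lookup_hook_monom:
  assumes "finite S" "i \<in> S"
  shows "lookup (hook_monom S i) j = (if j = i then Q else if j \<in> S then 1 else 0)"
proof -
  have "(\<Sum>k\<in>S - {i}. lookup (single k 1) j) = (\<Sum>k\<in>S - {i}. if k = j then 1 else (0::nat))"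
    by (rule sum.cong) (auto simp: lookup_single when_def)
  also have "\<dots> = (if j \<in> S - {i} then 1 else 0)"
    using assms by (simp add: sum.delta)
  finally show ?thesis
    by (auto simp: hook_monom_def lookup_add lookup_sum lookup_single when_def)
qed

lemma keys_hook_monom:
  assumes "finite S" "i \<in> S"
  shows "keys (hook_monom S i) = S"
proof (rule Set.set_eqI)
  fix j show "j \<in> keys (hook_monom S i) \<longleftrightarrow> j \<in> S"
    using assms(2) by (simp add: in_keys_iff lookup_hook_monom[OF assms])
qed

lemma lin_eq: "finite S \<Longrightarrow> lin S = (\<Sum>i\<in>S. xm (hook_monom S i))"
  unfolding lin_def by (rule sum.cong) (simp_all add: hook_monom_def xm_add xm_sum var_eq_xm)

lemma expo_split:
  assumes "keys M \<subseteq> {1..q}"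
  shows "expo M = image_mset (lookup M) (mset_set (keys M)) + replicate_mset (q - card (keys M)) 0"
proof -
  have "mset_set {1..q} = mset_set (keys M) + mset_set ({1..q} - keys M)"
    using mset_set_Union[of "keys M" "{1..q} - keys M"] assms by (simp add: Un_absorb1)
  moreover have "image_mset (lookup M) (mset_set ({1..q} - keys M)) = image_mset (\<lambda>_. 0) (mset_set ({1..q} - keys M))"
    by (rule image_mset_cong) (simp add: in_keys_iff)
  moreover have "card ({1..q} - keys M) = q - card (keys M)"
    using assms by (simp add: card_Diff_subset)
  ultimately show ?thesis by (simp add: expo_def image_mset_const_eq)
qed

text \<open>Without its zero entries the multiset lists the exponents on the support: a single Q and
  otherwise 1. Hence k is the size of the support.\<close>

lemma expo_eq_lead_iff:
  assumes "keys M \<subseteq> {1..q}" "k \<in> {1..q}"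
  shows "expo M = lead_mset k \<longleftrightarrow> card (keys M) = k \<and> (\<exists>i\<in>keys M. M = hook_monom (keys M) i)"
proof
  assume *: "expo M = lead_mset k"
  let ?K = "image_mset (lookup M) (mset_set (keys M))"
  have nz: "x \<noteq> 0" if "x \<in># ?K" for x
    using that by (auto simp: in_keys_iff)
  have "filter_mset (\<lambda>x. x \<noteq> 0) ?K = ?K"
    using nz by (simp add: filter_mset_eq_conv)
  then have "filter_mset (\<lambda>x. x \<noteq> 0) (expo M) = ?K"
    unfolding expo_split[OF assms(1)] by simp
  moreover have "filter_mset P (replicate_mset m x) = (if P x then replicate_mset m x else {#})" for P m and x :: nat
    by (induction m) simp_all
  then have "filter_mset (\<lambda>x. x \<noteq> 0) (lead_mset k) = add_mset Q (replicate_mset (k - 1) 1)"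
    using Q_ge_2 by (simp add: lead_mset_def)
  ultimately have K: "?K = add_mset Q (replicate_mset (k - 1) 1)" using * by simp
  have "size ?K = k" unfolding K using assms(2) by simp
  then have card: "card (keys M) = k" by simp
  have "Q \<in># ?K" unfolding K by simp
  then obtain i where i: "i \<in> keys M" "lookup M i = Q" by auto
  have "?K = add_mset (lookup M i) (image_mset (lookup M) (mset_set (keys M - {i})))"
    by (subst mset_set.remove[of _ i]) (use i in simp_all)
  then have "image_mset (lookup M) (mset_set (keys M - {i})) = replicate_mset (k - 1) 1"
    using K i(2) by simp
  then have one: "lookup M j = 1" if "j \<in> keys M - {i}" for j
  proof -
    have "lookup M j \<in># image_mset (lookup M) (mset_set (keys M - {i}))" using that by simp
    then show ?thesis
      unfolding \<open>image_mset (lookup M) (mset_set (keys M - {i})) = replicate_mset (k - 1) 1\<close>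
      by (simp split: if_splits)
  qed
  have "M = hook_monom (keys M) i"
  proof (rule poly_mapping_eqI)
    fix j
    show "lookup M j = lookup (hook_monom (keys M) i) j"
      unfolding lookup_hook_monom[OF finite_keys i(1)]
      using one[of j] i(2) by (simp add: in_keys_iff)
  qed
  with card i show "card (keys M) = k \<and> (\<exists>i\<in>keys M. M = hook_monom (keys M) i)" by blast
next
  assume "card (keys M) = k \<and> (\<exists>i\<in>keys M. M = hook_monom (keys M) i)"
  then obtain i where i: "card (keys M) = k" "i \<in> keys M" "M = hook_monom (keys M) i" by blast
  have l: "lookup M j = (if j = i then Q else if j \<in> keys M then 1 else 0)" for j
    using lookup_hook_monom[OF finite_keys i(2), of j] i(3) by simp
  have "image_mset (lookup M) (mset_set (keys M - {i})) = image_mset (\<lambda>_. 1) (mset_set (keys M - {i}))"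
    by (rule image_mset_cong) (simp add: l)
  also have "\<dots> = replicate_mset (k - 1) 1"
    using i by (simp add: image_mset_const_eq)
  finally have "image_mset (lookup M) (mset_set (keys M)) = add_mset Q (replicate_mset (k - 1) 1)"
    by (subst mset_set.remove[of _ i]) (use i l[of i] in simp_all)
  then show "expo M = lead_mset k"
    unfolding expo_split[OF assms(1)] i(1) lead_mset_def by simp
qed

text \<open>Each monomial of the orbit arises exactly once: S must be its support and i the variable
  with exponent Q, which is unique because Q > 1.\<close>

lemma sum_lin_eq_lead:
  assumes k: "k \<in> {1..q}"
  shows "(\<Sum>S\<in>{S. S \<subseteq> {1..q} \<and> card S = k}. lin S) = lead k"
proof (rule ps_eqI)
  fix M :: monom
  let ?T = "{S. S \<subseteq> {1..q} \<and> card S = k}" and ?K = "keys M"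
  have finT: "finite ?T" by (rule finite_subset[of _ "Pow {1..q}"]) auto
  have finS: "finite S" if "S \<in> ?T" for S using that finite_subset by auto
  define c :: bit where "c = (\<Sum>i\<in>?K. if M = hook_monom ?K i then 1 else 0)"
  have "cf (\<Sum>S\<in>?T. lin S) M = (\<Sum>S\<in>?T. \<Sum>i\<in>S. if M = hook_monom S i then 1 else 0)"
    by (simp add: lin_eq[OF finS])
  also have "\<dots> = (\<Sum>S\<in>?T. if S = ?K then c else 0)"
  proof (rule sum.cong[OF refl])
    fix S assume S: "S \<in> ?T"
    show "(\<Sum>i\<in>S. if M = hook_monom S i then 1 else 0) = (if S = ?K then c else 0)"
    proof (cases "S = ?K")
      case False
      have "M \<noteq> hook_monom S i" if "i \<in> S" for i
        using keys_hook_monom[OF finS[OF S] that] False by metis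
      then show ?thesis using False by simp
    qed (simp add: c_def)
  qed
  also have "\<dots> = (if ?K \<in> ?T then c else 0)" by (rule sum.delta[OF finT])
  also have "\<dots> = (if ?K \<subseteq> {1..q} \<and> expo M = lead_mset k then 1 else 0)"
  proof (cases "?K \<in> ?T")
    case True
    then have K: "?K \<subseteq> {1..q}" "card ?K = k" by simp_all
    have "c = (if \<exists>i\<in>?K. M = hook_monom ?K i then 1 else 0)"
    proof (cases "\<exists>i\<in>?K. M = hook_monom ?K i")
      case True
      then obtain i where i: "i \<in> ?K" "M = hook_monom ?K i" by blast
      have "M = hook_monom ?K j \<longleftrightarrow> j = i" if j: "j \<in> ?K" for j
      proof
        assume Mj: "M = hook_monom ?K j"
        have "lookup M i = Q" using lookup_hook_monom[OF finite_keys i(1), of i] i(2) by simp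
        moreover have "lookup M i = (if i = j then Q else 1)"
          using lookup_hook_monom[OF finite_keys j, of i] Mj i(1) by simp
        ultimately show "j = i" using Q_ge_2 by (simp split: if_splits)
      qed (use i in simp)
      then have "c = (\<Sum>j\<in>?K. if j = i then 1 else 0)" unfolding c_def by (intro sum.cong) simp_all
      then show ?thesis using i(1) True by (simp add: sum.delta)
    next
      case False
      then show ?thesis unfolding c_def by (subst sum.neutral) auto
    qed
    then show ?thesis using True expo_eq_lead_iff[OF K(1) k] K by simp
  next
    case False
    then have "\<not> (?K \<subseteq> {1..q} \<and> expo M = lead_mset k)"
      using expo_eq_lead_iff[OF _ k] by blast
    then show ?thesis using False by (simp only: if_False)
  qed
  finally show "cf (\<Sum>S\<in>?T. lin S) M = cf (lead k) M" by (simp add: lead_def cf_msym)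
qed

lemma gen_lead:
  assumes k: "k \<in> {1..q}"
  shows "ordge (Q + k) (gen k - lead k)"
proof -
  let ?T = "{S. S \<subseteq> {1..q} \<and> card S = k}"
  have "gen k - lead k = (\<Sum>S\<in>?T. (\<Prod>j\<in>S. fpsub gb (var j)) - ((\<Prod>j\<in>S. var j) + lin S))"
    unfolding gen_def esym_def sum_lin_eq_lead[OF k, symmetric] bit_ps_diff
    by (simp add: sum.distrib add_ac)
  also have "ordge (Q + k) \<dots>"
  proof (rule ordge_sum)
    fix S assume "S \<in> ?T"
    then have "finite S" "card S = k" using finite_subset by auto
    then show "ordge (Q + k) ((\<Prod>j\<in>S. fpsub gb (var j)) - ((\<Prod>j\<in>S. var j) + lin S))"
      using prod_conj_expansion by blast
  qed
  finally show ?thesis .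
qed

text \<open>Solving \<open>f' = f - \<Sum>\<^sub>k E\<^sub>k(f') (g\<^sub>k - \<ell>\<^sub>k)\<close>, where \<open>\<Sum>\<^sub>k E\<^sub>k(f') \<ell>\<^sub>k\<close> is the bad part of \<open>f'\<close>
  written in terms of the leading forms \<open>\<ell>\<^sub>k\<close> of the generators \<open>g\<^sub>k\<close>, performs all
  reduction steps at once.\<close>

theorem spanning:
  assumes q: "q \<ge> 1" and f: "symq f"
  shows "\<exists>b h. symq b \<and> (\<forall>M. cf b M \<noteq> 0 \<longrightarrow> \<not> bad (expo M)) \<and> (\<forall>k. symq (h k)) \<and>
    f = b + (\<Sum>k\<in>{1..q}. h k * gen k)"
proof -
  define \<Phi> where "\<Phi> g = f - (\<Sum>k\<in>{1..q}. lead_coef k g * (gen k - lead k))" for g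
  have "\<exists>!g. g \<in> Collect symq \<and> \<Phi> g = g"
  proof (rule ps_contraction_fixpoint[where z = 0])
    show "0 \<in> Collect symq" using symq_0 by simp
  next
    fix g :: "bit ps" assume "g \<in> Collect symq"
    then have g: "symq g" by simp
    have "symq (lead k)" for k unfolding lead_def by (rule symq_msym)
    then have "symq (\<Phi> g)"
      unfolding \<Phi>_def by (intro symq_diff f symq_sum symq_mult symq_gen symq_lead_coef[OF q g])
    then show "\<Phi> g \<in> Collect symq" by simp
  next
    fix g g' :: "bit ps" and N assume gg: "ordge N (g - g')"
    have "\<Phi> g - \<Phi> g' = (\<Sum>k\<in>{1..q}. (lead_coef k g' - lead_coef k g) * (gen k - lead k))"
      unfolding \<Phi>_def by (simp add: left_diff_distrib sum_subtractf)
    also have "ordge (Suc N) \<dots>"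
    proof (rule ordge_sum)
      fix k assume k: "k \<in> {1..q}"
      have "ordge N (g' - g)" using ordge_uminus[OF gg] by simp
      \<comment> \<open>The coefficient loses Q + k - 1 orders and \<open>gen k - lead k\<close> has
        order Q + k, so one order is gained.\<close>
      from ordge_mult[OF ordge_lead_coef_diff[OF this, of k] gen_lead[OF k]]
      show "ordge (Suc N) ((lead_coef k g' - lead_coef k g) * (gen k - lead k))"
        by (rule ordge_mono) (use Q_ge_2 in linarith)
    qed
    finally show "ordge (Suc N) (\<Phi> g - \<Phi> g')" .
  next
    fix g :: "bit ps" assume *: "\<And>N. \<exists>g'\<in>Collect symq. ordge N (g - g')"
    have "symq g"
    proof (rule symqI)
      show "supp g"
      proof (rule suppI)
        fix M :: monom assume M: "\<not> keys M \<subseteq> {1..q}"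
        obtain g' where g': "symq g'" "ordge (Suc (total_degree M)) (g - g')" using * by auto
        then have "cf g M = cf g' M" by (simp add: ordge_diff_iff)
        then show "cf g M = 0" using suppD[OF symq_supp[OF g'(1)] M] by simp
      qed
      fix \<sigma> M assume p: "perm \<sigma>"
      obtain g' where g': "symq g'" "ordge (Suc (total_degree M)) (g - g')" using * by auto
      then have "cf g M = cf g' M" "cf g (map_key \<sigma> M) = cf g' (map_key \<sigma> M)"
        by (simp_all add: ordge_diff_iff total_degree_map_key[OF p])
      then show "cf g (map_key \<sigma> M) = cf g M"
        using symq_cf_map_key[OF g'(1) p] by simp
    qed
    then show "g \<in> Collect symq" by simp
  qed
  then obtain g where g: "symq g" "\<Phi> g = g" by auto
  have "f = g + (\<Sum>k\<in>{1..q}. lead_coef k g * (gen k - lead k))"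
    using g(2) unfolding \<Phi>_def by (simp only: diff_eq_eq)
  \<comment> \<open>The multiples of the leading forms add up to the bad part of g, so subtracting
    them leaves exactly the terms of g that are not bad.\<close>
  also have "\<dots> = (g - bad_part g) + (\<Sum>k\<in>{1..q}. lead_coef k g * gen k)"
    unfolding bad_part_eq[OF q g(1)] by (simp add: right_diff_distrib sum_subtractf)
  finally have "f = (g - bad_part g) + (\<Sum>k\<in>{1..q}. lead_coef k g * gen k)" .
  moreover have "symq (g - bad_part g)" by (intro symq_diff symq_bad_part g(1))
  moreover have "\<forall>M. cf (g - bad_part g) M \<noteq> 0 \<longrightarrow> \<not> bad (expo M)"
    by (auto simp: cf_bad_part)
  moreover have "\<forall>k. symq (lead_coef k g)" by (intro allI symq_lead_coef[OF q g(1)])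
  ultimately show ?thesis
    by (intro exI[of _ "g - bad_part g"] exI[of _ "\<lambda>k. lead_coef k g"] conjI)
qed

end

section \<open>Pairings of the variables\<close>

lemma even_fibres_involution:
  fixes m :: "'b \<Rightarrow> nat"
  assumes "finite A" "\<And>c. c \<ge> B \<Longrightarrow> even (card {i \<in> A. m i = c})"
  shows "\<exists>\<tau>. \<forall>i\<in>A. \<tau> i \<in> A \<and> \<tau> (\<tau> i) = i \<and> m (\<tau> i) = m i \<and> (\<tau> i = i \<longrightarrow> m i < B)"
  using assms
proof (induction "card A" arbitrary: A rule: less_induct)
  case less
  show ?case
  proof (cases "\<exists>i\<in>A. m i \<ge> B")
    case False
    then show ?thesis by (intro exI[of _ id]) (auto simp: not_le)
  next
    case True
    then obtain a where a: "a \<in> A" "m a \<ge> B" by blast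
    let ?L = "{i \<in> A. m i = m a}"
    have "even (card ?L)" by (rule less.prems(2)[OF a(2)])
    then have "?L \<noteq> {a}" by auto
    then obtain b where b: "b \<in> A" "m b = m a" "b \<noteq> a" using a(1) by auto
    let ?A = "A - {a, b}"
    have fin: "finite ?A" using less.prems(1) by simp
    have "card ?A < card A" using a(1) less.prems(1) by (intro psubset_card_mono) auto
    moreover have "even (card {i \<in> ?A. m i = c})" if c: "c \<ge> B" for c
    proof (cases "c = m a")
      case True
      have "{i \<in> A. m i = c} = insert a (insert b {i \<in> ?A. m i = c})" using a b True by auto
      moreover have "card (insert a (insert b {i \<in> ?A. m i = c})) = Suc (Suc (card {i \<in> ?A. m i = c}))"
        using fin b(3) by simp
      ultimately show ?thesis using less.prems(2)[OF c] by simp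
    next
      case False
      then have "{i \<in> ?A. m i = c} = {i \<in> A. m i = c}" using b by auto
      then show ?thesis using less.prems(2)[OF c] by simp
    qed
    ultimately obtain \<tau> where \<tau>: "\<forall>i\<in>?A. \<tau> i \<in> ?A \<and> \<tau> (\<tau> i) = i \<and> m (\<tau> i) = m i \<and> (\<tau> i = i \<longrightarrow> m i < B)"
      using less.hyps[OF _ fin] by blast
    let ?\<tau> = "\<tau>(a := b, b := a)"
    have "?\<tau> i \<in> A \<and> ?\<tau> (?\<tau> i) = i \<and> m (?\<tau> i) = m i \<and> (?\<tau> i = i \<longrightarrow> m i < B)" if i: "i \<in> A" for i
    proof (cases "i \<in> {a, b}")
      case True
      then show ?thesis using a b by auto
    next
      case False
      then have "i \<in> ?A" using i by simp
      then have t: "\<tau> i \<in> ?A" "\<tau> (\<tau> i) = i" "m (\<tau> i) = m i" "\<tau> i = i \<longrightarrow> m i < B" using \<tau> by simp_all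
      have ne: "i \<noteq> a" "i \<noteq> b" "\<tau> i \<noteq> a" "\<tau> i \<noteq> b" using False t(1) by simp_all
      show ?thesis using t ne by simp
    qed
    then show ?thesis by (intro exI[of _ ?\<tau>] ballI)
  qed
qed

text \<open>Substituting \<open>[-1](x\<^sub>i)\<close> for the other variable of each pair \<open>{i, \<tau> i}\<close>, the set of variables becomes
  invariant under conjugation modulo the \<open>x\<^sub>i\<^bsup>Q\<^esup>\<close> with \<open>\<tau> i = i\<close>. So the generators are sent to series in the
  ideal of these powers.\<close>

locale pairing = morava_sym +
  fixes \<tau> :: "nat \<Rightarrow> nat"
  assumes \<tau>_in: "i \<in> {1..q} \<Longrightarrow> \<tau> i \<in> {1..q}"
    and \<tau>_out: "i \<notin> {1..q} \<Longrightarrow> \<tau> i = i"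
    and \<tau>_\<tau> [simp]: "\<tau> (\<tau> i) = i"
begin

definition y :: "nat \<Rightarrow> bit ps" where
  "y i = (if i \<le> \<tau> i then var i else fpsub gb (var (\<tau> i)))"

sublocale substitution "{1..q}" y
  by unfold_locales (simp_all add: y_def ordge_var ordge_fpsub gb_0)

lemma permutes_\<tau>: "perm \<tau>"
proof (rule bij_imp_permutes)
  show "bij_betw \<tau> {1..q} {1..q}"
    by (rule bij_betw_byWitness[of _ \<tau>]) (use \<tau>_in in auto)
qed (rule \<tau>_out)

text \<open>Membership in the ideal generated by the x_i^Q with i fixed by \<tau>, expressed on
  coefficients: every monomial that occurs is divisible by one of them.\<close>

definition killed :: "bit ps \<Rightarrow> bool" where
  "killed f \<longleftrightarrow> (\<forall>M. (\<forall>i\<in>{1..q}. \<tau> i = i \<longrightarrow> lookup M i < Q) \<longrightarrow> cf f M = 0)"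

lemma killed_0: "killed 0" by (simp add: killed_def)
lemma killed_add: "killed f \<Longrightarrow> killed g \<Longrightarrow> killed (f + g)" by (simp add: killed_def)
lemma killed_diff: "killed f \<Longrightarrow> killed g \<Longrightarrow> killed (f - g)" by (simp add: killed_def)
lemma killed_sum: "(\<And>i. i \<in> S \<Longrightarrow> killed (f i)) \<Longrightarrow> killed (sum f S)"
  by (induction S rule: infinite_finite_induct) (simp_all add: killed_0 killed_add)

lemma killed_mult:
  assumes "killed g"
  shows "killed (f * g)"
  unfolding killed_def
proof (intro allI impI)
  fix M assume M: "\<forall>i\<in>{1..q}. \<tau> i = i \<longrightarrow> lookup M i < Q"
  have "cf f A * cf g B = 0" if "A + B = M" for A B
  proof -
    have "lookup B i \<le> lookup M i" for i using that by (auto simp: lookup_add)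
    then have "\<forall>i\<in>{1..q}. \<tau> i = i \<longrightarrow> lookup B i < Q" using M le_less_trans by blast
    then show ?thesis using assms by (simp add: killed_def)
  qed
  then show "cf (f * g) M = 0" unfolding cf_mult by (intro sum.neutral) (auto simp: splits_def)
qed

lemma killed_prod_diff:
  assumes "finite S" "\<And>i. i \<in> S \<Longrightarrow> killed (f i - g i)"
  shows "killed (prod f S - prod g S)"
  using assms
proof (induction S rule: finite_induct)
  case (insert x S)
  have "prod f (insert x S) - prod g (insert x S) = f x * (prod f S - prod g S) + prod g S * (f x - g x)"
    using insert.hyps by (simp add: algebra_simps)
  then show ?case using insert by (simp add: killed_add killed_mult)
qed (simp add: killed_0)

text \<open>Within a pair conjugation exchanges the two values exactly, in one direction by
  definition and in the other because it is an involution. For a fixed index it changes the variable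
  only by multiples of x_j^Q, since [-1](x) has no terms strictly between x and x^Q.\<close>

lemma killed_y:
  assumes "j \<in> {1..q}"
  shows "killed (fpsub gb (y j) - y (\<tau> j))"
proof -
  consider "\<tau> j = j" | "j < \<tau> j" | "\<tau> j < j" by linarith
  then show ?thesis
  proof cases
    case 1
    have "cf (fpsub gb (var j)) M = cf (var j) M" if M: "lookup M j < Q" for M
    proof (cases "\<exists>i. M = single j i")
      case False
      then have "cf (fpsub gb (var j)) M = 0" by (intro fpsub_var_other) blast
      then show ?thesis using False by (auto simp: var_eq_xm)
    next
      case True
      then obtain i where i: "M = single j i" by blast
      have inj: "single j a = single j b \<longleftrightarrow> a = b" for a b :: nat
        using lookup_single_eq by metis
      have iQ: "i < Q" using M i by simp
      have "cf (fpsub gb (var j)) M = fps_nth gb i" unfolding i by (rule fpsub_var_single)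
      also have "\<dots> = (if i = 1 then 1 else 0)"
      proof -
        consider "i = 0" | "i = 1" | "1 < i" by linarith
        then show ?thesis using gb_0 gb_1 gb_between[OF _ iQ] by cases simp_all
      qed
      also have "\<dots> = cf (var j) M" by (simp add: var_eq_xm i inj)
      finally show ?thesis .
    qed
    then show ?thesis using 1 assms by (simp add: killed_def y_def)
  next
    case 2
    then show ?thesis by (simp add: y_def killed_0)
  next
    case 3
    then show ?thesis using fpsub_gb_gb[OF ordge_var] by (simp add: y_def killed_0)
  qed
qed

lemma ms_esym: "ms (esym q k f) = esym q k (\<lambda>j. ms (f j))"
  unfolding esym_def by (simp add: ms_sum ms_prod)

lemma esym_cong: "(\<And>j. j \<in> {1..q} \<Longrightarrow> f j = g j) \<Longrightarrow> esym q k f = esym q k g"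
  unfolding esym_def by (intro sum.cong prod.cong refl) auto

lemma esym_reindex: "esym q k (\<lambda>j. f (\<tau> j)) = esym q k f"
  unfolding esym_def
proof (rule sum.reindex_bij_witness[of _ "\<lambda>S. \<tau> ` S" "\<lambda>S. \<tau> ` S"])
  have inj: "inj_on \<tau> S" for S by (rule inj_on_inverseI[of _ \<tau>]) simp
  fix S assume S: "S \<in> {S. S \<subseteq> {1..q} \<and> card S = k}"
  show "\<tau> ` \<tau> ` S = S" by (simp add: image_image)
  show "\<tau> ` S \<in> {S. S \<subseteq> {1..q} \<and> card S = k}" using S \<tau>_in by (auto simp: card_image[OF inj])
  show "(\<Prod>j\<in>\<tau> ` S. f j) = (\<Prod>j\<in>S. f (\<tau> j))" by (simp add: prod.reindex[OF inj])
qed (simp_all add: image_image, use \<tau>_in in \<open>auto simp: card_image[OF inj_on_inverseI[of _ \<tau>]]\<close>)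

lemma killed_gen: "killed (ms (gen k))"
proof -
  have "ms (gen k) = esym q k (\<lambda>j. ms (var j)) - esym q k (\<lambda>j. fpsub gb (ms (var j)))"
    unfolding gen_def by (simp only: ms_diff ms_esym ms_fpsub[OF ordge_var])
  also have "\<dots> = esym q k y - esym q k (\<lambda>j. fpsub gb (y j))"
    by (intro arg_cong2[of _ _ _ _ minus] esym_cong) (simp_all add: ms_var)
  also have "\<dots> = esym q k (\<lambda>j. y (\<tau> j)) - esym q k (\<lambda>j. fpsub gb (y j))"
    by (simp only: esym_reindex)
  finally have eq: "ms (gen k) = esym q k (\<lambda>j. y (\<tau> j)) - esym q k (\<lambda>j. fpsub gb (y j))" .
  have "killed (esym q k (\<lambda>j. fpsub gb (y j)) - esym q k (\<lambda>j. y (\<tau> j)))"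
    unfolding esym_def sum_subtractf[symmetric]
  proof (rule killed_sum)
    fix S assume "S \<in> {S. S \<subseteq> {1..q} \<and> card S = k}"
    then have S: "finite S" "S \<subseteq> {1..q}" using finite_subset by auto
    show "killed ((\<Prod>j\<in>S. fpsub gb (y j)) - (\<Prod>j\<in>S. y (\<tau> j)))"
      by (rule killed_prod_diff[OF S(1)]) (use S(2) in \<open>auto intro!: killed_y\<close>)
  qed
  from killed_diff[OF killed_0 this] show ?thesis unfolding eq by simp
qed

text \<open>The leading monomial in the image of the monomial \<open>A\<close>: both variables of a
  pair become the one with the smaller index.\<close>

definition push :: "monom \<Rightarrow> monom" where
  "push A = (\<Sum>i\<in>{1..q}. single (min i (\<tau> i)) (lookup A i))"

lemma total_degree_push: "keys A \<subseteq> {1..q} \<Longrightarrow> total_degree (push A) = total_degree A"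
  by (simp add: push_def total_degree_superset[of "{1..q}" A])

lemma lookup_push:
  assumes i: "i \<in> {1..q}" "i \<le> \<tau> i"
  shows "lookup (push A) i = lookup A i + (if \<tau> i = i then 0 else lookup A (\<tau> i))"
proof -
  have min: "min j (\<tau> j) = i \<longleftrightarrow> j = i \<or> j = \<tau> i" for j
  proof
    assume "min j (\<tau> j) = i"
    then have "j = i \<or> \<tau> j = i" by (auto simp: min_def split: if_splits)
    then show "j = i \<or> j = \<tau> i" using \<tau>_\<tau>[of j] by metis
  next
    assume "j = i \<or> j = \<tau> i"
    then show "min j (\<tau> j) = i" using i(2) by (auto simp: min_def)
  qed
  have "lookup (push A) i = (\<Sum>j\<in>{1..q}. if j = i \<or> j = \<tau> i then lookup A j else 0)"
    unfolding push_def lookup_sum by (rule sum.cong) (simp_all add: lookup_single when_def min)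
  also have "\<dots> = (\<Sum>j\<in>{i, \<tau> i}. lookup A j)"
    by (rule sum.mono_neutral_cong_right) (use i \<tau>_in in auto)
  also have "\<dots> = lookup A i + (if \<tau> i = i then 0 else lookup A (\<tau> i))" by auto
  finally show ?thesis .
qed

lemma push_map_key: "push (map_key \<tau> A) = push A"
proof -
  have "(\<Sum>i\<in>{1..q}. single (min i (\<tau> i)) (lookup A (\<tau> i))) = (\<Sum>i\<in>{1..q}. single (min i (\<tau> i)) (lookup A i))"
    by (rule sum.reindex_bij_witness[of _ \<tau> \<tau>]) (use \<tau>_in in \<open>simp_all add: min.commute\<close>)
  then show ?thesis by (simp add: push_def lookup_map_key[OF permutes_\<tau>])
qed

text \<open>Conjugation is the identity to first order over Z/2, so \<open>y i\<close> and the
  variable with index \<open>min i (\<tau> i)\<close> have the same leading form.\<close>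

lemma cf_evm_y:
  assumes "keys A \<subseteq> {1..q}" "total_degree M = total_degree A"
  shows "cf (evm y A) M = (if M = push A then 1 else 0)"
proof -
  have y: "ordge (Suc 1) (y i - var (min i (\<tau> i)))" for i
  proof (cases "i \<le> \<tau> i")
    case False
    have "ordge (Suc 1) (fpsub gb (var j) - var j)" for j
    proof -
      have "ordge (Suc 1) (fpsub gb (var j) - (var j + xm (single j Q)) + xm (single j Q))"
        by (intro ordge_add ordge_mono[OF fpsub_gb_var_low]) (use Q_ge_2 n_ge_1 in simp_all)
      then show ?thesis by simp
    qed
    then show ?thesis using False by (simp add: y_def min_def)
  qed (simp add: y_def min_def)
  have "ordge (Suc (\<Sum>i\<in>{1..q}. 1 * lookup A i))
      ((\<Prod>i\<in>{1..q}. y i ^ lookup A i) - (\<Prod>i\<in>{1..q}. var (min i (\<tau> i)) ^ lookup A i))"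
  proof (rule ordge_prod_diff)
    fix i assume i: "i \<in> {1..q}"
    show "ordge (1 * lookup A i) (y i ^ lookup A i)"
      by (rule ordge_power[OF ordge_y[OF i]])
    show "ordge (Suc (1 * lookup A i)) (y i ^ lookup A i - var (min i (\<tau> i)) ^ lookup A i)"
      by (rule ordge_power_diff[OF ordge_y[OF i] y])
  qed simp
  moreover have "(\<Prod>i\<in>{1..q}. var (min i (\<tau> i)) ^ lookup A i) = (xm (push A) :: bit ps)"
    by (simp add: push_def xm_sum var_power)
  moreover have "(\<Prod>i\<in>{1..q}. y i ^ lookup A i) = evm y A"
    by (rule evm_superset[OF _ assms(1), symmetric]) simp
  moreover have "(\<Sum>i\<in>{1..q}. 1 * lookup A i) = total_degree A"
    using total_degree_superset[OF _ assms(1)] by simp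
  ultimately have "ordge (Suc (total_degree A)) (evm y A - xm (push A))" by simp
  then have "cf (evm y A) M = cf (xm (push A)) M"
    using assms(2) by (simp add: ordge_diff_iff)
  then show ?thesis by simp
qed

text \<open>As f has order at least |M|, the coefficient is the sum of those of f over all A of
  degree |M| with the same image under \<open>push\<close> as M. These A are permuted by \<tau> and
  f is invariant, so over Z/2 only the A fixed by \<tau> count; M is the only one.\<close>

lemma cf_ms_push:
  assumes M: "keys M \<subseteq> {1..q}" "\<And>i. i \<in> {1..q} \<Longrightarrow> lookup M (\<tau> i) = lookup M i"
    and f: "symq f" "ordge (total_degree M) f"
  shows "cf (ms f) (push M) = cf f M"
proof -
  let ?d = "total_degree M" and ?T = "push M"
  let ?S = "{A \<in> below ?d. push A = ?T}"
  have d: "total_degree ?T = ?d" by (rule total_degree_push[OF M(1)])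
  have "cf (ms f) ?T = (\<Sum>A\<in>below ?d. cf f A * cf (evm y A) ?T)"
    by (rule cf_msubst) (simp add: d)
  also have "\<dots> = (\<Sum>A\<in>below ?d. if push A = ?T then cf f A else 0)"
  proof (rule sum.cong[OF refl])
    fix A assume "A \<in> below ?d"
    then have A: "keys A \<subseteq> {1..q}" "total_degree A \<le> ?d" by simp_all
    show "cf f A * cf (evm y A) ?T = (if push A = ?T then cf f A else 0)"
    proof (cases "total_degree A = ?d")
      case True
      then show ?thesis using cf_evm_y[OF A(1), of ?T] d by auto
    next
      case False
      then have "cf f A = 0" using A(2) by (intro ordgeD[OF f(2)]) simp
      then show ?thesis by simp
    qed
  qed
  also have "\<dots> = sum (cf f) ?S"
    by (rule sum.inter_filter[symmetric]) simp
  also have "\<dots> = sum (cf f) {A \<in> ?S. map_key \<tau> A = A}"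
  proof (rule sum_bit_involution)
    have inv: "inv_into UNIV \<tau> = \<tau>" by (rule inv_unique_comp) (simp_all add: fun_eq_iff)
    fix A assume A: "A \<in> ?S"
    show "map_key \<tau> A \<in> ?S"
      using A by (simp add: push_map_key total_degree_map_key[OF permutes_\<tau>] keys_map_key_subset[OF permutes_\<tau>])
    show "map_key \<tau> (map_key \<tau> A) = A"
      using map_key_inv(1)[OF permutes_\<tau>, of A] inv by simp
    show "cf f (map_key \<tau> A) = cf f A" by (rule symq_cf_map_key[OF f(1) permutes_\<tau>])
  qed (rule finite_subset[OF _ finite_below[of ?d]], blast)
  also have "{A \<in> ?S. map_key \<tau> A = A} = {M}"
  proof (rule equalityI; rule subsetI)
    fix A assume "A \<in> {A \<in> ?S. map_key \<tau> A = A}"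
    then have A: "keys A \<subseteq> {1..q}" "push A = ?T" "map_key \<tau> A = A" by simp_all
    have A\<tau>: "lookup A (\<tau> i) = lookup A i" for i
      using arg_cong[OF A(3), of "\<lambda>A. lookup A i"] lookup_map_key[OF permutes_\<tau>, of A i] by simp
    \<comment> \<open>Within a pair the pushed exponent is twice the common exponent and so
      determines it.\<close>
    have le: "lookup A i = lookup M i" if i: "i \<in> {1..q}" "i \<le> \<tau> i" for i
      using lookup_push[OF i, of A] lookup_push[OF i, of M] A(2) A\<tau>[of i] M(2)[OF i(1)]
      by (simp split: if_splits)
    have "A = M"
    proof (rule poly_mapping_eqI)
      fix i
      show "lookup A i = lookup M i"
      proof (cases "i \<in> {1..q}")
        case True
        then show ?thesis
          using le[OF True] le[OF \<tau>_in[OF True]] A\<tau>[of i] M(2)[OF True] by (cases "i \<le> \<tau> i") simp_all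
      next
        case False
        then have "i \<notin> keys A" "i \<notin> keys M" using A(1) M(1) by blast+
        then show ?thesis by (simp add: in_keys_iff)
      qed
    qed
    then show "A \<in> {M}" by simp
  next
    fix A assume "A \<in> {M}"
    moreover have "map_key \<tau> M = M"
    proof (rule poly_mapping_eqI)
      fix i
      show "lookup (map_key \<tau> M) i = lookup M i"
        using M(2)[of i] \<tau>_out[of i] by (cases "i \<in> {1..q}") (simp_all add: lookup_map_key[OF permutes_\<tau>])
    qed
    ultimately show "A \<in> {A \<in> ?S. map_key \<tau> A = A}" using M(1) by simp
  qed
  finally show ?thesis by simp
qed

end

section \<open>Independence modulo the ideal\<close>

context morava_sym
begin

lemma pairing_exists:
  assumes "\<not> bad (expo M)"
  shows "\<exists>\<tau>. pairing n q \<tau> \<and> (\<forall>i\<in>{1..q}. lookup M (\<tau> i) = lookup M i \<and> (\<tau> i = i \<longrightarrow> lookup M i < Q))"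
proof -
  have "even (card {i \<in> {1..q}. lookup M i = c})" if c: "c \<ge> Q" for c
  proof -
    have "even (count (expo M) c)" using assms c by (auto simp: bad_def)
    moreover have "(of_nat (count (expo M) c) :: int) = of_nat (card {i \<in> {1..q}. lookup M i = c})"
      unfolding count_expo by (simp flip: sum.inter_filter)
    ultimately show ?thesis by simp
  qed
  then obtain t where t: "\<forall>i\<in>{1..q}. t i \<in> {1..q} \<and> t (t i) = i \<and> lookup M (t i) = lookup M i \<and> (t i = i \<longrightarrow> lookup M i < Q)"
    using even_fibres_involution[of "{1..q}" Q "lookup M"] by auto
  define \<tau> where "\<tau> i = (if i \<in> {1..q} then t i else i)" for i
  have "pairing n q \<tau>"
  proof
    show "\<tau> i \<in> {1..q}" if "i \<in> {1..q}" for i using t that by (simp add: \<tau>_def)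
    show "\<tau> i = i" if "i \<notin> {1..q}" for i unfolding \<tau>_def using that by (rule if_not_P)
    show "\<tau> (\<tau> i) = i" for i
    proof (cases "i \<in> {1..q}")
      case True
      then have "t i \<in> {1..q}" "t (t i) = i" using t by blast+
      then show ?thesis using True by (simp only: \<tau>_def if_True)
    next
      case False
      then show ?thesis by (simp only: \<tau>_def if_False)
    qed
  qed
  moreover have "\<forall>i\<in>{1..q}. lookup M (\<tau> i) = lookup M i \<and> (\<tau> i = i \<longrightarrow> lookup M i < Q)"
    using t by (simp add: \<tau>_def)
  ultimately show ?thesis by blast
qed

text \<open>Induction on the order of b. A monomial M in the leading form of b is not bad, so a
  pairing exists; \<open>push M\<close> has exponents below Q at the fixed variables and hence does
  not occur in the images of the generators. The term v is the error up to which the quotient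
  topology compares elements.\<close>

theorem independence:
  assumes b: "symq b" "\<And>M. cf b M \<noteq> 0 \<Longrightarrow> \<not> bad (expo M)"
    and eq: "b = (\<Sum>k\<in>{1..q}. h k * gen k) + v" and v: "ordge N v"
  shows "ordge N b"
proof -
  have "ordge d b" if "d \<le> N" for d
    using that
  proof (induction d)
    case (Suc d)
    then have bd: "ordge d b" "d < N" by simp_all
    show ?case
      unfolding ordge_def
    proof (intro allI impI)
      fix M :: monom assume M: "total_degree M < Suc d"
      show "cf b M = 0"
      proof (rule ccontr)
        assume nz: "cf b M \<noteq> 0"
        then have d: "total_degree M = d" using M bd(1) by (metis ordgeD less_SucE)
        have keys: "keys M \<subseteq> {1..q}" using nz suppD[OF symq_supp[OF b(1)]] by blast
        obtain \<tau> where \<tau>: "pairing n q \<tau>" "\<And>i. i \<in> {1..q} \<Longrightarrow> lookup M (\<tau> i) = lookup M i"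
          "\<And>i. i \<in> {1..q} \<Longrightarrow> \<tau> i = i \<Longrightarrow> lookup M i < Q"
          using pairing_exists[OF b(2)[OF nz]] by blast
        interpret pairing n q \<tau> by (rule \<tau>(1))
        have "cf b M = cf (ms b) (push M)"
          by (rule cf_ms_push[symmetric]) (use keys \<tau> b(1) bd d in simp_all)
        also have "\<dots> = cf (\<Sum>k\<in>{1..q}. ms (h k) * ms (gen k)) (push M) + cf (ms v) (push M)"
          by (subst eq) (simp only: ms_add ms_sum ms_mult cf_basic)
        also have "cf (ms v) (push M) = 0"
          by (rule ordgeD[OF ordge_ms[OF v]]) (simp add: total_degree_push[OF keys] d bd(2))
        also have "cf (\<Sum>k\<in>{1..q}. ms (h k) * ms (gen k)) (push M) = 0"
        proof -
          have "killed (\<Sum>k\<in>{1..q}. ms (h k) * ms (gen k))"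
            by (intro killed_sum killed_mult killed_gen)
          moreover have "\<forall>i\<in>{1..q}. \<tau> i = i \<longrightarrow> lookup (push M) i < Q"
            using \<tau>(3) by (simp add: lookup_push)
          ultimately show ?thesis unfolding killed_def by blast
        qed
        finally show False using nz by simp
      qed
    qed
  qed simp
  then show ?thesis by simp
qed

section \<open>The ring of symmetric power series and its ideal\<close>

abbreviation "R \<equiv> K_BU n q"

lemma R_simps:
  "f \<otimes>\<^bsub>R\<^esub> g = cf (Ps f * Ps g)" "f \<oplus>\<^bsub>R\<^esub> g = cf (Ps f + Ps g)" "\<one>\<^bsub>R\<^esub> = cf 1" "\<zero>\<^bsub>R\<^esub> = cf 0"
  by (simp_all add: K_BU_def)

lemma carrier_R: "f \<in> carrier R \<longleftrightarrow> symq (Ps f) \<and> finite (degrees n f)"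
proof -
  have "symq (Ps f) \<longleftrightarrow> (\<forall>M. f M \<noteq> 0 \<longrightarrow> keys M \<subseteq> {1..q}) \<and>
      (\<forall>\<sigma> M. \<sigma> permutes {1..q} \<longrightarrow> f (map_key \<sigma> M) = f M)"
  proof
    assume s: "symq (Ps f)"
    show "(\<forall>M. f M \<noteq> 0 \<longrightarrow> keys M \<subseteq> {1..q}) \<and>
        (\<forall>\<sigma> M. \<sigma> permutes {1..q} \<longrightarrow> f (map_key \<sigma> M) = f M)"
      using symq_supp[OF s] symq_cf_map_key[OF s] unfolding supp_def cf_Ps by blast
  next
    assume "(\<forall>M. f M \<noteq> 0 \<longrightarrow> keys M \<subseteq> {1..q}) \<and>
        (\<forall>\<sigma> M. \<sigma> permutes {1..q} \<longrightarrow> f (map_key \<sigma> M) = f M)"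
    then show "symq (Ps f)" by (intro symqI) (simp_all add: supp_def)
  qed
  then show ?thesis unfolding K_BU_def by simp
qed

lemma degrees_iff: "d \<in> degrees n (cf f) \<longleftrightarrow>
    (\<exists>M k. k \<in> keys (cf f M) \<and> d = 2 * int (total_degree M) - 2 * (2 ^ n - 1) * k)"
  unfolding degrees_def by blast

lemma degrees_add: "degrees n (cf (f + g)) \<subseteq> degrees n (cf f) \<union> degrees n (cf g)"
proof
  fix d assume "d \<in> degrees n (cf (f + g))"
  then obtain M k where k: "k \<in> keys (cf f M + cf g M)" "d = 2 * int (total_degree M) - 2 * (2 ^ n - 1) * k"
    by (auto simp: degrees_iff)
  have "k \<in> keys (cf f M) \<union> keys (cf g M)" by (rule subsetD[OF Poly_Mapping.keys_add k(1)])
  then show "d \<in> degrees n (cf f) \<union> degrees n (cf g)"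
    unfolding Un_iff degrees_iff using k(2) by (elim disjE) blast+
qed

lemma degrees_uminus: "degrees n (cf (- f)) = degrees n (cf f)"
  by (simp add: degrees_def)

lemma degrees_mult: "degrees n (cf (f * g)) \<subseteq> (\<lambda>(a, b). a + b) ` (degrees n (cf f) \<times> degrees n (cf g))"
proof
  fix d assume "d \<in> degrees n (cf (f * g))"
  then obtain M k where k: "k \<in> keys (\<Sum>(A, B)\<in>splits M. cf f A * cf g B)" "d = 2 * int (total_degree M) - 2 * (2 ^ n - 1) * k"
    unfolding degrees_iff cf_mult by blast
  from k(1) keys_sum[of "\<lambda>(A, B). cf f A * cf g B" "splits M"]
  obtain p where p: "p \<in> splits M" "k \<in> keys (case p of (A, B) \<Rightarrow> cf f A * cf g B)" by blast
  obtain A B where AB: "p = (A, B)" "A + B = M" using p(1) by (auto simp: splits_def)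
  have "k \<in> keys (cf f A * cf g B)" using p(2) AB(1) by simp
  with keys_mult[of "cf f A" "cf g B"] obtain a b where ab: "k = a + b" "a \<in> keys (cf f A)" "b \<in> keys (cf g B)" by blast
  let ?a = "2 * int (total_degree A) - 2 * (2 ^ n - 1) * a" and ?b = "2 * int (total_degree B) - 2 * (2 ^ n - 1) * b"
  have "?a \<in> degrees n (cf f)" "?b \<in> degrees n (cf g)" unfolding degrees_iff using ab by blast+
  moreover have "d = ?a + ?b" using k(2) AB(2) ab(1) by (auto simp: algebra_simps)
  ultimately show "d \<in> (\<lambda>(a, b). a + b) ` (degrees n (cf f) \<times> degrees n (cf g))"
    by (intro image_eqI[of _ _ "(?a, ?b)"]) simp_all
qed

lemma degrees_cst: "finite (degrees n (cf (cst a)))"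
proof -
  have "degrees n (cf (cst a)) \<subseteq> (\<lambda>k. - (2 * (2 ^ n - 1) * k)) ` keys a"
    by (auto simp: degrees_iff cf_cst split: if_splits)
  then show ?thesis by (rule finite_subset) simp
qed

lemma carrier_cf: "cf f \<in> carrier R \<longleftrightarrow> symq f \<and> finite (degrees n (cf f))"
  by (simp add: carrier_R)

lemma carrier_add: "cf f \<in> carrier R \<Longrightarrow> cf g \<in> carrier R \<Longrightarrow> cf (f + g) \<in> carrier R"
  unfolding carrier_cf using finite_subset[OF degrees_add[of f g]] by (simp add: symq_add)

lemma carrier_uminus: "cf f \<in> carrier R \<Longrightarrow> cf (- f) \<in> carrier R"
  unfolding carrier_cf degrees_uminus using symq_diff[OF symq_0, of f] by simp

lemma carrier_mult: "cf f \<in> carrier R \<Longrightarrow> cf g \<in> carrier R \<Longrightarrow> cf (f * g) \<in> carrier R"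
  unfolding carrier_cf using finite_subset[OF degrees_mult[of f g]] by (simp add: symq_mult)

lemma carrier_cst: "cf (cst a) \<in> carrier R"
  unfolding carrier_cf using degrees_cst symq_cst by blast

lemma carrier_0: "cf 0 \<in> carrier R" and carrier_1: "cf 1 \<in> carrier R"
  using carrier_cst[of 0] carrier_cst[of 1] by simp_all

lemma carrier_diff: "cf f \<in> carrier R \<Longrightarrow> cf g \<in> carrier R \<Longrightarrow> cf (f - g) \<in> carrier R"
  using carrier_add[of f "- g"] carrier_uminus[of g] by simp

lemma carrier_sum: "(\<And>i. i \<in> S \<Longrightarrow> cf (f i) \<in> carrier R) \<Longrightarrow> cf (sum f S) \<in> carrier R"
  by (induction S rule: infinite_finite_induct) (simp_all only: sum.infinite sum.empty sum.insert carrier_0 carrier_add insert_iff simp_thms)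

lemma cring_R: "cring R"
proof (rule cringI)
  have cl: "cf (Ps f) \<in> carrier R" if "f \<in> carrier R" for f using that by simp
  show "abelian_group R"
  proof (rule abelian_groupI)
    fix f g h assume f: "f \<in> carrier R" "g \<in> carrier R" "h \<in> carrier R"
    show "f \<oplus>\<^bsub>R\<^esub> g \<in> carrier R" unfolding R_simps by (intro carrier_add cl f)
    show "(f \<oplus>\<^bsub>R\<^esub> g) \<oplus>\<^bsub>R\<^esub> h = f \<oplus>\<^bsub>R\<^esub> (g \<oplus>\<^bsub>R\<^esub> h)" unfolding R_simps by (simp add: add.assoc)
    show "f \<oplus>\<^bsub>R\<^esub> g = g \<oplus>\<^bsub>R\<^esub> f" unfolding R_simps by (simp add: add.commute)
    show "\<zero>\<^bsub>R\<^esub> \<oplus>\<^bsub>R\<^esub> f = f" unfolding R_simps by simp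
    show "\<exists>g\<in>carrier R. g \<oplus>\<^bsub>R\<^esub> f = \<zero>\<^bsub>R\<^esub>"
      by (rule bexI[of _ "cf (- Ps f)"]) (simp add: R_simps, intro carrier_uminus cl f)
  next
    show "\<zero>\<^bsub>R\<^esub> \<in> carrier R" unfolding R_simps by (rule carrier_0)
  qed
  show "Group.comm_monoid R"
  proof (rule comm_monoidI)
    fix f g h assume f: "f \<in> carrier R" "g \<in> carrier R" "h \<in> carrier R"
    show "f \<otimes>\<^bsub>R\<^esub> g \<in> carrier R" unfolding R_simps by (intro carrier_mult cl f)
    show "(f \<otimes>\<^bsub>R\<^esub> g) \<otimes>\<^bsub>R\<^esub> h = f \<otimes>\<^bsub>R\<^esub> (g \<otimes>\<^bsub>R\<^esub> h)" unfolding R_simps by (simp add: mult.assoc)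
    show "f \<otimes>\<^bsub>R\<^esub> g = g \<otimes>\<^bsub>R\<^esub> f" unfolding R_simps by (simp add: mult.commute)
    show "\<one>\<^bsub>R\<^esub> \<otimes>\<^bsub>R\<^esub> f = f" unfolding R_simps by simp
  next
    show "\<one>\<^bsub>R\<^esub> \<in> carrier R" unfolding R_simps by (rule carrier_1)
  qed
  fix f g h
  show "(f \<oplus>\<^bsub>R\<^esub> g) \<otimes>\<^bsub>R\<^esub> h = f \<otimes>\<^bsub>R\<^esub> h \<oplus>\<^bsub>R\<^esub> g \<otimes>\<^bsub>R\<^esub> h" unfolding R_simps by (simp add: distrib_right)
qed

sublocale R: cring R by (rule cring_R)

lemma R_uminus: "f \<in> carrier R \<Longrightarrow> \<ominus>\<^bsub>R\<^esub> f = cf (- Ps f)"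
proof (rule R.minus_equality)
  show "cf (- Ps f) \<oplus>\<^bsub>R\<^esub> f = \<zero>\<^bsub>R\<^esub>" unfolding R_simps by simp
  assume "f \<in> carrier R"
  then show "f \<in> carrier R" "cf (- Ps f) \<in> carrier R" using carrier_uminus[of "Ps f"] by simp_all
qed

lemma R_diff: "g \<in> carrier R \<Longrightarrow> f \<ominus>\<^bsub>R\<^esub> g = cf (Ps f - Ps g)"
  unfolding a_minus_def R_uminus R_simps by (simp only: Ps_cf diff_conv_add_uminus)

definition genK :: "nat \<Rightarrow> K_coeff ps" where
  "genK k = esym q k var - esym q k (\<lambda>j. fpsub iK (var j))"

lemma chern_eq: "chern q k = cf (esym q k var)"
  unfolding chern_def elem_sym_eq by (simp only: var_def[abs_def])

lemma chern_conj_eq: "chern_conj n q k = cf (esym q k (\<lambda>j. fpsub iK (var j)))"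
  unfolding chern_conj_def elem_sym_eq by (simp only: fps_subst_eq Ps_cf var_def iK_def)

lemma homog_degrees: "homog n e f \<Longrightarrow> degrees n (cf f) \<subseteq> {2 * e}"
proof
  fix d assume h: "homog n e f" "d \<in> degrees n (cf f)"
  then obtain M k where k: "k \<in> keys (cf f M)" "d = 2 * int (total_degree M) - 2 * (2 ^ n - 1) * k"
    by (auto simp: degrees_iff)
  from homogD[OF h(1) k(1)] k(2) show "d \<in> {2 * e}" by (simp add: algebra_simps)
qed

lemma degrees_homog: "degrees n (cf f) \<subseteq> {2 * e} \<Longrightarrow> homog n e f"
  unfolding homog_def
proof (intro allI impI)
  fix M k assume d: "degrees n (cf f) \<subseteq> {2 * e}" and k: "k \<in> keys (cf f M)"
  then have "2 * int (total_degree M) - 2 * (2 ^ n - 1) * k \<in> degrees n (cf f)" unfolding degrees_iff by blast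
  then have "2 * int (total_degree M) - 2 * (2 ^ n - 1) * k = 2 * e" using d by blast
  then show "int (total_degree M) - (2 ^ n - 1) * k = e" by (simp add: algebra_simps)
qed

lemma homog_carrier: "homog n e f \<Longrightarrow> symq f \<Longrightarrow> cf f \<in> carrier R"
  unfolding carrier_cf using finite_subset[OF homog_degrees] by blast

lemma homog_esym:
  assumes "\<And>j. homog n 1 (f j)"
  shows "homog n (int k) (esym q k f)"
  unfolding esym_def
proof (rule homog_sum)
  fix S assume "S \<in> {S. S \<subseteq> {1..q} \<and> card S = k}"
  then show "homog n (int k) (prod f S)"
    using homog_prod[of S n "\<lambda>_. 1" f] assms by simp
qed

lemma esym_var: "esym q k var = (esym q k (\<lambda>j. fpsub fps_X (var j)) :: 'a::comm_ring_1 ps)"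
  by (simp add: fpsub_X)

lemma homog_gens: "homog n (int k) (esym q k var)" "homog n (int k) (esym q k (\<lambda>j. fpsub iK (var j)))"
  by (intro homog_esym homog_var homog_iK)+

lemma homog_genK: "homog n (int k) (genK k)"
  unfolding genK_def by (intro homog_diff homog_gens)

lemma carrier_gens: "cf (esym q k var) \<in> carrier R" "cf (esym q k (\<lambda>j. fpsub iK (var j))) \<in> carrier R"
proof -
  show "cf (esym q k var) \<in> carrier R"
    by (rule homog_carrier[OF homog_gens(1)]) (simp only: esym_var symq_esym)
  show "cf (esym q k (\<lambda>j. fpsub iK (var j))) \<in> carrier R"
    by (rule homog_carrier[OF homog_gens(2) symq_esym])
qed

lemma carrier_genK: "cf (genK k) \<in> carrier R"
  unfolding genK_def by (intro carrier_diff carrier_gens)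

lemma gens_eq: "(\<lambda>k. chern q k \<ominus>\<^bsub>R\<^esub> chern_conj n q k) ` {1..q} = (\<lambda>k. cf (genK k)) ` {1..q}"
  unfolding chern_eq chern_conj_eq genK_def by (simp add: R_diff carrier_gens)

interpretation augb: subring_hom UNIV "aug :: K_coeff \<Rightarrow> bit" by (rule subring_hom_aug)

lemma aug_prod: "map_ps aug (prod f S) = (\<Prod>i\<in>S. map_ps aug (f i :: K_coeff ps))"
  by (induction S rule: infinite_finite_induct) (simp_all add: augb.map_ps_1 augb.map_ps_mult)

lemma aug_genK: "map_ps aug (genK k) = gen k"
  unfolding genK_def gen_def esym_def
  by (simp add: augb.map_ps_diff augb.map_ps_sum aug_prod augb.map_ps_var aug_fpsub_iK)

abbreviation "I \<equiv> conj_ideal n q"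

lemma gens_subset: "(\<lambda>k. cf (genK k)) ` {1..q} \<subseteq> carrier R"
  using carrier_genK by blast

lemma ideal_I: "ideal I R"
  unfolding conj_ideal_def gens_eq by (rule R.genideal_ideal[OF gens_subset])

sublocale I: ideal I R by (rule ideal_I)

lemma genK_in_I: "k \<in> {1..q} \<Longrightarrow> cf (genK k) \<in> I"
  unfolding conj_ideal_def gens_eq using R.genideal_self[OF gens_subset] by blast

lemma sum_genK_in_I:
  assumes "\<And>k. k \<in> {1..q} \<Longrightarrow> cf (h k) \<in> carrier R"
  shows "cf (\<Sum>k\<in>{1..q}. h k * genK k) \<in> I"
proof -
  have "cf (\<Sum>k\<in>S. h k * genK k) \<in> I" if "finite S" "S \<subseteq> {1..q}" for S
    using that
  proof (induction S rule: finite_induct)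
    case empty
    show ?case using I.zero_closed by (simp only: R_simps sum.empty)
  next
    case (insert k S)
    have "cf (h k) \<otimes>\<^bsub>R\<^esub> cf (genK k) \<in> I"
      by (rule I.I_l_closed[OF genK_in_I assms]) (use insert.prems in simp_all)
    then have "cf (h k) \<otimes>\<^bsub>R\<^esub> cf (genK k) \<oplus>\<^bsub>R\<^esub> cf (\<Sum>k\<in>S. h k * genK k) \<in> I"
      by (rule I.a_closed) (rule insert.IH, use insert.prems in simp)
    then show ?case by (simp only: R_simps Ps_cf sum.insert[OF insert.hyps])
  qed
  then show ?thesis by simp
qed

text \<open>The elements of the ring with this property form an ideal containing the generators, and
  \<open>conj_ideal\<close> is the smallest such ideal.\<close>

lemma I_gen:
  assumes "f \<in> I"
  shows "\<exists>h. map_ps aug (Ps f) = (\<Sum>k\<in>{1..q}. h k * gen k)"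
proof -
  let ?Z = "{f \<in> carrier R. \<exists>h. map_ps aug (Ps f) = (\<Sum>k\<in>{1..q}. h k * gen k)}"
  have ZI: "f \<in> ?Z" if "f \<in> carrier R" "map_ps aug (Ps f) = (\<Sum>k\<in>{1..q}. h k * gen k)" for f h
    using that by blast
  have mult: "f \<otimes>\<^bsub>R\<^esub> g \<in> ?Z" if fg: "f \<in> carrier R" "g \<in> ?Z" for f g
  proof -
    obtain h where h: "map_ps aug (Ps g) = (\<Sum>k\<in>{1..q}. h k * gen k)" using fg by blast
    show ?thesis
    proof (rule ZI)
      show "f \<otimes>\<^bsub>R\<^esub> g \<in> carrier R" using fg by simp
      show "map_ps aug (Ps (f \<otimes>\<^bsub>R\<^esub> g)) = (\<Sum>k\<in>{1..q}. (map_ps aug (Ps f) * h k) * gen k)"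
        unfolding R_simps by (simp add: augb.map_ps_mult h sum_distrib_left mult.assoc)
    qed
  qed
  have "ideal ?Z R"
  proof (rule idealI)
    show "ring R" by (rule R.ring_axioms)
    show "subgroup ?Z (add_monoid R)"
    proof
      show "?Z \<subseteq> carrier (add_monoid R)" by auto
      show "\<one>\<^bsub>add_monoid R\<^esub> \<in> ?Z"
      proof -
        have "\<zero>\<^bsub>R\<^esub> \<in> ?Z"
          by (rule ZI[of _ "\<lambda>_. 0"]) (simp_all add: R_simps augb.map_ps_0 carrier_0)
        then show ?thesis by simp
      qed
      fix f assume f: "f \<in> ?Z"
      then obtain h where h: "map_ps aug (Ps f) = (\<Sum>k\<in>{1..q}. h k * gen k)" by blast
      have fc: "f \<in> carrier R" using f by blast
      have neg: "map_ps aug (- g) = - map_ps aug g" for g :: "K_coeff ps"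
        using augb.map_ps_diff[of 0 g] by (simp add: augb.map_ps_0)
      have "\<ominus>\<^bsub>R\<^esub> f \<in> ?Z"
      proof (rule ZI)
        show "\<ominus>\<^bsub>R\<^esub> f \<in> carrier R" using fc by simp
        show "map_ps aug (Ps (\<ominus>\<^bsub>R\<^esub> f)) = (\<Sum>k\<in>{1..q}. (- h k) * gen k)"
          unfolding R_uminus[OF fc] by (simp add: neg h sum_negf)
      qed
      then show "inv\<^bsub>add_monoid R\<^esub> f \<in> ?Z" by (simp add: a_inv_def)
      fix g assume g: "g \<in> ?Z"
      then obtain h' where h': "map_ps aug (Ps g) = (\<Sum>k\<in>{1..q}. h' k * gen k)" by blast
      have "f \<oplus>\<^bsub>R\<^esub> g \<in> ?Z"
      proof (rule ZI)
        show "f \<oplus>\<^bsub>R\<^esub> g \<in> carrier R" using f g by simp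
        show "map_ps aug (Ps (f \<oplus>\<^bsub>R\<^esub> g)) = (\<Sum>k\<in>{1..q}. (h k + h' k) * gen k)"
          unfolding R_simps by (simp add: augb.map_ps_add h h' distrib_right sum.distrib)
      qed
      then show "f \<otimes>\<^bsub>add_monoid R\<^esub> g \<in> ?Z" by simp
    qed
    fix a x assume ax: "a \<in> ?Z" "x \<in> carrier R"
    show "x \<otimes>\<^bsub>R\<^esub> a \<in> ?Z" by (rule mult[OF ax(2,1)])
    then show "a \<otimes>\<^bsub>R\<^esub> x \<in> ?Z" using ax R.m_comm[of a x] by simp
  qed
  moreover have "(\<lambda>k. cf (genK k)) ` {1..q} \<subseteq> ?Z"
  proof (rule image_subsetI)
    fix k assume k: "k \<in> {1..q}"
    show "cf (genK k) \<in> ?Z"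
    proof (rule ZI)
      have "(\<Sum>j\<in>{1..q}. (if j = k then 1 else 0) * gen j) = (\<Sum>j\<in>{1..q}. if j = k then gen k else 0)"
        by (rule sum.cong) simp_all
      then show "map_ps aug (Ps (cf (genK k))) = (\<Sum>j\<in>{1..q}. (if j = k then 1 else 0) * gen j)"
        using k by (simp add: aug_genK sum.delta)
    qed (rule carrier_genK)
  qed
  ultimately have "I \<subseteq> ?Z" unfolding conj_ideal_def gens_eq by (rule R.genideal_minimal)
  with assms show ?thesis by blast
qed

section \<open>Homogeneous lifts\<close>

text \<open>Inverts evaluation at \<open>v\<^sub>n = 1\<close> in degree e by inserting the power of
  \<open>v\<^sub>n\<close> that the degree of each monomial requires. Monomials for which there is
  no such power are dropped.\<close>

definition lift :: "int \<Rightarrow> bit ps \<Rightarrow> K_coeff ps" where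
  "lift e h = Ps (\<lambda>M. if (2 ^ n - 1) dvd (int (total_degree M) - e)
     then single ((int (total_degree M) - e) div (2 ^ n - 1)) (cf h M) else 0)"

lemma cf_lift: "cf (lift e h) M = (if (2 ^ n - 1) dvd (int (total_degree M) - e)
     then single ((int (total_degree M) - e) div (2 ^ n - 1)) (cf h M) else 0)"
  by (simp add: lift_def)

lemma homog_lift: "homog n e (lift e h)"
  unfolding homog_def by (auto simp: cf_lift split: if_splits)

lemma lift_add: "lift e (f + g) = lift e f + lift e g"
  by (rule ps_eqI) (simp add: cf_lift single_add)

lemma lift_0: "lift e 0 = 0"
  by (rule ps_eqI) (simp add: cf_lift)

lemma lift_sum: "lift e (sum f S) = (\<Sum>i\<in>S. lift e (f i))"
  by (induction S rule: infinite_finite_induct) (simp_all add: lift_add lift_0)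

lemma symq_lift: "symq h \<Longrightarrow> symq (lift e h)"
proof (rule symqI)
  assume h: "symq h"
  show "supp (lift e h)" by (rule suppI) (simp add: cf_lift suppD[OF symq_supp[OF h]])
  fix \<sigma> M assume "perm \<sigma>"
  then show "cf (lift e h) (map_key \<sigma> M) = cf (lift e h) M"
    by (simp add: cf_lift total_degree_map_key symq_cf_map_key[OF h])
qed

lemma Q1_nz: "(2::int) ^ n - 1 \<noteq> 0"
proof -
  have "(2::int) ^ n = int Q" by simp
  then show ?thesis using Q_ge_2 by linarith
qed

lemma homog_coeff:
  assumes g: "homog n e g"
  shows "cf g M = (if (2 ^ n - 1) dvd (int (total_degree M) - e)
     then single ((int (total_degree M) - e) div (2 ^ n - 1)) (aug (cf g M)) else 0)"
proof (cases "cf g M = 0")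
  case False
  then have "keys (cf g M) \<noteq> {}" by simp
  then obtain k where k: "k \<in> keys (cf g M)" by blast
  have kd: "int (total_degree M) - e = (2 ^ n - 1) * k" using homogD[OF g k] by simp
  have c: "cf g M = single k (lookup (cf g M) k)" by (rule homog_unique_key[OF n_ge_1 g k])
  then have "aug (cf g M) = lookup (cf g M) k" by (metis aug_single)
  then show ?thesis using c Q1_nz by (simp add: kd)
qed simp

lemma lift_aug: "homog n e g \<Longrightarrow> lift e (map_ps aug g) = g"
  by (rule ps_eqI) (unfold cf_lift cf_map_ps, rule homog_coeff[symmetric])

text \<open>Only monomials of degree congruent to e' modulo 2^n - 1 occur in g, so a product of
  monomials survives in degree e + e' exactly when the factor from h survives in degree e.\<close>

lemma lift_mult:
  assumes g: "homog n e' g"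
  shows "lift (e + e') (h * map_ps aug g) = lift e h * g"
proof (rule ps_eqI)
  fix M
  let ?m = "(2::int) ^ n - 1"
  have "cf (lift e h) A * cf g B = (if ?m dvd (int (total_degree M) - (e + e'))
      then single ((int (total_degree M) - (e + e')) div ?m) (cf h A * aug (cf g B)) else 0)"
    if AB: "A + B = M" for A B
  proof (cases "?m dvd (int (total_degree B) - e')")
    case True
    then obtain b where b: "int (total_degree B) - e' = ?m * b" by blast
    have gB: "cf g B = single b (aug (cf g B))"
      using homog_coeff[OF g, of B] Q1_nz by (simp add: b)
    have M: "int (total_degree M) - (e + e') = (int (total_degree A) - e) + ?m * b"
      using AB b by auto
    show ?thesis
    proof (cases "?m dvd (int (total_degree A) - e)")
      case True
      then obtain a where a: "int (total_degree A) - e = ?m * a" by blast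
      have Ma: "int (total_degree M) - (e + e') = ?m * (a + b)" unfolding M a by (simp add: distrib_left)
      have "cf (lift e h) A = single a (cf h A)" using Q1_nz by (simp add: cf_lift a)
      then have "cf (lift e h) A * cf g B = single (a + b) (cf h A * aug (cf g B))"
        by (subst gB) (simp add: mult_single)
      then show ?thesis unfolding Ma using Q1_nz by simp
    next
      case False
      then have "\<not> ?m dvd (int (total_degree M) - (e + e'))" unfolding M by (simp add: dvd_add_left_iff)
      then show ?thesis using False by (simp add: cf_lift)
    qed
  next
    case False
    then have "cf g B = 0" using homog_coeff[OF g, of B] by simp
    then show ?thesis by simp
  qed
  then have "cf (lift e h * g) M = (\<Sum>p\<in>splits M. if ?m dvd (int (total_degree M) - (e + e'))
      then single ((int (total_degree M) - (e + e')) div ?m) (cf h (fst p) * aug (cf g (snd p))) else 0)"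
    unfolding cf_mult by (intro sum.cong) (auto simp: splits_def)
  also have "\<dots> = (if ?m dvd (int (total_degree M) - (e + e'))
      then single ((int (total_degree M) - (e + e')) div ?m) (\<Sum>p\<in>splits M. cf h (fst p) * aug (cf g (snd p))) else 0)"
  proof -
    have "(\<Sum>p\<in>T. single c (f p)) = single c (sum f T)" for T and c :: int and f :: "monom \<times> monom \<Rightarrow> bit"
      by (induction T rule: infinite_finite_induct) (simp_all add: single_add)
    then show ?thesis by simp
  qed
  also have "\<dots> = cf (lift (e + e') (h * map_ps aug g)) M"
    by (simp add: cf_lift cf_mult case_prod_unfold)
  finally show "cf (lift (e + e') (h * map_ps aug g)) M = cf (lift e h * g) M" by simp
qed

lemma symq_map_aug: "symq f \<Longrightarrow> symq (map_ps aug f)"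
proof (rule symqI)
  assume f: "symq f"
  show "supp (map_ps aug f)" by (rule suppI) (simp add: suppD[OF symq_supp[OF f]])
  fix \<sigma> M assume "perm \<sigma>"
  then show "cf (map_ps aug f) (map_key \<sigma> M) = cf (map_ps aug f) M"
    by (simp add: symq_cf_map_key[OF f])
qed

text \<open>The reduction is performed at \<open>v\<^sub>n = 1\<close> and lifted back. Since
  \<open>gen k\<close> comes from \<open>genK k\<close> of degree k, its coefficient is lifted in
  degree e - k.\<close>

lemma homog_reduction:
  assumes q: "q \<ge> 1" and f: "symq f" "homog n e f"
  shows "\<exists>b. symq b \<and> homog n e b \<and> (\<forall>M. cf b M \<noteq> 0 \<longrightarrow> \<not> bad (expo M)) \<and> cf (f - b) \<in> I"
proof -
  from spanning[OF q symq_map_aug[OF f(1)]] obtain b h where b: "symq b" "\<forall>M. cf b M \<noteq> 0 \<longrightarrow> \<not> bad (expo M)"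
    and h: "\<forall>k. symq (h k)" and eq: "map_ps aug f = b + (\<Sum>k\<in>{1..q}. h k * gen k)" by blast
  have lm: "lift e (h k * gen k) = lift (e - int k) (h k) * genK k" for k
    using lift_mult[OF homog_genK[of k], of "e - int k" "h k"] by (simp add: aug_genK)
  have "f = lift e (map_ps aug f)" by (rule lift_aug[OF f(2), symmetric])
  also have "\<dots> = lift e b + (\<Sum>k\<in>{1..q}. lift (e - int k) (h k) * genK k)"
    unfolding eq by (simp add: lift_add lift_sum lm)
  finally have f_eq: "f - lift e b = (\<Sum>k\<in>{1..q}. lift (e - int k) (h k) * genK k)"
    by (simp only: diff_eq_eq add.commute)
  have "cf (\<Sum>k\<in>{1..q}. lift (e - int k) (h k) * genK k) \<in> I"
    by (rule sum_genK_in_I, rule homog_carrier[OF homog_lift symq_lift]) (use h in blast)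
  then have "cf (f - lift e b) \<in> I" unfolding f_eq .
  moreover have "\<forall>M. cf (lift e b) M \<noteq> 0 \<longrightarrow> \<not> bad (expo M)"
  proof (intro allI impI)
    fix M assume nz: "cf (lift e b) M \<noteq> 0"
    have "cf b M \<noteq> 0"
    proof
      assume "cf b M = 0"
      then show False using nz by (simp add: cf_lift split: if_splits)
    qed
    then show "\<not> bad (expo M)" using b(2) by blast
  qed
  ultimately show ?thesis using homog_lift symq_lift[OF b(1)] by blast
qed

section \<open>The quotient and its topology\<close>

abbreviation "qp \<equiv> quot_proj n q"
abbreviation "KQ \<equiv> K_quot n q"
abbreviation "T \<equiv> K_BU_topology n q"
abbreviation "qsum a A \<equiv> \<Oplus>\<^bsub>KQ\<^esub>s\<in>A. qp (mps_const (a s)) \<otimes>\<^bsub>KQ\<^esub> qp s"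

lemma qp_eq_iff: "f \<in> carrier R \<Longrightarrow> g \<in> carrier R \<Longrightarrow> qp f = qp g \<longleftrightarrow> cf (Ps f - Ps g) \<in> I"
  using R.quotient_eq_iff_same_a_r_cos[OF ideal_I, of f g] by (simp only: R_diff quot_proj_def)

lemma carrier_KQ: "carrier KQ = qp ` carrier R"
  unfolding K_quot_def FactRing_def A_RCOSETS_def' quot_proj_def by auto

lemma qp_hom: "qp \<in> ring_hom R KQ"
proof -
  have "qp = (+>\<^bsub>R\<^esub>) I" by (rule ext) (simp add: quot_proj_def)
  then show ?thesis using I.rcos_ring_hom by (simp add: K_quot_def)
qed

lemma ring_KQ: "ring KQ"
  unfolding K_quot_def by (rule I.quotient_is_ring)

lemma qp_sum:
  assumes "finite A" "A \<subseteq> carrier R"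
  shows "qsum a A = qp (cf (\<Sum>s\<in>A. cst (a s) * Ps s))"
proof -
  interpret KQ: ring KQ by (rule ring_KQ)
  have c: "mps_const x = cf (cst x)" for x :: K_coeff by (simp add: cst_def)
  have term_eq: "qp (mps_const (a s)) \<otimes>\<^bsub>KQ\<^esub> qp s = qp (cf (cst (a s) * Ps s))" if "s \<in> carrier R" for s
    using ring_hom_mult[OF qp_hom carrier_cst that, of "a s"] by (simp only: c R_simps Ps_cf)
  have qc: "qp f \<in> carrier KQ" if "f \<in> carrier R" for f
    using that by (simp add: carrier_KQ)
  have tc: "cf (cst (a s) * Ps s) \<in> carrier R" if "s \<in> carrier R" for s
    by (rule carrier_mult[OF carrier_cst]) (simp add: that)
  show ?thesis
    using assms
  proof (induction A rule: finite_induct)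
    case empty
    have "qp (\<zero>\<^bsub>R\<^esub>) = \<zero>\<^bsub>KQ\<^esub>"
      by (rule ring_hom_zero[OF qp_hom R.ring_axioms ring_KQ])
    then show ?case by (simp only: KQ.finsum_empty sum.empty R_simps)
  next
    case (insert s A)
    have s: "s \<in> carrier R" "A \<subseteq> carrier R" using insert.prems by simp_all
    have "(\<Oplus>\<^bsub>KQ\<^esub>s\<in>insert s A. qp (mps_const (a s)) \<otimes>\<^bsub>KQ\<^esub> qp s) =
        qp (cf (cst (a s) * Ps s)) \<oplus>\<^bsub>KQ\<^esub> qp (cf (\<Sum>s\<in>A. cst (a s) * Ps s))"
    proof (subst KQ.finsum_insert)
      show "(\<lambda>s. qp (mps_const (a s)) \<otimes>\<^bsub>KQ\<^esub> qp s) \<in> A \<rightarrow> carrier KQ"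
        using s(2) by (auto simp: term_eq intro!: qc tc)
      show "qp (mps_const (a s)) \<otimes>\<^bsub>KQ\<^esub> qp s \<in> carrier KQ" unfolding term_eq[OF s(1)] by (intro qc tc s)
      show "qp (mps_const (a s)) \<otimes>\<^bsub>KQ\<^esub> qp s \<oplus>\<^bsub>KQ\<^esub> qsum a A =
          qp (cf (cst (a s) * Ps s)) \<oplus>\<^bsub>KQ\<^esub> qp (cf (\<Sum>s\<in>A. cst (a s) * Ps s))"
        unfolding term_eq[OF s(1)] insert.IH[OF s(2)] ..
    qed (use insert.hyps in simp_all)
    also have "\<dots> = qp (cf (cst (a s) * Ps s) \<oplus>\<^bsub>R\<^esub> cf (\<Sum>s\<in>A. cst (a s) * Ps s))"
    proof (rule ring_hom_add[OF qp_hom, symmetric])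
      show "cf (cst (a s) * Ps s) \<in> carrier R" by (rule tc[OF s(1)])
      show "cf (\<Sum>s\<in>A. cst (a s) * Ps s) \<in> carrier R" by (rule carrier_sum, rule tc) (use s(2) in blast)
    qed
    also have "\<dots> = qp (cf (\<Sum>s\<in>insert s A. cst (a s) * Ps s))"
      by (simp only: R_simps Ps_cf sum.insert[OF insert.hyps])
    finally show ?case .
  qed
qed

lemma topspace_T: "topspace T = carrier R"
  by (simp add: K_BU_topology_def)

lemma openin_T_iff:
  "openin T W \<longleftrightarrow> W \<subseteq> carrier R \<and>
     (\<forall>f\<in>W. \<exists>F. finite F \<and> (\<forall>f'\<in>carrier R. (\<forall>M\<in>F. f' M = f M) \<longrightarrow> f' \<in> W))"
proof
  assume W: "openin T W"
  then obtain S where S: "openin (product_topology (\<lambda>_. discrete_topology UNIV) UNIV) S" "W = S \<inter> carrier R"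
    unfolding K_BU_topology_def openin_subtopology by blast
  show "W \<subseteq> carrier R \<and>
     (\<forall>f\<in>W. \<exists>F. finite F \<and> (\<forall>f'\<in>carrier R. (\<forall>M\<in>F. f' M = f M) \<longrightarrow> f' \<in> W))"
  proof (intro conjI ballI)
    show "W \<subseteq> carrier R" using S(2) by simp
    fix f assume f: "f \<in> W"
    then have "f \<in> S" using S(2) by simp
    then obtain U where U: "finite {i. U i \<noteq> UNIV}" "f \<in> Pi\<^sub>E UNIV U" "Pi\<^sub>E UNIV U \<subseteq> S"
      using S(1)[unfolded openin_product_topology_alt] by fastforce
    have "f' \<in> W" if "f' \<in> carrier R" "\<forall>M\<in>{i. U i \<noteq> UNIV}. f' M = f M" for f'
    proof -
      have "f' M \<in> U M" for M
      proof (cases "U M = UNIV")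
        case False
        then have "f' M = f M" using that(2) by simp
        then show ?thesis using U(2) by (auto simp: PiE_iff)
      qed simp
      then have "f' \<in> S" using U(3) by (auto simp: PiE_iff)
      then show ?thesis using S(2) that(1) by simp
    qed
    then show "\<exists>F. finite F \<and> (\<forall>f'\<in>carrier R. (\<forall>M\<in>F. f' M = f M) \<longrightarrow> f' \<in> W)"
      using U(1) by blast
  qed
next
  assume W: "W \<subseteq> carrier R \<and>
     (\<forall>f\<in>W. \<exists>F. finite F \<and> (\<forall>f'\<in>carrier R. (\<forall>M\<in>F. f' M = f M) \<longrightarrow> f' \<in> W))"
  show "openin T W"
  proof (subst openin_subopen, intro ballI)
    fix f assume f: "f \<in> W"
    then obtain F where F: "finite F" "\<forall>f'\<in>carrier R. (\<forall>M\<in>F. f' M = f M) \<longrightarrow> f' \<in> W" using W by blast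
    let ?S = "Pi\<^sub>E UNIV (\<lambda>M. if M \<in> F then {f M} else UNIV)"
    have "openin (product_topology (\<lambda>_. discrete_topology UNIV) UNIV) ?S"
      unfolding openin_product_topology_alt
    proof (intro ballI exI conjI)
      show "finite {i \<in> UNIV. (if i \<in> F then {f i} else UNIV) \<noteq> topspace (discrete_topology UNIV)}"
        by (rule finite_subset[OF _ F(1)]) auto
    qed simp_all
    then have "openin T (?S \<inter> carrier R)"
      unfolding K_BU_topology_def openin_subtopology by blast
    moreover have "f \<in> ?S \<inter> carrier R" using f W by (auto simp: PiE_iff)
    moreover have "?S \<inter> carrier R \<subseteq> W"
    proof
      fix f' assume f': "f' \<in> ?S \<inter> carrier R"
      then have "\<forall>M\<in>F. f' M = f M" by (auto simp: PiE_iff split: if_splits)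
      then show "f' \<in> W" using F(2) f' by blast
    qed
    ultimately show "\<exists>V. openin T V \<and> f \<in> V \<and> V \<subseteq> W" by blast
  qed
qed

text \<open>The definition through \<open>topology\<close> has the intended open sets only once the
  axioms of a topology are verified.\<close>

lemma openin_quot_iff:
  "openin (K_quot_topology n q) U \<longleftrightarrow> U \<subseteq> carrier KQ \<and> openin T {f \<in> carrier R. qp f \<in> U}"
proof -
  have "istopology (\<lambda>U. U \<subseteq> carrier KQ \<and> openin T {f \<in> carrier R. qp f \<in> U})"
    unfolding istopology_def
  proof (intro conjI allI impI)
    fix U V assume *: "U \<subseteq> carrier KQ \<and> openin T {f \<in> carrier R. qp f \<in> U}"
      "V \<subseteq> carrier KQ \<and> openin T {f \<in> carrier R. qp f \<in> V}"
    have eq: "{f \<in> carrier R. qp f \<in> U \<inter> V} = {f \<in> carrier R. qp f \<in> U} \<inter> {f \<in> carrier R. qp f \<in> V}" by auto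
    show "openin T {f \<in> carrier R. qp f \<in> U \<inter> V}" unfolding eq using * by (intro openin_Int) blast+
    show "U \<inter> V \<subseteq> carrier KQ" using * by blast
  next
    fix K assume *: "\<forall>U\<in>K. U \<subseteq> carrier KQ \<and> openin T {f \<in> carrier R. qp f \<in> U}"
    have eq: "{f \<in> carrier R. qp f \<in> \<Union>K} = (\<Union>U\<in>K. {f \<in> carrier R. qp f \<in> U})" by auto
    show "openin T {f \<in> carrier R. qp f \<in> \<Union>K}" unfolding eq by (rule openin_Union) (use * in blast)
    show "\<Union>K \<subseteq> carrier KQ" using * by blast
  qed
  then show ?thesis unfolding K_quot_topology_def by (simp only: topology_inverse')
qed

lemma topspace_quot: "topspace (K_quot_topology n q) = carrier KQ"
proof
  show "topspace (K_quot_topology n q) \<subseteq> carrier KQ"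
    using openin_quot_iff openin_topspace by blast
  have "{f \<in> carrier R. qp f \<in> carrier KQ} = topspace T" by (auto simp: topspace_T carrier_KQ)
  then have "openin (K_quot_topology n q) (carrier KQ)" by (simp add: openin_quot_iff)
  then show "carrier KQ \<subseteq> topspace (K_quot_topology n q)" by (rule openin_subset)
qed

text \<open>The projection is open, by translation: if f is congruent to an f1 close to g, and f' is
  close to f, then f' is congruent to f1 + (f' - f), which is again close to g.\<close>

lemma openin_qp_neighbourhood:
  assumes g: "g \<in> carrier R"
  shows "openin (K_quot_topology n q) (qp ` {f \<in> carrier R. ordge N (Ps f - Ps g)})"
  unfolding openin_quot_iff openin_T_iff
proof (intro conjI ballI)
  let ?V = "qp ` {f \<in> carrier R. ordge N (Ps f - Ps g)}"
  show "?V \<subseteq> carrier KQ" by (auto simp: carrier_KQ)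
  show "{f \<in> carrier R. qp f \<in> ?V} \<subseteq> carrier R" by auto
  fix f assume "f \<in> {f \<in> carrier R. qp f \<in> ?V}"
  then obtain f1 where f: "f \<in> carrier R" and f1: "f1 \<in> carrier R" "ordge N (Ps f1 - Ps g)" "qp f = qp f1" by auto
  \<comment> \<open>Elements of the ring only involve q variables, so finitely many coefficients
    control the order.\<close>
  let ?F = "{A :: monom. keys A \<subseteq> {1..q} \<and> total_degree A \<le> N}"
  have "f' \<in> {f \<in> carrier R. qp f \<in> ?V}" if f': "f' \<in> carrier R" "\<forall>M\<in>?F. f' M = f M" for f'
  proof -
    define f2 where "f2 = cf (Ps f1 + (Ps f' - Ps f))"
    have f2: "f2 \<in> carrier R" unfolding f2_def by (intro carrier_add carrier_diff) (simp_all add: f f' f1)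
    have "ordge N (Ps f' - Ps f)"
    proof (subst ordge_diff_iff, intro allI impI)
      fix M :: monom assume M: "total_degree M < N"
      show "cf (Ps f') M = cf (Ps f) M"
      proof (cases "keys M \<subseteq> {1..q}")
        case True
        then show ?thesis using f'(2) M by simp
      next
        case False
        then show ?thesis using f'(1) f carrier_R suppD[OF symq_supp] by metis
      qed
    qed
    then have "ordge N ((Ps f1 - Ps g) + (Ps f' - Ps f))" by (rule ordge_add[OF f1(2)])
    then have "ordge N (Ps f2 - Ps g)" unfolding f2_def by (simp add: algebra_simps)
    moreover have "qp f' = qp f2"
    proof -
      have "cf (Ps f - Ps f1) \<in> I" using qp_eq_iff[OF f f1(1)] f1(3) by simp
      moreover have "Ps f' - Ps f2 = Ps f - Ps f1" unfolding f2_def by simp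
      ultimately show ?thesis using qp_eq_iff[OF f'(1) f2] by simp
    qed
    ultimately show ?thesis using f'(1) f2 by blast
  qed
  then show "\<exists>F. finite F \<and> (\<forall>f'\<in>carrier R. (\<forall>M\<in>F. f' M = f M) \<longrightarrow> f' \<in> {f \<in> carrier R. qp f \<in> ?V})"
    using finite_monoms[of "{1..q}" N] by blast
qed

section \<open>The basis\<close>

definition good_msyms :: "K_coeff mps set" where
  "good_msyms = {cf (msym \<kappa>) | \<kappa>. size \<kappa> = q \<and> \<not> bad \<kappa>}"

lemma homog_msym: "homog n (int (sum_mset \<kappa>)) (msym \<kappa>)"
  unfolding homog_def
proof (intro allI impI)
  fix M and k :: int assume k: "k \<in> keys (cf (msym \<kappa>) M)"
  then have M: "keys M \<subseteq> {1..q}" "expo M = \<kappa>" and "k = 0" by (auto simp: cf_msym split: if_splits)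
  have "total_degree M = sum_mset \<kappa>" using sum_expo[OF M(1)] M(2) by simp
  then show "int (total_degree M) - (2 ^ n - 1) * k = int (sum_mset \<kappa>)"
    unfolding \<open>k = 0\<close> by (simp only: mult_zero_right diff_zero)
qed

lemma good_carrier: "good_msyms \<subseteq> carrier R"
  unfolding good_msyms_def using homog_carrier[OF homog_msym symq_msym] by blast

lemma good_eq:
  assumes "s \<in> good_msyms" "s M \<noteq> 0"
  shows "keys M \<subseteq> {1..q} \<and> s = cf (msym (expo M)) \<and> \<not> bad (expo M)"
proof -
  obtain \<kappa> where k: "s = cf (msym \<kappa>)" "\<not> bad \<kappa>" using assms(1) unfolding good_msyms_def by blast
  then have "keys M \<subseteq> {1..q} \<and> expo M = \<kappa>" using assms(2) by (simp add: cf_msym split: if_splits)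
  with k show ?thesis by blast
qed

text \<open>Distinct monomial symmetric functions have no monomial in common.\<close>

lemma cf_combination:
  assumes A: "finite A" "A \<subseteq> good_msyms"
  shows "cf (\<Sum>s\<in>A. cst (a s) * Ps s) M =
    (if keys M \<subseteq> {1..q} \<and> cf (msym (expo M)) \<in> A then a (cf (msym (expo M))) else 0)"
proof (cases "keys M \<subseteq> {1..q}")
  case True
  let ?s = "cf (msym (expo M)) :: K_coeff mps"
  have "cf (\<Sum>s\<in>A. cst (a s) * Ps s) M = (\<Sum>s\<in>A. if s = ?s then a ?s else 0)"
    unfolding cf_sum
  proof (rule sum.cong[OF refl])
    fix s assume s: "s \<in> A"
    show "cf (cst (a s) * Ps s) M = (if s = ?s then a ?s else 0)"
    proof (cases "s = ?s")
      case False
      then have "s M = 0" using good_eq[of s M] s A(2) by blast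
      then show ?thesis using False by simp
    qed (simp add: cf_msym True)
  qed
  also have "\<dots> = (if ?s \<in> A then a ?s else 0)" by (rule sum.delta[OF A(1)])
  finally show ?thesis using True by simp
next
  case False
  have "s M = 0" if "s \<in> A" for s using good_eq[of s M] that A(2) False by blast
  then show ?thesis using False by (simp add: sum.neutral)
qed

lemma combination_carrier:
  assumes "A \<subseteq> good_msyms"
  shows "cf (\<Sum>s\<in>A. cst (a s) * Ps s) \<in> carrier R"
proof (rule carrier_sum, rule carrier_mult[OF carrier_cst])
  fix s assume "s \<in> A"
  then show "cf (Ps s) \<in> carrier R" using assms good_carrier by auto
qed

text \<open>The coefficients in the expansion of b by monomial symmetric functions, each read off at
  some monomial of s; for symmetric b the choice is immaterial.\<close>

definition nf :: "K_coeff ps \<Rightarrow> K_coeff mps \<Rightarrow> K_coeff" where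
  "nf b s = (if s \<in> good_msyms then cf b (SOME M. s M \<noteq> 0) else 0)"

lemma nf_eq:
  assumes b: "symq b" and s: "s \<in> good_msyms" "s M \<noteq> 0"
  shows "nf b s = cf b M"
proof -
  let ?M = "SOME M. s M \<noteq> 0"
  have "s ?M \<noteq> 0" by (rule someI[of "\<lambda>M. s M \<noteq> 0", OF s(2)])
  from good_eq[OF s(1) this] have M': "keys ?M \<subseteq> {1..q}" "s = cf (msym (expo ?M))" by blast+
  have "cf (msym (expo ?M)) M \<noteq> (0 :: K_coeff)" unfolding M'(2)[symmetric] by (rule s(2))
  then have "expo M = expo ?M" by (simp add: cf_msym split: if_splits)
  then have "cf b M = cf b ?M"
    by (rule symq_expo[OF b]) (use good_eq[OF s] M' in blast)+
  then show ?thesis using s(1) by (simp add: nf_def)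
qed

lemma homog_nf:
  assumes b: "symq b" "homog n e b" and s: "s \<in> good_msyms"
  shows "homog n e (cst (nf b s) * Ps s)"
  unfolding homog_def
proof (intro allI impI)
  fix M k assume k: "k \<in> keys (cf (cst (nf b s) * Ps s) M)"
  then have k': "k \<in> keys (nf b s * s M)" by simp
  then have nz: "s M \<noteq> 0" by auto
  have M: "keys M \<subseteq> {1..q}" "s = cf (msym (expo M))" using good_eq[OF s nz] by blast+
  have "s M = 1" by (subst M(2)) (simp add: cf_msym M(1))
  then have "k \<in> keys (cf b M)" using k' nf_eq[OF b(1) s nz] by simp
  then show "int (total_degree M) - (2 ^ n - 1) * k = e" by (rule homogD[OF b(2)])
qed

text \<open>A neighbourhood is reached by prescribing finitely many coefficients of a
  representative. As soon as the finite set of summands contains the good orbits of the monomials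
  concerned, the partial sum agrees with b there.\<close>

lemma limitin_nf:
  assumes b: "symq b" "cf b \<in> carrier R" "\<And>M. cf b M \<noteq> 0 \<Longrightarrow> \<not> bad (expo M)"
  shows "limitin (K_quot_topology n q) (qsum (nf b)) (qp (cf b))
    (finite_subsets_at_top good_msyms)"
  unfolding limitin_def
proof (intro conjI allI impI)
  show "qp (cf b) \<in> topspace (K_quot_topology n q)" using b(2) by (simp add: topspace_quot carrier_KQ)
  fix U assume U: "openin (K_quot_topology n q) U \<and> qp (cf b) \<in> U"
  let ?W = "{f \<in> carrier R. qp f \<in> U}"
  have "openin T ?W" using U by (simp add: openin_quot_iff)
  moreover have "cf b \<in> ?W" using U b(2) by simp
  ultimately obtain F where F: "finite F" "\<forall>f'\<in>carrier R. (\<forall>M\<in>F. f' M = cf b M) \<longrightarrow> f' \<in> ?W"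
    unfolding openin_T_iff by blast
  let ?X = "(\<lambda>M. cf (msym (expo M))) ` {M \<in> F. \<not> bad (expo M)} :: K_coeff mps set"
  show "\<forall>\<^sub>F A in finite_subsets_at_top good_msyms.
      qsum (nf b) A \<in> U"
    unfolding eventually_finite_subsets_at_top
  proof (intro exI[of _ ?X] conjI allI impI)
    show "finite ?X" using F(1) by simp
    show "?X \<subseteq> good_msyms" unfolding good_msyms_def using size_expo by blast
    fix A assume A: "finite A \<and> ?X \<subseteq> A \<and> A \<subseteq> good_msyms"
    let ?S = "cf (\<Sum>s\<in>A. cst (nf b s) * Ps s)"
    have "?S M = cf b M" if M: "M \<in> F" for M
    proof -
      let ?s = "cf (msym (expo M)) :: K_coeff mps"
      have comb: "?S M = (if keys M \<subseteq> {1..q} \<and> ?s \<in> A then nf b ?s else 0)"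
        by (rule cf_combination) (use A in blast)+
      show ?thesis
      proof (cases "keys M \<subseteq> {1..q}")
        case False
        then show ?thesis using comb suppD[OF symq_supp[OF b(1)]] by simp
      next
        case True
        then have sM: "?s M \<noteq> 0" by (simp add: cf_msym)
        show ?thesis
        proof (cases "bad (expo M)")
          case bad: True
          then have "?s \<notin> A" using good_eq[of ?s M] sM A by blast
          moreover have "cf b M = 0" using b(3) bad by blast
          ultimately show ?thesis using comb by simp
        next
          case False
          then have "?s \<in> A" using M A by blast
          moreover have "nf b ?s = cf b M"
            using nf_eq[OF b(1), of ?s M] sM \<open>?s \<in> A\<close> A by blast
          ultimately show ?thesis using comb True by simp
        qed
      qed
    qed
    moreover have "?S \<in> carrier R" by (rule combination_carrier) (use A in blast)
    ultimately have "?S \<in> ?W" using F(2) by blast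
    moreover have "A \<subseteq> carrier R" using A good_carrier by blast
    ultimately show "qsum (nf b) A \<in> U"
      using qp_sum[of A "nf b"] A by simp
  qed
qed

lemma normal_form_exists:
  assumes q: "q \<ge> 1" and f: "f \<in> carrier R" "degrees n f \<subseteq> {d}"
  shows "\<exists>b. symq b \<and> cf b \<in> carrier R \<and> (\<forall>M. cf b M \<noteq> 0 \<longrightarrow> \<not> bad (expo M)) \<and> qp f = qp (cf b) \<and>
    (\<forall>s\<in>good_msyms. degrees n (cf (cst (nf b s) * Ps s)) \<subseteq> {d})"
proof (cases "even d")
  case True
  then obtain e where e: "d = 2 * e" by blast
  have fs: "symq (Ps f)" using f(1) by (simp add: carrier_R)
  have "homog n e (Ps f)" using f(2) e by (intro degrees_homog) simp
  from homog_reduction[OF q fs this] obtain b where b: "symq b" "homog n e b"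
    "\<forall>M. cf b M \<noteq> 0 \<longrightarrow> \<not> bad (expo M)" "cf (Ps f - b) \<in> I" by blast
  have bc: "cf b \<in> carrier R" by (rule homog_carrier[OF b(2,1)])
  have "qp f = qp (cf b)" using qp_eq_iff[OF f(1) bc] b(4) by simp
  moreover have "\<forall>s\<in>good_msyms. degrees n (cf (cst (nf b s) * Ps s)) \<subseteq> {d}"
    unfolding e by (intro ballI homog_degrees homog_nf b(1,2))
  ultimately show ?thesis using b bc by blast
next
  \<comment> \<open>All degrees that occur are even, so a homogeneous element of odd degree is
    zero.\<close>
  case False
  have "f M = 0" for M
  proof (rule ccontr)
    assume "f M \<noteq> 0"
    then have "keys (f M) \<noteq> {}" by simp
    then obtain k where k: "k \<in> keys (f M)" by blast
    then have "2 * int (total_degree M) - 2 * (2 ^ n - 1) * k \<in> degrees n f"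
      unfolding degrees_def by blast
    then have "2 * int (total_degree M) - 2 * (2 ^ n - 1) * k = d" using f(2) by blast
    moreover have "even (2 * int (total_degree M) - 2 * (2 ^ n - 1) * k)" by simp
    ultimately show False using False by simp
  qed
  then have f0: "f = cf 0" by (intro ext) simp
  have "nf 0 s = 0" for s by (simp add: nf_def)
  then have "\<forall>s\<in>good_msyms. degrees n (cf (cst (nf 0 s) * Ps s)) \<subseteq> {d}"
    by (simp add: degrees_def)
  then show ?thesis using f0 symq_0 carrier_0 by (intro exI[of _ 0]) simp
qed

text \<open>Far enough out both partial sums agree with g up to the ideal and order N. Their
  difference is a combination of functions that are not bad, so at \<open>v\<^sub>n = 1\<close> it
  vanishes below order N by \<open>independence\<close>; the degree condition then recovers the
  coefficient itself.\<close>

lemma limit_coefficient_unique: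
  assumes g: "g \<in> carrier R"
    and a: "\<forall>s\<in>good_msyms. degrees n (mps_const (a s) \<otimes>\<^bsub>R\<^esub> s) \<subseteq> {d}"
      "limitin (K_quot_topology n q) (qsum a) (qp g)
        (finite_subsets_at_top good_msyms)"
    and a': "\<forall>s\<in>good_msyms. degrees n (mps_const (a' s) \<otimes>\<^bsub>R\<^esub> s) \<subseteq> {d}"
      "limitin (K_quot_topology n q) (qsum a') (qp g)
        (finite_subsets_at_top good_msyms)"
    and s: "s \<in> good_msyms" "s M \<noteq> 0"
  shows "a s = a' s"
proof -
  \<comment> \<open>One more than the degree of M, so that vanishing below order N includes the
    coefficient at M.\<close>
  define N where "N = Suc (total_degree M)"
  let ?U = "qp ` {f \<in> carrier R. ordge N (Ps f - Ps g)}"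
  have U: "openin (K_quot_topology n q) ?U" by (rule openin_qp_neighbourhood[OF g])
  have gU: "qp g \<in> ?U" using g by (intro imageI) simp
  obtain X where X: "finite X" "X \<subseteq> good_msyms"
    "\<And>A. finite A \<and> X \<subseteq> A \<and> A \<subseteq> good_msyms \<Longrightarrow> qsum a A \<in> ?U"
    using limitinD[OF a(2) U gU] unfolding eventually_finite_subsets_at_top by blast
  obtain X' where X': "finite X'" "X' \<subseteq> good_msyms"
    "\<And>A. finite A \<and> X' \<subseteq> A \<and> A \<subseteq> good_msyms \<Longrightarrow> qsum a' A \<in> ?U"
    using limitinD[OF a'(2) U gU] unfolding eventually_finite_subsets_at_top by blast
  define A where "A = insert s (X \<union> X')"
  have A: "finite A" "A \<subseteq> good_msyms" "s \<in> A" using X X' s(1) by (simp_all add: A_def)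
  have AR: "A \<subseteq> carrier R" using A(2) good_carrier by blast
  have close: "\<exists>h v. map_ps aug ((\<Sum>s\<in>A. cst (c s) * Ps s) - Ps g) = (\<Sum>k\<in>{1..q}. h k * gen k) + v \<and> ordge N v"
    if c: "qsum c A \<in> ?U" for c
  proof -
    let ?S = "\<Sum>s\<in>A. cst (c s) * Ps s"
    have S: "cf ?S \<in> carrier R" by (rule combination_carrier[OF A(2)])
    obtain f where f: "f \<in> carrier R" "ordge N (Ps f - Ps g)" "qp (cf ?S) = qp f"
      using c unfolding qp_sum[OF A(1) AR] by blast
    have "cf (?S - Ps f) \<in> I" using qp_eq_iff[OF S f(1)] f(3) by simp
    from I_gen[OF this] obtain h where h: "map_ps aug (?S - Ps f) = (\<Sum>k\<in>{1..q}. h k * gen k)" by auto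
    have "?S - Ps g = (?S - Ps f) + (Ps f - Ps g)" by simp
    then have "map_ps aug (?S - Ps g) = (\<Sum>k\<in>{1..q}. h k * gen k) + map_ps aug (Ps f - Ps g)"
      by (simp only: augb.map_ps_add over_UNIV h)
    moreover have "ordge N (map_ps aug (Ps f - Ps g))" by (rule augb.ordge_map_ps[OF f(2)])
    ultimately show ?thesis by blast
  qed
  have "qsum a A \<in> ?U" by (rule X(3)) (use A in \<open>auto simp: A_def\<close>)
  from close[OF this] obtain h v where hv: "map_ps aug ((\<Sum>s\<in>A. cst (a s) * Ps s) - Ps g) = (\<Sum>k\<in>{1..q}. h k * gen k) + v" "ordge N v"
    by blast
  have "qsum a' A \<in> ?U" by (rule X'(3)) (use A in \<open>auto simp: A_def\<close>)
  from close[OF this] obtain h' v' where hv': "map_ps aug ((\<Sum>s\<in>A. cst (a' s) * Ps s) - Ps g) = (\<Sum>k\<in>{1..q}. h' k * gen k) + v'" "ordge N v'"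
    by blast
  let ?D = "(\<Sum>s\<in>A. cst (a s) * Ps s) - (\<Sum>s\<in>A. cst (a' s) * Ps s)"
  have "?D = ((\<Sum>s\<in>A. cst (a s) * Ps s) - Ps g) - ((\<Sum>s\<in>A. cst (a' s) * Ps s) - Ps g)" by simp
  then have "map_ps aug ?D = ((\<Sum>k\<in>{1..q}. h k * gen k) + v) - ((\<Sum>k\<in>{1..q}. h' k * gen k) + v')"
    by (simp only: augb.map_ps_diff over_UNIV hv(1) hv'(1))
  also have "\<dots> = (\<Sum>k\<in>{1..q}. (h k - h' k) * gen k) + (v - v')"
    by (simp add: left_diff_distrib sum_subtractf)
  finally have D: "map_ps aug ?D = (\<Sum>k\<in>{1..q}. (h k - h' k) * gen k) + (v - v')" .
  have comb: "cf ?D M' = (if keys M' \<subseteq> {1..q} \<and> cf (msym (expo M')) \<in> A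
      then a (cf (msym (expo M'))) - a' (cf (msym (expo M'))) else 0)" for M'
    using cf_combination[OF A(1,2), of a M'] cf_combination[OF A(1,2), of a' M'] by simp
  have "ordge N (map_ps aug ?D)"
  proof (rule independence[OF _ _ D])
    have "cf ?D \<in> carrier R" by (intro carrier_diff combination_carrier A(2))
    then have "symq ?D" by (simp only: carrier_cf)
    then show "symq (map_ps aug ?D)" by (rule symq_map_aug)
    show "ordge N (v - v')" by (rule ordge_diff[OF hv(2) hv'(2)])
    fix M' assume nz: "cf (map_ps aug ?D) M' \<noteq> 0"
    have "cf ?D M' \<noteq> 0"
    proof
      assume "cf ?D M' = 0"
      then have "cf (map_ps aug ?D) M' = 0" by (simp only: cf_map_ps aug_0)
      with nz show False by simp
    qed
    then have M': "keys M' \<subseteq> {1..q}" "cf (msym (expo M')) \<in> A" unfolding comb by (simp_all split: if_splits)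
    then have "cf (msym (expo M')) M' \<noteq> (0 :: K_coeff)" by (simp add: cf_msym)
    then show "\<not> bad (expo M')" using good_eq M'(2) A(2) by blast
  qed
  then have "cf (map_ps aug ?D) M = 0" by (rule ordgeD) (simp add: N_def)
  moreover have Ms: "keys M \<subseteq> {1..q}" "s = cf (msym (expo M))" using good_eq[OF s] by blast+
  ultimately have aug0: "aug (a s - a' s) = 0"
    using comb[of M] A(3) by (simp only: cf_map_ps simp_thms if_True)
  have sM: "s M = 1" by (subst Ms(2)) (simp add: cf_msym Ms(1))
  have key: "2 * int (total_degree M) - 2 * (2 ^ n - 1) * k = d"
    if "\<forall>s\<in>good_msyms. degrees n (mps_const (c s) \<otimes>\<^bsub>R\<^esub> s) \<subseteq> {d}" "k \<in> keys (c s)"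
    for c :: "K_coeff mps \<Rightarrow> K_coeff" and k
  proof -
    have "mps_const (c s) \<otimes>\<^bsub>R\<^esub> s = cf (cst (c s) * Ps s)" by (simp add: R_simps cst_def)
    then have "degrees n (cf (cst (c s) * Ps s)) \<subseteq> {d}" using that(1) s(1) by metis
    moreover have "k \<in> keys (cf (cst (c s) * Ps s) M)" using that(2) sM by simp
    then have "2 * int (total_degree M) - 2 * (2 ^ n - 1) * k \<in> degrees n (cf (cst (c s) * Ps s))"
      unfolding degrees_iff by blast
    ultimately show ?thesis by blast
  qed
  \<comment> \<open>Both coefficients obey the same degree condition, so their difference involves
    at most one power of \<open>v\<^sub>n\<close> and is determined by its value at
    \<open>v\<^sub>n = 1\<close>.\<close>
  have "a s - a' s = 0"
  proof (rule ccontr)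
    assume "a s - a' s \<noteq> 0"
    then have "keys (a s - a' s) \<noteq> {}" by simp
    then obtain k where k: "k \<in> keys (a s - a' s)" by blast
    have kd: "2 * int (total_degree M) - 2 * (2 ^ n - 1) * j = d" if "j \<in> keys (a s - a' s)" for j
      using that keys_diff[of "a s" "a' s"] key[OF a(1)] key[OF a'(1)] by blast
    have "j = k" if j: "j \<in> keys (a s - a' s)" for j
    proof -
      have "2 * (2 ^ n - 1) * j = 2 * (2 ^ n - 1) * k" using kd[OF j] kd[OF k] by linarith
      then show ?thesis using Q1_nz by simp
    qed
    then have "keys (a s - a' s) = {k}" using k by blast
    then have "aug (a s - a' s) = lookup (a s - a' s) k" unfolding aug_def by simp
    then show False using aug0 k by (simp add: in_keys_iff)
  qed
  then show ?thesis by simp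
qed

end

section \<open>The symmetric functions of the theorem\<close>

lemma lookup_monom_of_list:
  "lookup (monom_of_list es) j = (if 1 \<le> j \<and> j \<le> length es then es ! (j - 1) else 0)"
proof (cases j)
  case 0
  then show ?thesis by (simp add: monom_of_list_def lookup_sum lookup_single when_def)
next
  case (Suc i)
  have "lookup (monom_of_list es) j = (\<Sum>k<length es. if k = i then es ! i else 0)"
    unfolding monom_of_list_def lookup_sum by (rule sum.cong) (simp_all add: lookup_single when_def Suc)
  then show ?thesis by (simp add: Suc sum.delta)
qed

lemma even_count_pairs:
  "even (length J) \<Longrightarrow> (\<forall>k < length J div 2. J ! (2 * k) = J ! (2 * k + 1)) \<Longrightarrow> even (count (mset J) c)"
proof (induction J rule: induct_list012)
  case (3 x y zs)
  have "x = y" using 3(4)[rule_format, of 0] by simp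
  have "even (count (mset zs) c)"
  proof (rule 3(1))
    show "even (length zs)" using 3(3) by simp
    show "\<forall>k < length zs div 2. zs ! (2 * k) = zs ! (2 * k + 1)"
    proof (intro allI impI)
      fix k assume "k < length zs div 2"
      then show "zs ! (2 * k) = zs ! (2 * k + 1)" using 3(4)[rule_format, of "Suc k"] by (simp add: One_nat_def)
    qed
  qed
  then show ?case using \<open>x = y\<close> by simp
qed simp_all

fun twice :: "'b list \<Rightarrow> 'b list" where
  "twice [] = []"
| "twice (x # xs) = x # x # twice xs"

lemma length_twice [simp]: "length (twice xs) = 2 * length xs"
  by (induction xs) simp_all

lemma mset_twice: "mset (twice xs) = mset xs + mset xs"
  by (induction xs) simp_all

lemma set_twice [simp]: "set (twice xs) = set xs"
  by (induction xs) simp_all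

lemma sorted_twice: "sorted xs \<Longrightarrow> sorted (twice xs)"
  by (induction xs) simp_all

lemma nth_twice: "k < length xs \<Longrightarrow> twice xs ! (2 * k) = twice xs ! (2 * k + 1)"
proof (induction xs arbitrary: k)
  case (Cons x xs)
  then show ?case by (cases k) (simp_all add: One_nat_def)
qed simp

text \<open>I takes one copy of each positive entry of odd multiplicity, and J the even number of
  copies that remain of each positive entry. All zeros are left to the padding.\<close>

lemma mset_eq_pairs:
  fixes \<kappa> :: "nat multiset"
  assumes "\<And>c. c \<ge> B \<Longrightarrow> even (count \<kappa> c)"
  obtains I J where "sorted_wrt (<) I" "\<forall>i\<in>set I. 0 < i \<and> i < B" "even (length J)" "sorted J"
    "\<forall>k < length J div 2. J ! (2 * k) = J ! (2 * k + 1)"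
    "\<kappa> = mset (I @ J) + replicate_mset (count \<kappa> 0) 0"
proof -
  let ?S = "{i. 0 < i \<and> odd (count \<kappa> i)}"
  have finS: "finite ?S"
  proof (rule finite_subset[OF _ finite_set_mset[of \<kappa>]])
    show "?S \<subseteq> set_mset \<kappa>"
    proof
      fix i assume "i \<in> ?S"
      then have "count \<kappa> i \<noteq> 0" by (intro notI) simp
      then show "i \<in># \<kappa>" by simp
    qed
  qed
  define I where "I = sorted_list_of_set ?S"
  define h where "h i = (if 0 < i then count \<kappa> i div 2 else 0)" for i
  have finh: "finite {i. h i > 0}"
  proof (rule finite_subset[OF _ finite_set_mset[of \<kappa>]])
    show "{i. h i > 0} \<subseteq> set_mset \<kappa>"
    proof
      fix i assume "i \<in> {i. h i > 0}"
      then have "count \<kappa> i \<noteq> 0" by (intro notI) (simp add: h_def split: if_splits)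
      then show "i \<in># \<kappa>" by simp
    qed
  qed
  define xs where "xs = sorted_list_of_multiset (Abs_multiset h)"
  have mset_xs: "count (mset xs) i = h i" for i
    unfolding xs_def by (simp add: count_Abs_multiset[OF finh])
  have mset_I: "mset I = mset_set ?S"
    unfolding I_def by (metis mset_sorted_list_of_multiset sorted_list_of_mset_set)
  have set_I: "set I = ?S" unfolding I_def using finS by (rule sorted_list_of_set.set_sorted_key_list_of_set)
  show ?thesis
  proof (rule that[of I "twice xs"])
    show "sorted_wrt (<) I" unfolding I_def by (rule strict_sorted_list_of_set)
    show "\<forall>i\<in>set I. 0 < i \<and> i < B"
    proof
      fix i assume "i \<in> set I"
      then have i: "0 < i" "odd (count \<kappa> i)" using set_I by simp_all
      then have "\<not> B \<le> i" using assms[of i] by blast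
      then show "0 < i \<and> i < B" using i by simp
    qed
    show "even (length (twice xs))" by simp
    have "sorted xs" unfolding xs_def by (metis mset_sorted_list_of_multiset sorted_list_of_multiset_mset sorted_sort)
    then show "sorted (twice xs)" by (rule sorted_twice)
    show "\<forall>k < length (twice xs) div 2. twice xs ! (2 * k) = twice xs ! (2 * k + 1)"
      using nth_twice[of _ xs] by simp
    show "\<kappa> = mset (I @ twice xs) + replicate_mset (count \<kappa> 0) 0"
    proof (rule multiset_eqI)
      fix i
      have cI: "count (mset I) i = (if i \<in> ?S then 1 else 0)"
        unfolding mset_I by (simp add: count_mset_set' finS)
      show "count \<kappa> i = count (mset (I @ twice xs) + replicate_mset (count \<kappa> 0) 0) i"
      proof (cases "i = 0")
        case True
        then show ?thesis using cI mset_xs[of 0] by (simp add: mset_twice h_def)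
      next
        case False
        have "(if odd (count \<kappa> i) then 1 else 0) + 2 * (count \<kappa> i div 2) = count \<kappa> i" by presburger
        then show ?thesis using False cI mset_xs[of i] by (simp add: mset_twice h_def)
      qed
    qed
  qed
qed

context morava_sym
begin

lemma monom_of_list_props:
  assumes "length es \<le> q"
  shows "keys (monom_of_list es) \<subseteq> {1..q}"
    and "expo (monom_of_list es) = mset es + replicate_mset (q - length es) 0"
proof -
  let ?l = "length es" and ?f = "lookup (monom_of_list es)"
  show "keys (monom_of_list es) \<subseteq> {1..q}"
  proof
    fix j assume "j \<in> keys (monom_of_list es)"
    then show "j \<in> {1..q}" using assms by (simp add: in_keys_iff lookup_monom_of_list split: if_splits)
  qed
  have "{1..q} = {1..?l} \<union> {?l<..q}" "{1..?l} \<inter> {?l<..q} = {}" using assms by auto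
  then have split: "mset_set {1..q} = mset_set {1..?l} + mset_set {?l<..q}"
    using mset_set_Union[of "{1..?l}" "{?l<..q}"] by simp
  have "image_mset Suc (mset_set {0..<?l}) = mset_set {1..?l}"
    by (subst image_mset_mset_set) (simp_all add: image_Suc_atLeastLessThan atLeastLessThanSuc_atLeastAtMost One_nat_def)
  then have "image_mset ?f (mset_set {1..?l}) = image_mset (?f \<circ> Suc) (mset_set {0..<?l})"
    by (metis multiset.map_comp)
  also have "\<dots> = image_mset ((!) es) (mset_set {0..<?l})"
    by (rule image_mset_cong) (simp add: lookup_monom_of_list)
  also have "\<dots> = mset (map ((!) es) [0..<?l])" by simp
  also have "\<dots> = mset es" by (simp only: map_nth)
  finally have 1: "image_mset ?f (mset_set {1..?l}) = mset es" .
  have "image_mset ?f (mset_set {?l<..q}) = image_mset (\<lambda>_. 0) (mset_set {?l<..q})"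
    by (rule image_mset_cong) (simp add: lookup_monom_of_list)
  then have 2: "image_mset ?f (mset_set {?l<..q}) = replicate_mset (q - ?l) 0"
    by (simp add: image_mset_const_eq)
  show "expo (monom_of_list es) = mset es + replicate_mset (q - ?l) 0"
    unfolding expo_def split image_mset_union 1 2 ..
qed

lemma monomial_symmetric_eq:
  assumes "keys M0 \<subseteq> {1..q}"
  shows "monomial_symmetric q M0 = cf (msym (expo M0))"
proof
  fix M
  have "(\<exists>\<sigma>. \<sigma> permutes {1..q} \<and> M = map_key \<sigma> M0) \<longleftrightarrow> keys M \<subseteq> {1..q} \<and> expo M = expo M0"
  proof
    assume "\<exists>\<sigma>. \<sigma> permutes {1..q} \<and> M = map_key \<sigma> M0"
    then obtain \<sigma> where \<sigma>: "perm \<sigma>" "M = map_key \<sigma> M0" by blast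
    show "keys M \<subseteq> {1..q} \<and> expo M = expo M0"
      unfolding \<sigma>(2) using keys_map_key_subset[OF \<sigma>(1), of M0] expo_map_key[OF \<sigma>(1), of M0] assms by blast
  next
    assume "keys M \<subseteq> {1..q} \<and> expo M = expo M0"
    then have "expo M = expo M0" "keys M \<subseteq> {1..q}" by blast+
    from expo_eqD[OF this assms] show "\<exists>\<sigma>. \<sigma> permutes {1..q} \<and> M = map_key \<sigma> M0" by blast
  qed
  then show "monomial_symmetric q M0 M = cf (msym (expo M0)) M"
    by (simp add: monomial_symmetric_def cf_msym)
qed

lemma s_IJ_eq:
  fixes I J :: "nat list"
  assumes "length I + length J \<le> q"
  shows "s_IJ q I J = cf (msym (mset (I @ J) + replicate_mset (q - length (I @ J)) 0))"
proof -
  have "length (I @ J) \<le> q" using assms by simp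
  note p = monom_of_list_props[OF this]
  show ?thesis unfolding s_IJ_def monomial_symmetric_eq[OF p(1)] p(2) ..
qed

text \<open>An exponent of at least 2^n can only come from J, where it occurs an even number of
  times. Different (I, J) may give the same function, since a pair of zeros in J acts like padding;
  the comparison is between sets of functions.\<close>

lemma s_IJ_set_eq:
  "{s_IJ q I J | I J.
       length I + length J \<le> q \<and> even (length J) \<and>
       sorted_wrt (<) I \<and> (\<forall>i\<in>set I. 0 < i \<and> i < 2 ^ n) \<and>
       sorted J \<and> (\<forall>k < length J div 2. J ! (2 * k) = J ! (2 * k + 1))} = good_msyms"
  (is "?B = _")
proof
  show "?B \<subseteq> good_msyms"
  proof
    fix s assume "s \<in> ?B"
    then obtain I J where s: "s = s_IJ q I J" and len: "length I + length J \<le> q" and J: "even (length J)"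
      "\<forall>k < length J div 2. J ! (2 * k) = J ! (2 * k + 1)" and I: "\<forall>i\<in>set I. 0 < i \<and> i < 2 ^ n"
      by blast
    let ?\<kappa> = "mset (I @ J) + replicate_mset (q - length (I @ J)) 0"
    have "\<not> bad ?\<kappa>"
      unfolding bad_def
    proof clarify
      fix c assume c: "Q \<le> c" "odd (count ?\<kappa> c)"
      have "c \<notin> set I" using I c(1) by auto
      then have "count (mset I) c = 0" by (simp add: count_eq_zero_iff)
      moreover have "c \<noteq> 0" using c(1) Q_ge_2 by simp
      ultimately have eq: "count ?\<kappa> c = count (mset J) c" by simp
      show False using c(2) even_count_pairs[OF J, of c] unfolding eq by blast
    qed
    moreover have "size ?\<kappa> = q" using len by simp
    ultimately show "s \<in> good_msyms" unfolding s s_IJ_eq[OF len] good_msyms_def by blast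
  qed
  show "good_msyms \<subseteq> ?B"
  proof
    fix s assume "s \<in> good_msyms"
    then obtain \<kappa> where \<kappa>: "s = cf (msym \<kappa>)" "size \<kappa> = q" "\<not> bad \<kappa>" unfolding good_msyms_def by blast
    have "even (count \<kappa> c)" if "c \<ge> Q" for c using \<kappa>(3) that unfolding bad_def by blast
    from mset_eq_pairs[of Q \<kappa>, OF this] obtain I J where IJ: "sorted_wrt (<) I" "\<forall>i\<in>set I. 0 < i \<and> i < Q"
      "even (length J)" "sorted J" "\<forall>k < length J div 2. J ! (2 * k) = J ! (2 * k + 1)"
      "\<kappa> = mset (I @ J) + replicate_mset (count \<kappa> 0) 0" .
    have "q = length (I @ J) + count \<kappa> 0"
      using \<kappa>(2) arg_cong[OF IJ(6), of size] by simp
    then have len: "length I + length J \<le> q" "count \<kappa> 0 = q - length (I @ J)" by simp_all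
    have "s = s_IJ q I J" unfolding s_IJ_eq[OF len(1)] \<kappa>(1) len(2)[symmetric] IJ(6)[symmetric] ..
    then show "s \<in> ?B" using len(1) IJ by blast
  qed
qed

lemma good_nonzero:
  assumes "s \<in> good_msyms"
  shows "\<exists>M. s M \<noteq> 0"
proof -
  obtain \<kappa> where \<kappa>: "s = cf (msym \<kappa>)" "size \<kappa> = q" using assms unfolding good_msyms_def by blast
  let ?es = "sorted_list_of_multiset \<kappa>"
  have l: "length ?es = q" using \<kappa>(2) by (metis mset_sorted_list_of_multiset size_mset)
  then have le: "length ?es \<le> q" by simp
  have "keys (monom_of_list ?es) \<subseteq> {1..q}" "expo (monom_of_list ?es) = \<kappa>"
    using monom_of_list_props[OF le] l by simp_all
  then have "s (monom_of_list ?es) \<noteq> 0" unfolding \<kappa>(1) by (simp add: cf_msym)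
  then show ?thesis by blast
qed

lemma good_msyms_basis:
  assumes q: "q \<ge> 1"
  shows "is_topological_basis n q good_msyms"
  unfolding is_topological_basis_def
proof (intro conjI allI ballI)
  show "good_msyms \<subseteq> carrier R" by (rule good_carrier)
  fix d r assume "r \<in> qp ` {f \<in> carrier R. degrees n f \<subseteq> {d}}"
  then obtain f where f: "f \<in> carrier R" "degrees n f \<subseteq> {d}" and r: "r = qp f" by blast
  from normal_form_exists[OF q f] obtain b where b: "symq b" "cf b \<in> carrier R"
    "\<forall>M. cf b M \<noteq> 0 \<longrightarrow> \<not> bad (expo M)" "qp f = qp (cf b)"
    "\<forall>s\<in>good_msyms. degrees n (cf (cst (nf b s) * Ps s)) \<subseteq> {d}" by blast
  have prod_eq: "mps_const x \<otimes>\<^bsub>R\<^esub> s = cf (cst x * Ps s)" for x s by (simp add: R_simps cst_def)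
  show "\<exists>!a. (\<forall>s. s \<notin> good_msyms \<longrightarrow> a s = 0) \<and>
      (\<forall>s\<in>good_msyms. degrees n (mps_const (a s) \<otimes>\<^bsub>R\<^esub> s) \<subseteq> {d}) \<and>
      limitin (K_quot_topology n q) (qsum a) r
        (finite_subsets_at_top good_msyms)"
  proof (rule ex1I[of _ "nf b"], intro conjI)
    show "\<forall>s. s \<notin> good_msyms \<longrightarrow> nf b s = 0" by (simp add: nf_def)
    show "\<forall>s\<in>good_msyms. degrees n (mps_const (nf b s) \<otimes>\<^bsub>R\<^esub> s) \<subseteq> {d}" unfolding prod_eq by (rule b(5))
    show lim: "limitin (K_quot_topology n q) (qsum (nf b)) r
        (finite_subsets_at_top good_msyms)"
      unfolding r b(4) by (rule limitin_nf[OF b(1,2)]) (use b(3) in blast)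
    fix a
    assume a: "(\<forall>s. s \<notin> good_msyms \<longrightarrow> a s = 0) \<and>
      (\<forall>s\<in>good_msyms. degrees n (mps_const (a s) \<otimes>\<^bsub>R\<^esub> s) \<subseteq> {d}) \<and>
      limitin (K_quot_topology n q) (qsum a) r
        (finite_subsets_at_top good_msyms)"
    show "a = nf b"
    proof
      fix s
      show "a s = nf b s"
      proof (cases "s \<in> good_msyms")
        case True
        then obtain M where M: "s M \<noteq> 0" using good_nonzero by blast
        show ?thesis
        proof (rule limit_coefficient_unique[OF f(1) _ _ _ _ True M])
          show "\<forall>s\<in>good_msyms. degrees n (mps_const (a s) \<otimes>\<^bsub>R\<^esub> s) \<subseteq> {d}" using a by blast
          show "\<forall>s\<in>good_msyms. degrees n (mps_const (nf b s) \<otimes>\<^bsub>R\<^esub> s) \<subseteq> {d}" unfolding prod_eq by (rule b(5))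
          show "limitin (K_quot_topology n q) (qsum a) (qp f)
            (finite_subsets_at_top good_msyms)" using a r by blast
          show "limitin (K_quot_topology n q) (qsum (nf b)) (qp f)
            (finite_subsets_at_top good_msyms)" using lim unfolding r .
        qed
      next
        case False
        then show ?thesis using a by (simp add: nf_def)
      qed
    qed
  qed
qed

end

theorem theorem5p1:
  fixes n q :: nat
  assumes "n \<ge> 1" and "q \<ge> 1"
  shows "is_topological_basis n q
    {s_IJ q I J | I J.
       length I + length J \<le> q \<and> even (length J) \<and>
       sorted_wrt (<) I \<and> (\<forall>i\<in>set I. 0 < i \<and> i < 2 ^ n) \<and>
       sorted J \<and> (\<forall>k < length J div 2. J ! (2 * k) = J ! (2 * k + 1))}"
proof -
  interpret morava_sym n q by unfold_locales (rule assms(1))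
  show ?thesis unfolding s_IJ_set_eq by (rule good_msyms_basis[OF assms(2)])
qed

end
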